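(* Let $\mathcal{T}$ be a primitive substitution tiling in $\mathbb{R}^d$ with expansion map $Q$ and tile-substitution $\omega$, and let $\mu$ be the unique invariant Borel probability measure of $(X_\mathcal{T},\mathbb{R}^d)$. For $\alpha\in\mathbb{R}^d$ consider the conditions $$\text{(a)}\quad \lim_{n\to\infty}e^{2\pi i\langle Q^nz,\alpha\rangle}=1\ \text{ for all }z\in\Xi_{\rm legal}(\mathcal{T}),\qquad\text{(b)}\quad e^{2\pi i\langle g,\alpha\rangle}=1\ \text{ for all }g\in\mathcal{K}(\mathcal{T}).$$ (i) If $\alpha\in\mathbb{R}^d$ is an eigenvalue of the measure-preserving system $(X_\mathcal{T},\mathbb{R}^d,\mu)$, then (a) and (b) hold. (ii) Suppose, in addition, that $\mathcal{T}$ is repetitive, the tile-substitution $\omega$ is recognizable modulo periods, and all the eigenvalues of $Q$ are algebraic integers. If $\alpha\in\mathbb{R}^d$ satisfies (a) and (b), then $\alpha$ is an eigenvalue of $(X_\mathcal{T},\mathbb{R}^d,\mu)$, and the eigenfunction can be chosen continuous.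
   Context: Prototiles $T_i=(A_i,i)$, $1\le i\le\kappa$: $A_i\subset\mathbb{R}^d$ is nonempty, compact, and the closure of its interior; $i$ is the type. A tile of type $i$ is a translate $g+T_i=(g+A_i,i)$. A tiling is a set of tiles whose supports cover $\mathbb{R}^d$ and such that distinct tiles have supports with disjoint interiors. A patch is a finite nonempty set of tiles with mutually disjoint interiors. A linear map $Q$ on $\mathbb{R}^d$ is expansive if all its (real and complex) eigenvalues have modulus $>1$. A tile-substitution $\omega$ with expansive map $Q$ is given by finite sets $\mathcal{D}_{ij}\subset\mathbb{R}^d$ with $\omega(T_j)=\{u+T_i:u\in\mathcal{D}_{ij},i\le\kappa\}$ and $QA_j=\bigcup_{i=1}^\kappa(\mathcal{D}_{ij}+A_i)$, where all the sets $u+A_i$ ($u\in\mathcal{D}_{ij}$, $i\le\kappa$) have disjoint interiors. It is extended by $\omega(T_j+x)=\omega(T_j)+Qx$ and $\omega(S)=\bigcup_{T\in S}\omega(T)$ for patches and tilings $S$ made of translates of prototiles. A substitution tiling with expansion map $Q$ is a tiling $\mathcal{T}$ by translates of the prototiles with $\omega(\mathcal{T})=\mathcal{T}$; it is primitive if some positive power of the matrix $(\#\mathcal{D}_{ij})_{i,j}$ has no zero entries. Finite local complexity is not assumed. For a tiling $\mathcal{S}$ by translates of the prototiles let $\Lambda(\mathcal{S})=\{(x,i):x+T_i\in\mathcal{S}\}$. For coloured sets, intersection with $B_r(0)$ and addition of $B_\epsilon(0)$ are applied to the $\mathbb{R}^d$-coordinate, keeping colours. Metric: $d(\mathcal{S}_1,\mathcal{S}_2)=\min\{2^{-1/2},\inf\{\epsilon>0:B_{1/\epsilon}(0)\cap\Lambda(\mathcal{S}_2)\subset\Lambda(\mathcal{S}_1)+B_\epsilon(0),\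 B_{1/\epsilon}(0)\cap\Lambda(\mathcal{S}_1)\subset\Lambda(\mathcal{S}_2)+B_\epsilon(0)\}\}$. $X_\mathcal{T}$ is the closure of $\{\mathcal{T}-g:g\in\mathbb{R}^d\}$ in the space of tilings by translates of the prototiles; it is compact, $\mathbb{R}^d$ acts by $\mathcal{S}\mapsto\mathcal{S}-g$, and for primitive $\omega$ this system is uniquely ergodic. $\omega$ extends to a continuous surjection $X_\mathcal{T}\to X_\mathcal{T}$. A patch is legal if it is a translate of a subpatch of $\omega^k(T_i)$ for some $k\in\mathbb{N}$, $i\le\kappa$. $\Xi_{\rm legal}(\mathcal{T})$ is the set of $x\in\mathbb{R}^d$ such that there are a legal patch $P\subset\mathcal{T}$ and $T,T'\in P$ with $T'=T+x$. $\mathcal{K}(\mathcal{T})=\{x\in\mathbb{R}^d:\mathcal{T}-x=\mathcal{T}\}$ is the group of periods. $\mathcal{T}$ is repetitive if for every patch $P\subset\mathcal{T}$ there is $M>0$ such that every ball of radius $M$ contains (the support of) a translate of $P$ belonging to $\mathcal{T}$. $\omega$ is recognizable modulo periods if for $\mathcal{S},\mathcal{S}'\in X_\mathcal{T}$, $\omega(\mathcal{S})=\omega(\mathcal{S}')$ implies $\mathcal{S}'=\mathcal{S}-Q^{-1}x$ for some $x\in\mathcal{K}(\mathcal{T})$. $\alpha\in\mathbb{R}^d$ is an eigenvalue of $(X_\mathcal{T},\mathbb{R}^d,\mu)$ if there is a nonzero $f\in L^2(X_\mathcal{T},\mu)$ (an eigenfunction) with $f(\mathcal{S}-x)=e^{2\pi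 i\langle x,\alpha\rangle}f(\mathcal{S})$ for all $x\in\mathbb{R}^d$ and $\mu$-a.e. $\mathcal{S}$. *)

theory Defs
  imports "HOL-Analysis.Analysis" "HOL-Probability.Probability"
    "HOL-Computational_Algebra.Polynomial"
begin

section \<open>Tiles, tilings and patches\<close>

text \<open>A tile is a pair of a support in $R^d$ and a type; the types range over the finite index
  type \<open>'k\<close>, so that the number of prototiles is the cardinality of \<open>'k\<close>.\<close>

type_synonym ('n, 'k) tile = "(real^'n) set \<times> 'k"

definition prototiles :: "('k::finite \<Rightarrow> (real^'n) set) \<Rightarrow> bool" where
  "prototiles A \<longleftrightarrow> (\<forall>i. A i \<noteq> {} \<and> compact (A i) \<and> closure (interior (A i)) = A i)"

definition shift_tile :: "real^'n \<Rightarrow> ('n, 'k) tile \<Rightarrow> ('n, 'k) tile" where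
  "shift_tile g t = ((\<lambda>a. g + a) ` fst t, snd t)"

definition shift_tiles :: "real^'n \<Rightarrow> ('n, 'k) tile set \<Rightarrow> ('n, 'k) tile set" where
  "shift_tiles g S = shift_tile g ` S"

definition prototile :: "('k::finite \<Rightarrow> (real^'n) set) \<Rightarrow> 'k \<Rightarrow> ('n, 'k) tile" where
  "prototile A i = (A i, i)"

definition tiles :: "('k::finite \<Rightarrow> (real^'n) set) \<Rightarrow> ('n, 'k) tile set" where
  "tiles A = {shift_tile x (prototile A i) | x i. True}"

definition disjoint_interiors :: "('n::finite, 'k) tile set \<Rightarrow> bool" where
  "disjoint_interiors S \<longleftrightarrow> pairwise (\<lambda>t t'. interior (fst t) \<inter> interior (fst t') = {}) S"

definition tilings :: "('k::finite \<Rightarrow> (real^'n) set) \<Rightarrow> ('n, 'k) tile set set" where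
  "tilings A = {S. S \<subseteq> tiles A \<and> (\<Union>t\<in>S. fst t) = UNIV \<and> disjoint_interiors S}"

definition patch :: "('k::finite \<Rightarrow> (real^'n) set) \<Rightarrow> ('n, 'k) tile set \<Rightarrow> bool" where
  "patch A P \<longleftrightarrow> P \<subseteq> tiles A \<and> finite P \<and> P \<noteq> {} \<and> disjoint_interiors P"

definition Lam :: "('k::finite \<Rightarrow> (real^'n) set) \<Rightarrow> ('n, 'k) tile set \<Rightarrow> ((real^'n) \<times> 'k) set" where
  "Lam A S = {(x, i). shift_tile x (prototile A i) \<in> S}"


section \<open>Tile-substitutions\<close>

definition complex_eigenvalue :: "(real^'n \<Rightarrow> real^'n) \<Rightarrow> complex \<Rightarrow> bool" where
  "complex_eigenvalue Q z \<longleftrightarrow>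
     (\<exists>v::complex^'n. v \<noteq> 0 \<and> (\<chi> i j. complex_of_real (matrix Q $ i $ j)) *v v = z *s v)"

definition expansive :: "(real^'n \<Rightarrow> real^'n) \<Rightarrow> bool" where
  "expansive Q \<longleftrightarrow> linear Q \<and> (\<forall>z. complex_eigenvalue Q z \<longrightarrow> cmod z > 1)"

definition tile_substitution ::
    "('k::finite \<Rightarrow> (real^'n) set) \<Rightarrow> (real^'n \<Rightarrow> real^'n) \<Rightarrow> ('k \<Rightarrow> 'k \<Rightarrow> (real^'n) set) \<Rightarrow> bool" where
  "tile_substitution A Q D \<longleftrightarrow>
     prototiles A \<and> expansive Q \<and> (\<forall>i j. finite (D i j)) \<and>
     (\<forall>j. Q ` A j = (\<Union>i. \<Union>u\<in>D i j. (\<lambda>a. u + a) ` A i)) \<and>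
     (\<forall>j i u i' u'. u \<in> D i j \<longrightarrow> u' \<in> D i' j \<longrightarrow> (u, i) \<noteq> (u', i') \<longrightarrow>
        interior ((\<lambda>a. u + a) ` A i) \<inter> interior ((\<lambda>a. u' + a) ` A i') = {})"

definition subst_proto ::
    "('k::finite \<Rightarrow> (real^'n) set) \<Rightarrow> ('k \<Rightarrow> 'k \<Rightarrow> (real^'n) set) \<Rightarrow> 'k \<Rightarrow> ('n, 'k) tile set" where
  "subst_proto A D j = {shift_tile u (prototile A i) | u i. u \<in> D i j}"

definition tile_subst ::
    "('k::finite \<Rightarrow> (real^'n) set) \<Rightarrow> (real^'n \<Rightarrow> real^'n) \<Rightarrow> ('k \<Rightarrow> 'k \<Rightarrow> (real^'n) set) \<Rightarrow>
     ('n, 'k) tile set \<Rightarrow> ('n, 'k) tile set" where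
  "tile_subst A Q D S = (\<Union>(x, j)\<in>Lam A S. shift_tiles (Q x) (subst_proto A D j))"

definition substitution_tiling ::
    "('k::finite \<Rightarrow> (real^'n) set) \<Rightarrow> (real^'n \<Rightarrow> real^'n) \<Rightarrow> ('k \<Rightarrow> 'k \<Rightarrow> (real^'n) set) \<Rightarrow>
     ('n, 'k) tile set \<Rightarrow> bool" where
  "substitution_tiling A Q D T \<longleftrightarrow>
     tile_substitution A Q D \<and> T \<in> tilings A \<and> tile_subst A Q D T = T"

definition subst_matrix :: "('k::finite \<Rightarrow> 'k \<Rightarrow> (real^'n) set) \<Rightarrow> nat^'k^'k" where
  "subst_matrix D = (\<chi> i j. card (D i j))"

definition primitive :: "('k::finite \<Rightarrow> 'k \<Rightarrow> (real^'n) set) \<Rightarrow> bool" where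
  "primitive D \<longleftrightarrow>
     (\<exists>m>0. \<forall>i j. (((\<lambda>N. subst_matrix D ** N) ^^ m) (mat 1)) $ i $ j \<noteq> 0)"


section \<open>The tiling space and its dynamics\<close>

definition close_tilings ::
    "('k::finite \<Rightarrow> (real^'n) set) \<Rightarrow> real \<Rightarrow> ('n, 'k) tile set \<Rightarrow> ('n, 'k) tile set \<Rightarrow> bool" where
  "close_tilings A \<epsilon> S1 S2 \<longleftrightarrow>
     (ball 0 (1 / \<epsilon>) \<times> UNIV) \<inter> Lam A S2 \<subseteq> {(x + y, i) | x y i. (x, i) \<in> Lam A S1 \<and> y \<in> ball 0 \<epsilon>} \<and>
     (ball 0 (1 / \<epsilon>) \<times> UNIV) \<inter> Lam A S1 \<subseteq> {(x + y, i) | x y i. (x, i) \<in> Lam A S2 \<and> y \<in> ball 0 \<epsilon>}"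

text \<open>The minimum of $2^{-1/2}$ and an infimum is written as one infimum, because the set of
  admissible \<open>\<epsilon>\<close> may be empty (its infimum is then $+\infty$) and \<open>Inf {}\<close> is unspecified on the
  reals.\<close>

definition tiling_dist ::
    "('k::finite \<Rightarrow> (real^'n) set) \<Rightarrow> ('n, 'k) tile set \<Rightarrow> ('n, 'k) tile set \<Rightarrow> real" where
  "tiling_dist A S1 S2 = Inf (insert (1 / sqrt 2) {\<epsilon>. \<epsilon> > 0 \<and> close_tilings A \<epsilon> S1 S2})"

definition tilings_topology ::
    "('k::finite \<Rightarrow> (real^'n) set) \<Rightarrow> ('n, 'k) tile set topology" where
  "tilings_topology A = Metric_space.mtopology (tilings A) (tiling_dist A)"

definition tiling_hull ::
    "('k::finite \<Rightarrow> (real^'n) set) \<Rightarrow> ('n, 'k) tile set \<Rightarrow> ('n, 'k) tile set set" where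
  "tiling_hull A T = tilings_topology A closure_of {shift_tiles (- g) T | g. True}"

definition hull_topology ::
    "('k::finite \<Rightarrow> (real^'n) set) \<Rightarrow> ('n, 'k) tile set \<Rightarrow> ('n, 'k) tile set topology" where
  "hull_topology A T = subtopology (tilings_topology A) (tiling_hull A T)"

definition hull_borel ::
    "('k::finite \<Rightarrow> (real^'n) set) \<Rightarrow> ('n, 'k) tile set \<Rightarrow> ('n, 'k) tile set measure" where
  "hull_borel A T = sigma (tiling_hull A T) {U. openin (hull_topology A T) U}"

definition invariant_prob ::
    "('k::finite \<Rightarrow> (real^'n) set) \<Rightarrow> ('n, 'k) tile set \<Rightarrow> ('n, 'k) tile set measure \<Rightarrow> bool" where
  "invariant_prob A T \<mu> \<longleftrightarrow>
     prob_space \<mu> \<and> space \<mu> = tiling_hull A T \<and> sets \<mu> = sets (hull_borel A T) \<and>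
     (\<forall>g. shift_tiles (- g) \<in> measurable \<mu> \<mu> \<and> distr \<mu> \<mu> (shift_tiles (- g)) = \<mu>)"

definition unit_char :: "real^'n \<Rightarrow> real^'n \<Rightarrow> complex" where
  "unit_char \<alpha> x = exp (2 * complex_of_real pi * \<i> * complex_of_real (x \<bullet> \<alpha>))"

definition eigenfunction ::
    "('n::finite, 'k) tile set measure \<Rightarrow> real^'n \<Rightarrow> (('n, 'k) tile set \<Rightarrow> complex) \<Rightarrow> bool" where
  "eigenfunction \<mu> \<alpha> f \<longleftrightarrow>
     f \<in> borel_measurable \<mu> \<and> integrable \<mu> (\<lambda>S. (cmod (f S))\<^sup>2) \<and> \<not> (AE S in \<mu>. f S = 0) \<and>
     (\<forall>x. AE S in \<mu>. f (shift_tiles (- x) S) = unit_char \<alpha> x * f S)"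

definition dyn_eigenvalue :: "('n::finite, 'k) tile set measure \<Rightarrow> real^'n \<Rightarrow> bool" where
  "dyn_eigenvalue \<mu> \<alpha> \<longleftrightarrow> (\<exists>f. eigenfunction \<mu> \<alpha> f)"


section \<open>Return vectors, periods, repetitivity, recognizability\<close>

definition legal ::
    "('k::finite \<Rightarrow> (real^'n) set) \<Rightarrow> (real^'n \<Rightarrow> real^'n) \<Rightarrow> ('k \<Rightarrow> 'k \<Rightarrow> (real^'n) set) \<Rightarrow>
     ('n, 'k) tile set \<Rightarrow> bool" where
  "legal A Q D P \<longleftrightarrow>
     patch A P \<and> (\<exists>g k i. P \<subseteq> shift_tiles g ((tile_subst A Q D ^^ k) {prototile A i}))"

definition Xi_legal ::
    "('k::finite \<Rightarrow> (real^'n) set) \<Rightarrow> (real^'n \<Rightarrow> real^'n) \<Rightarrow> ('k \<Rightarrow> 'k \<Rightarrow> (real^'n) set) \<Rightarrow>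
     ('n, 'k) tile set \<Rightarrow> (real^'n) set" where
  "Xi_legal A Q D T =
     {x. \<exists>P. legal A Q D P \<and> P \<subseteq> T \<and> (\<exists>t\<in>P. \<exists>t'\<in>P. t' = shift_tile x t)}"

definition periods :: "('n::finite, 'k) tile set \<Rightarrow> (real^'n) set" where
  "periods T = {x. shift_tiles (- x) T = T}"

definition repetitive :: "('k::finite \<Rightarrow> (real^'n) set) \<Rightarrow> ('n, 'k) tile set \<Rightarrow> bool" where
  "repetitive A T \<longleftrightarrow>
     (\<forall>P. patch A P \<and> P \<subseteq> T \<longrightarrow>
        (\<exists>M>0. \<forall>y. \<exists>g. shift_tiles g P \<subseteq> T \<and> (\<Union>t\<in>shift_tiles g P. fst t) \<subseteq> ball y M))"

text \<open>\<open>inv Q\<close> is the inverse linear map: an expansive map is invertible.\<close>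

definition recognizable_mod_periods ::
    "('k::finite \<Rightarrow> (real^'n) set) \<Rightarrow> (real^'n \<Rightarrow> real^'n) \<Rightarrow> ('k \<Rightarrow> 'k \<Rightarrow> (real^'n) set) \<Rightarrow>
     ('n, 'k) tile set \<Rightarrow> bool" where
  "recognizable_mod_periods A Q D T \<longleftrightarrow>
     (\<forall>S\<in>tiling_hull A T. \<forall>S'\<in>tiling_hull A T. tile_subst A Q D S = tile_subst A Q D S' \<longrightarrow>
        (\<exists>x\<in>periods T. S' = shift_tiles (- (inv Q x)) S))"

definition legal_limit_condition ::
    "('k::finite \<Rightarrow> (real^'n) set) \<Rightarrow> (real^'n \<Rightarrow> real^'n) \<Rightarrow> ('k \<Rightarrow> 'k \<Rightarrow> (real^'n) set) \<Rightarrow>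
     ('n, 'k) tile set \<Rightarrow> real^'n \<Rightarrow> bool" where
  "legal_limit_condition A Q D T \<alpha> \<longleftrightarrow>
     (\<forall>z\<in>Xi_legal A Q D T. (\<lambda>n. unit_char \<alpha> ((Q ^^ n) z)) \<longlonglongrightarrow> 1)"

definition period_condition :: "('n::finite, 'k) tile set \<Rightarrow> real^'n \<Rightarrow> bool" where
  "period_condition T \<alpha> \<longleftrightarrow> (\<forall>g\<in>periods T. unit_char \<alpha> g = 1)"

end

theory Submission
  imports Defs "HOL-Computational_Algebra.Fundamental_Theorem_Algebra"
    "HOL-Library.Diagonal_Subsequence"
begin

text \<open>Let \<open>\<chi>\<close> be the character of \<open>\<alpha>\<close>.

  (i) If \<open>t\<close> and \<open>t + z\<close> lie in a legal patch then, by primitivity, copies of the pair occur in every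
  tiling of the hull with bounded gaps; applying \<open>\<omega>\<^sup>n\<close> gives a finite set \<open>F\<close>, independent of \<open>n\<close>, such
  that every \<open>S\<close> has a translate \<open>S - Q\<^sup>n x\<close>, \<open>x \<in> F\<close>, that nearly agrees with its own translate by
  \<open>Q\<^sup>n z\<close>. Hence for every invariant measure the tilings that nearly agree with their translate by
  \<open>Q\<^sup>n z\<close> fill a proportion at least \<open>1 / card F\<close> of any invariant set, and on most of them an
  eigenfunction can hardly change; this forces \<open>\<chi> (Q\<^sup>n z)\<close> to be close to 1. No ergodicity is needed.

  (ii) The orbit of \<open>u\<close> under \<open>Q\<close> satisfies a monic integer recurrence, so \<open>\<chi> (Q\<^sup>n u)\<close> tends to 1
  geometrically. A return vector of \<open>T\<close> is a sum of terms \<open>Q\<^sup>j u\<close> with \<open>u\<close> from a fixed finite set of return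
  vectors (descend through the supertiles until both tiles lie near the origin), so the convergence is
  uniform over all return vectors. If \<open>T - x\<close> and \<open>T - y\<close> are close, recognizability and compactness
  make their \<open>n\<close>-fold desubstitutions close up to a period, so \<open>y - x\<close> is, up to a period and a small
  error, \<open>Q\<^sup>n\<close> of a return vector. Therefore \<open>T - x \<mapsto> \<chi> x\<close> is uniformly continuous on the orbit and
  extends to the hull.\<close>

section \<open>Linear recurrences\<close>

text \<open>Tilings are handled through their coloured position sets, on which the substitution is
  the explicit rule \<open>(x, j) \<mapsto> (Q x + u, i)\<close> with \<open>u \<in> D i j\<close>;
  supports return only where overlaps or coverings matter. A translate of \<open>T\<close>
  desubstitutes explicitly, because \<open>T\<close> is fixed, so assertions about all tilings of
  the hull are phrased as closed conditions and tested on translates of \<open>T\<close>. In (i) the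
  obstacle is that closeness of a tiling to its translate by \<open>v\<close> says nothing by itself
  about a merely measurable function, and \<open>v = Q^n z\<close> is unbounded. It is met by
  bounding, for a measurable set \<open>B\<close> and uniformly in \<open>v\<close>, the measure of
  the tilings that are close to their translate by \<open>v\<close> while exactly one of the two
  lies in \<open>B\<close>. In (ii) the obstacle is the absence of finite local complexity: close
  tilings agree only up to small displacements, which \<open>Q^n\<close> magnifies. Hence the level
  \<open>n\<close> is fixed by the return vectors before any closeness is chosen.\<close>

text \<open>The polynomial \<open>p\<close> acts on sequences as \<open>p(E)\<close>, where \<open>E\<close> is the shift.\<close>

definition seq_act :: "complex poly \<Rightarrow> (nat \<Rightarrow> complex) \<Rightarrow> nat \<Rightarrow> complex" where
  "seq_act p s n = (\<Sum>i\<le>degree p. coeff p i * s (n + i))"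

lemma seq_act_eq:
  assumes "degree p \<le> N" shows "seq_act p s n = (\<Sum>i\<le>N. coeff p i * s (n + i))"
  unfolding seq_act_def using assms
  by (intro sum.mono_neutral_left) (auto simp: coeff_eq_0)

lemma seq_act_0 [simp]: "seq_act 0 s = (\<lambda>n. 0)"
  by (simp add: seq_act_def fun_eq_iff)

lemma seq_act_add: "seq_act (p + q) s n = seq_act p s n + seq_act q s n"
proof -
  define N where "N = max (degree p) (degree q)"
  have "degree (p + q) \<le> N" "degree p \<le> N" "degree q \<le> N"
    by (auto simp: N_def degree_add_le_max)
  then show ?thesis
    by (simp add: seq_act_eq[of _ N] distrib_right sum.distrib)
qed

lemma seq_act_smult: "seq_act (smult a p) s n = a * seq_act p s n"
  by (simp add: seq_act_eq[of "smult a p" "degree p"] degree_smult_le seq_act_def sum_distrib_left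
      mult.assoc)

lemma seq_act_pCons: "seq_act (pCons a p) s n = a * s n + seq_act p s (Suc n)"
proof -
  have "seq_act (pCons a p) s n = (\<Sum>i\<le>Suc (degree p). coeff (pCons a p) i * s (n + i))"
    by (rule seq_act_eq) (simp add: degree_pCons_le)
  also have "\<dots> = a * s n + seq_act p s (Suc n)"
    unfolding seq_act_def by (subst sum.atMost_Suc_shift) simp
  finally show ?thesis .
qed

text \<open>Polynomials in the shift compose, so a linear factor of a recurrence can be split
  off.\<close>

lemma seq_act_mult: "seq_act (p * q) s = seq_act p (seq_act q s)"
proof (induction p)
  case (pCons a p)
  have "seq_act (pCons a p * q) s n = a * seq_act q s n + seq_act (p * q) s (Suc n)" for n
    by (simp add: mult_pCons_left seq_act_add seq_act_smult seq_act_pCons)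
  then show ?case
    using pCons by (simp add: fun_eq_iff seq_act_pCons)
qed simp

lemma seq_act_sum: "seq_act p (\<lambda>n. \<Sum>j\<in>J. c j * s j n) n = (\<Sum>j\<in>J. c j * seq_act p (s j) n)"
  unfolding seq_act_def
  by (simp add: sum_distrib_left mult.left_commute) (rule sum.swap)

lemma seq_act_shift: "seq_act p (\<lambda>n. s (n + k)) n = seq_act p s (n + k)"
  unfolding seq_act_def by (simp add: add.assoc add.left_commute add.commute)

text \<open>Splitting off a root \<open>z\<close> leaves a recurrence of smaller degree for
  \<open>t = (E - z) s\<close>. The relation \<open>s (n + 1) = z * s n + t n\<close> is then solved
  forwards if \<open>z\<close> lies in the open unit disc, and otherwise backwards from infinity,
  where \<open>s\<close> has to vanish. The two alternatives in the hypothesis serve two uses: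
  orbits of \<open>inv Q\<close>, whose roots are known, and fractional parts, known only to
  converge.\<close>

lemma linear_recurrence_geometric_decay:
  assumes "p \<noteq> 0" "\<And>n. seq_act p s n = 0"
    and "s \<longlonglongrightarrow> 0 \<or> (\<forall>z. poly p z = 0 \<longrightarrow> cmod z < 1)"
  shows "\<exists>C r. 0 < r \<and> r < 1 \<and> (\<forall>n. cmod (s n) \<le> C * r ^ n)"
  using assms
proof (induction "degree p" arbitrary: p s)
  case 0
  then obtain c where "p = [:c:]" by (metis degree_eq_zeroE)
  with 0 have "s n = 0" for n by (simp add: seq_act_pCons)
  then show ?case by (intro exI[of _ 0] exI[of _ "1/2"]) simp
next
  case (Suc d)
  then obtain z where z: "poly p z = 0"
    by (metis Fundamental_Theorem_Algebra.fundamental_theorem_of_algebra constant_degree nat.distinct(1))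
  then obtain q where q: "p = q * [:-z, 1:]"
    by (metis dvdE mult.commute poly_eq_0_iff_dvd)
  have "q \<noteq> 0" using q Suc.prems(1) by auto
  have "degree q = d"
    using Suc.hyps(2) \<open>q \<noteq> 0\<close> unfolding q by (subst (asm) degree_mult_eq) auto
  define t where "t = seq_act [:-z, 1:] s"
  have t: "t n = s (Suc n) - z * s n" for n
    by (simp add: t_def seq_act_pCons)
  have "t \<longlonglongrightarrow> 0 \<or> (\<forall>z. poly q z = 0 \<longrightarrow> cmod z < 1)"
  proof (cases "s \<longlonglongrightarrow> 0")
    case True
    have "(\<lambda>n. s (Suc n) - z * s n) \<longlonglongrightarrow> 0 - z * 0"
      by (intro tendsto_intros True LIMSEQ_Suc)
    then show ?thesis by (simp add: t[abs_def])
  next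
    case False
    then show ?thesis using Suc.prems(3) by (auto simp: q)
  qed
  moreover have "seq_act q t n = 0" for n
    using Suc.prems(2)[of n] unfolding q seq_act_mult t_def .
  ultimately obtain C r where r: "0 < r" "r < 1" and C: "\<And>n. cmod (t n) \<le> C * r ^ n"
    using Suc.hyps(1)[of q t] \<open>degree q = d\<close> \<open>q \<noteq> 0\<close> by blast
  have "C \<ge> 0" using order_trans[OF norm_ge_zero C[of 0]] by simp
  show ?case
  proof (cases "cmod z < 1")
    case True
    define m where "m = max r (cmod z)"
    \<comment> \<open>The rate lies strictly above both \<open>r\<close> and \<open>cmod z\<close>,
      so that a coincidence of these two produces no extra factor growing with
      \<open>n\<close>.\<close>
    define k where "k = (m + 1) / 2"
    have k: "m < k" "k < 1" "0 < k" using r True by (auto simp: m_def k_def)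
    \<comment> \<open>The second entry is the least constant with
      \<open>m * K + C \<le> k * K\<close>, the inequality that carries the induction.\<close>
    define K where "K = max (cmod (s 0)) (C / (k - m))"
    have "cmod (s n) \<le> K * k ^ n" for n
    proof (induction n)
      case 0 show ?case by (simp add: K_def)
    next
      case (Suc n)
      have "cmod (s (Suc n)) \<le> cmod z * cmod (s n) + cmod (t n)"
        using norm_triangle_ineq[of "z * s n" "t n"] by (simp add: t norm_mult)
      also have "\<dots> \<le> m * (K * k ^ n) + C * k ^ n"
      proof (intro add_mono mult_mono)
        show "cmod (t n) \<le> C * k ^ n"
          using C[of n] \<open>C \<ge> 0\<close> r k power_mono[of r k n]
          by (smt (verit, best) m_def mult_left_mono)
      qed (use Suc m_def r in auto)
      also have "C \<le> K * (k - m)"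
        using k by (simp add: K_def field_simps max_def)
      then have "m * (K * k ^ n) + C * k ^ n \<le> m * (K * k ^ n) + K * (k - m) * k ^ n"
        using k by (intro add_left_mono mult_right_mono) auto
      also have "\<dots> = K * k ^ Suc n" by (simp add: algebra_simps)
      finally show ?case .
    qed
    then show ?thesis using k by blast
  next
    case False
    then have lim: "s \<longlonglongrightarrow> 0" using Suc.prems(3) z by blast
    \<comment> \<open>Dividing by \<open>z\<close> does not enlarge anything here, so going
      backwards costs one term of a geometric series per index.\<close>
    have step: "cmod (s n) \<le> cmod (s (Suc n)) + C * r ^ n" for n
    proof -
      have "cmod (s n) \<le> cmod (z * s n)" using False
        by (simp add: norm_mult mult_le_cancel_right1)
      also have "\<dots> = cmod (s (Suc n) - t n)" by (simp add: t)
      also have "\<dots> \<le> cmod (s (Suc n)) + C * r ^ n"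
        using norm_triangle_ineq4[of "s (Suc n)" "t n"] C[of n] by simp
      finally show ?thesis .
    qed
    have "cmod (s n) \<le> cmod (s (n + N)) + C / (1 - r) * (r ^ n - r ^ (n + N))" for n N
    proof (induction N)
      case (Suc N)
      have "C / (1 - r) * (r ^ n - r ^ (n + N)) + C * r ^ (n + N) =
          C / (1 - r) * (r ^ n - r ^ (n + Suc N))"
        using r by (simp add: field_simps)
      with Suc step[of "n + N"] show ?case by simp
    qed simp
    moreover have "C / (1 - r) * (r ^ n - r ^ (n + N)) \<le> C / (1 - r) * r ^ n" for n N
      using r \<open>C \<ge> 0\<close> by (intro mult_left_mono) auto
    ultimately have "cmod (s n) \<le> cmod (s (n + N)) + C / (1 - r) * r ^ n" for n N
      by (meson add_left_mono order_trans)
    moreover have "(\<lambda>N. cmod (s (n + N)) + C / (1 - r) * r ^ n) \<longlonglongrightarrow> 0 + C / (1 - r) * r ^ n" for n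
      using LIMSEQ_ignore_initial_segment[OF lim, of n]
      by (intro tendsto_intros) (simp add: tendsto_norm_zero add.commute)
    ultimately have "cmod (s n) \<le> 0 + C / (1 - r) * r ^ n" for n
      using LIMSEQ_le_const by blast
    then show ?thesis using r by (intro exI[of _ "C / (1 - r)"] exI[of _ r]) simp
  qed
qed

section \<open>Matrix orbits as solutions of recurrences, and the spectrum of an expansive
  map\<close>

definition complexify :: "real^'n \<Rightarrow> complex^'n" where
  "complexify v = (\<chi> i. complex_of_real (v $ i))"

definition complex_matrix :: "(real^'n \<Rightarrow> real^'n) \<Rightarrow> complex^'n^'n" where
  "complex_matrix Q = (\<chi> i j. complex_of_real (matrix Q $ i $ j))"

lemma complex_matrix_complexify:
  assumes "linear Q" shows "complex_matrix Q *v complexify v = complexify (Q v)"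
proof -
  have "Q v = matrix Q *v v" using assms by (simp add: matrix_works)
  then show ?thesis
    by (simp add: complex_matrix_def complexify_def matrix_vector_mult_def vec_eq_iff)
qed

lemma complex_matrix_funpow:
  assumes "linear Q" shows "((*v) (complex_matrix Q) ^^ n) (complexify v) = complexify ((Q ^^ n) v)"
  by (induction n) (simp_all add: complex_matrix_complexify assms)

text \<open>The vectors \<open>v, M v, ..., M^N v\<close> in dimension \<open>N\<close> are too many
  to be independent. Dependence is a property of a set, which does not see repetitions in the list,
  so a coincidence is treated separately and gives \<open>X^a - X^b\<close>.\<close>

lemma matrix_power_annihilator_exists:
  fixes M :: "complex^'n^'n"
  shows "\<exists>p. p \<noteq> 0 \<and> (\<forall>k. seq_act p (\<lambda>n. ((*v) M ^^ n) v $ k) 0 = 0)"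
proof -
  define V where "V n = ((*v) M ^^ n) v" for n
  define N where "N = CARD('n)"
  show ?thesis
  proof (cases "inj_on V {..N}")
    case False
    then obtain a b where ab: "a \<noteq> b" "V a = V b" by (auto simp: inj_on_def)
    define p :: "complex poly" where "p = monom 1 a + smult (-1) (monom 1 b)"
    have "coeff p a = 1" using ab by (simp add: p_def)
    then have "p \<noteq> 0" by auto
    have mon: "seq_act (monom 1 c) s 0 = s c" for c :: nat and s
    proof -
      have "seq_act (monom 1 c) s 0 = (\<Sum>i\<le>c. if i = c then s c else 0)"
        unfolding seq_act_def degree_monom_eq[OF one_neq_zero] by (intro sum.cong) auto
      then show ?thesis by simp
    qed
    show ?thesis
      using \<open>p \<noteq> 0\<close> ab(2)
      by (intro exI[of _ p]) (simp add: p_def seq_act_add seq_act_smult mon V_def[symmetric] del: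
          smult_minus_left smult_monom)
  next
    case True
    have "vec.dependent (V ` {..N})"
    proof (rule ccontr)
      assume "\<not> vec.dependent (V ` {..N})"
      then have "card (V ` {..N}) \<le> vec.dim (UNIV :: (complex^'n) set)"
        by (intro vec.independent_card_le_dim) auto
      then show False using True by (simp add: card_image N_def vec_dim_card del: vec.dim_UNIV)
    qed
    then obtain u w where u: "(\<Sum>x\<in>V ` {..N}. u x *s x) = 0" "w \<in> V ` {..N}" "u w \<noteq> 0"
      using vec.dependent_finite[of "V ` {..N}"] by auto
    define p where "p = (\<Sum>i\<le>N. monom (u (V i)) i)"
    have coeff: "coeff p i = (if i \<le> N then u (V i) else 0)" for i
      by (simp add: p_def coeff_sum)
    have "p \<noteq> 0" using u coeff by (metis (no_types, lifting) atMost_iff coeff_0 image_iff)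
    have deg: "degree p \<le> N" by (intro degree_le) (simp add: coeff)
    have "(\<Sum>i\<le>N. u (V i) *s V i) = 0"
      using u(1) by (simp add: sum.reindex[OF True])
    then have "(\<Sum>i\<le>N. u (V i) * V i $ k) = 0" for k
      by (metis (mono_tags, lifting) sum.cong sum_component vector_smult_component zero_index)
    then show ?thesis
      using \<open>p \<noteq> 0\<close> by (intro exI[of _ p]) (simp add: seq_act_eq[OF deg] coeff V_def)
  qed
qed

text \<open>The vector with entries \<open>seq_act p (\<lambda>n. V k n v) n\<close> is
  \<open>p(M) M^n v\<close>, so advancing \<open>n\<close> is multiplication by
  \<open>M\<close>.\<close>

lemma seq_act_matrix_shift:
  fixes M :: "complex^'n^'n"
  defines "V \<equiv> \<lambda>k n v. ((*v) M ^^ n) v $ k"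
  shows "seq_act p (\<lambda>n. V k n v) (Suc n) = (\<Sum>j\<in>UNIV. M $ k $ j * seq_act p (\<lambda>n. V j n v) n)"
proof -
  have "seq_act p (\<lambda>n. V k n v) (Suc n) = seq_act p (\<lambda>n. V k (n + 1) v) n"
    by (subst seq_act_shift[of p "\<lambda>n. V k n v" 1]) simp
  also have "(\<lambda>n. V k (n + 1) v) = (\<lambda>n. \<Sum>j\<in>UNIV. M $ k $ j * V j n v)"
    by (simp add: V_def matrix_vector_mult_def)
  finally show ?thesis by (simp add: seq_act_sum)
qed

text \<open>Take \<open>p\<close> of minimal degree: if \<open>p = (X - z) q\<close> then \<open>q(M) v\<close> is an eigenvector for \<open>z\<close>.\<close>

lemma orbit_annihilator:
  fixes M :: "complex^'n^'n"
  obtains p where "p \<noteq> 0" "\<And>k n. seq_act p (\<lambda>n. ((*v) M ^^ n) v $ k) n = 0"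
    "\<And>z. poly p z = 0 \<Longrightarrow> \<exists>w. w \<noteq> 0 \<and> M *v w = z *s w"
proof -
  define V where "V k n = ((*v) M ^^ n) v $ k" for k n
  define P where "P p \<longleftrightarrow> p \<noteq> 0 \<and> (\<forall>k. seq_act p (V k) 0 = 0)" for p
  have all: "seq_act p (V k) n = 0" if "\<forall>k. seq_act p (V k) 0 = 0" for p k n
  proof (induction n arbitrary: k)
    case (Suc n)
    show ?case using seq_act_matrix_shift[where p = p and M = M and k = k and v = v and n = n] Suc
        by (simp add: V_def)
  qed (use that in simp)
  obtain p where p: "P p" and min: "\<And>q. P q \<Longrightarrow> degree p \<le> degree q"
  proof -
    have "\<exists>p. P p" using matrix_power_annihilator_exists[of M v] by (auto simp: P_def V_def[abs_def])
    then obtain p0 where "P p0" ..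
    then obtain p where "P p" "\<forall>q. P q \<longrightarrow> degree p \<le> degree q"
      using ex_has_least_nat[of P p0 degree] by auto
    then show ?thesis using that by blast
  qed
  have "\<exists>w. w \<noteq> 0 \<and> M *v w = z *s w" if root: "poly p z = 0" for z
  proof -
    obtain q where q: "p = [:-z, 1:] * q" using root unfolding poly_eq_0_iff_dvd dvd_def by blast
    have "q \<noteq> 0" using p unfolding P_def q by (metis mult_zero_right)
    then have "degree p = Suc (degree q)" unfolding q by (subst degree_mult_eq) auto
    then have "\<not> P q" using min by fastforce
    define w where "w = (\<chi> k. seq_act q (V k) 0)"
    have "w \<noteq> 0" using \<open>\<not> P q\<close> \<open>q \<noteq> 0\<close> by (auto simp: w_def P_def vec_eq_iff)
    have "seq_act q (V k) (Suc 0) = z * seq_act q (V k) 0" for k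
    proof -
      have "seq_act ([:-z, 1:] * q) (V k) 0 = 0" using p unfolding P_def q by blast
      then show ?thesis unfolding seq_act_mult by (simp add: seq_act_pCons)
    qed
    then have "M *v w = z *s w"
      using seq_act_matrix_shift[where p = q and M = M and v = v and n = 0]
      by (simp add: vec_eq_iff w_def matrix_vector_mult_def V_def[abs_def])
    with \<open>w \<noteq> 0\<close> show ?thesis by blast
  qed
  then show thesis
    using p all by (intro that[of p]) (auto simp: P_def V_def[abs_def])
qed

lemma complex_eigenvalue_iff:
  "complex_eigenvalue Q z \<longleftrightarrow> (\<exists>w. w \<noteq> 0 \<and> complex_matrix Q *v w = z *s w)"
  by (simp add: complex_eigenvalue_def complex_matrix_def)

lemma complexify_eq_0_iff [simp]: "complexify v = 0 \<longleftrightarrow> v = 0"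
  by (simp add: complexify_def vec_eq_iff)

lemma linear_funpow:
  fixes f :: "'a::real_vector \<Rightarrow> 'a"
  assumes "linear f" shows "linear (f ^^ n)"
proof (induction n)
  case (Suc n)
  then show ?case unfolding funpow.simps using assms by (rule linear_compose)
qed (simp add: linear_id[unfolded id_def])

lemma expansive_linear: "expansive Q \<Longrightarrow> linear Q"
  by (simp add: expansive_def)

lemma expansive_bij:
  assumes "expansive Q" shows "bij Q"
proof -
  have lin: "linear Q" using assms by (rule expansive_linear)
  have "v = 0" if "Q v = 0" for v
  proof (rule ccontr)
    assume "v \<noteq> 0"
    then have "complexify v \<noteq> 0" by simp
    moreover have "complex_matrix Q *v complexify v = 0 *s complexify v"
      using that by (simp add: complex_matrix_complexify lin)
    ultimately have "complex_eigenvalue Q 0" unfolding complex_eigenvalue_iff by blast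
    then have "cmod 0 > 1" using assms by (auto simp only: expansive_def)
    then show False by simp
  qed
  then have "inj Q" using lin by (simp add: linear_injective_0)
  then show ?thesis using lin by (simp add: bij_def linear_injective_imp_surjective)
qed

lemma linear_inv_bij:
  fixes Q :: "real^'n \<Rightarrow> real^'n"
  assumes "linear Q" "bij Q" shows "linear (inv Q)"
  using assms by (simp add: bij_is_inj bij_is_surj inj_linear_imp_inv_linear)

lemma complex_matrix_mult:
  assumes "linear P" "linear Q"
  shows "complex_matrix P ** complex_matrix Q = complex_matrix (P \<circ> Q)"
  using matrix_compose[OF assms(2,1)]
  by (simp add: complex_matrix_def matrix_matrix_mult_def vec_eq_iff)

text \<open>Eigenvalues of \<open>inv Q\<close> are reciprocals of eigenvalues of \<open>Q\<close>,
  hence lie in the open unit disc. They contain the roots of the annihilator of any orbit of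
  \<open>inv Q\<close>, so the coordinates of such an orbit decay geometrically.\<close>

lemma expansive_inverse_decay:
  fixes Q :: "real^'n \<Rightarrow> real^'n"
  assumes Q: "expansive Q"
  obtains \<kappa> where "\<kappa> \<longlonglongrightarrow> 0" "\<And>n v. norm ((inv Q ^^ n) v) \<le> \<kappa> n * norm v" "\<And>n. \<kappa> n \<ge> 0"
proof -
  have lin: "linear Q" and bij: "bij Q"
    using Q by (auto intro: expansive_linear expansive_bij)
  have lini: "linear (inv Q)" using lin bij by (rule linear_inv_bij)
  have I: "complex_matrix Q ** complex_matrix (inv Q) = mat 1"
  proof -
    have "Q \<circ> inv Q = id" using bij by (simp add: bij_is_surj fun_eq_iff surj_f_inv_f)
    then have "complex_matrix Q ** complex_matrix (inv Q) = complex_matrix (id :: real^'n \<Rightarrow> real^'n)"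
      by (simp add: complex_matrix_mult lin lini)
    then show ?thesis by (simp add: complex_matrix_def matrix_id_mat_1 mat_def vec_eq_iff)
  qed
  have eig: "cmod z < 1" if w: "w \<noteq> 0" "complex_matrix (inv Q) *v w = z *s w" for w z
  proof -
    have "w = complex_matrix Q *v (complex_matrix (inv Q) *v w)"
      by (simp add: matrix_vector_mul_assoc I)
    also have "\<dots> = z *s (complex_matrix Q *v w)"
      by (simp add: w vector_scalar_commute)
    finally have ww: "w = z *s (complex_matrix Q *v w)" .
    then have "z \<noteq> 0" using w(1) by auto
    have "complex_matrix Q *v w = inverse z *s (z *s (complex_matrix Q *v w))"
      using \<open>z \<noteq> 0\<close> by (simp add: vector_smult_assoc)
    also have "\<dots> = inverse z *s w" using ww by simp
    finally have "complex_eigenvalue Q (inverse z)"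
      using w(1) unfolding complex_eigenvalue_iff by blast
    then have "cmod (inverse z) > 1" using Q by (simp add: expansive_def)
    then show ?thesis using \<open>z \<noteq> 0\<close> by (simp add: norm_inverse one_less_inverse_iff)
  qed
  have comp: "(\<lambda>n. (inv Q ^^ n) v $ k) \<longlonglongrightarrow> 0" for v k
  proof -
    define s where "s n = complex_of_real ((inv Q ^^ n) v $ k)" for n
    obtain p where p: "p \<noteq> 0"
      "\<And>k n. seq_act p (\<lambda>n. ((*v) (complex_matrix (inv Q)) ^^ n) (complexify v) $ k) n = 0"
      "\<And>z. poly p z = 0 \<Longrightarrow> \<exists>w. w \<noteq> 0 \<and> complex_matrix (inv Q) *v w = z *s w"
      using orbit_annihilator[of "complex_matrix (inv Q)" "complexify v"] by blast
    have "seq_act p s n = 0" for n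
      using p(2)[of k n] unfolding complex_matrix_funpow[OF lini]
          by (simp add: complexify_def s_def[abs_def])
    then obtain C r where r: "0 < r" "r < 1" and C: "\<And>n. cmod (s n) \<le> C * r ^ n"
      using linear_recurrence_geometric_decay[of p s] p(1,3) eig by blast
    have "(\<lambda>n. C * r ^ n) \<longlonglongrightarrow> C * 0" using r by (intro tendsto_intros) auto
    then have "s \<longlonglongrightarrow> 0"
      by (intro Lim_null_comparison[of s "\<lambda>n. C * r ^ n"]) (auto simp: C)
    then have "(\<lambda>n. Re (s n)) \<longlonglongrightarrow> Re 0" by (intro tendsto_intros)
    then show ?thesis by (simp add: s_def)
  qed
  have lim: "(\<lambda>n. (inv Q ^^ n) v) \<longlonglongrightarrow> 0" for v
    by (rule vec_tendstoI) (simp add: comp)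
  \<comment> \<open>A majorant of the operator norm of the \<open>n\<close>-th power: decay on a
    basis becomes decay uniform in the direction.\<close>
  define \<kappa> where "\<kappa> n = (\<Sum>b\<in>Basis. norm ((inv Q ^^ n) b))" for n
  show thesis
  proof (rule that)
    have "\<kappa> \<longlonglongrightarrow> (\<Sum>b\<in>(Basis::(real^'n) set). 0)"
      unfolding \<kappa>_def by (intro tendsto_sum tendsto_norm_zero lim)
    then show "\<kappa> \<longlonglongrightarrow> 0" by simp
    show "\<kappa> n \<ge> 0" for n by (simp add: \<kappa>_def sum_nonneg)
    fix n and v :: "real^'n"
    have linn: "linear (inv Q ^^ n)" using lini by (rule linear_funpow)
    have "(inv Q ^^ n) v = (inv Q ^^ n) (\<Sum>b\<in>Basis. (v \<bullet> b) *\<^sub>R b)"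
      by (simp add: euclidean_representation)
    also have "\<dots> = (\<Sum>b\<in>Basis. (v \<bullet> b) *\<^sub>R (inv Q ^^ n) b)"
      using linn by (simp add: linear_sum linear_cmul)
    also have "norm \<dots> \<le> (\<Sum>b\<in>Basis. norm v * norm ((inv Q ^^ n) b))"
      by (intro sum_norm_le) (auto intro!: mult_right_mono Basis_le_norm)
    also have "\<dots> = \<kappa> n * norm v" by (simp add: \<kappa>_def sum_distrib_left mult.commute sum_distrib_right)
    finally show "norm ((inv Q ^^ n) v) \<le> \<kappa> n * norm v" .
  qed
qed

text \<open>Roots are removed one at a time, so multiplicities are respected: each contributes a
  monic integer polynomial vanishing at it, and \<open>p\<close> divides the product of
  these.\<close>

lemma monic_int_multiple:
  fixes p :: "complex poly"
  assumes "p \<noteq> 0" "\<And>z. poly p z = 0 \<Longrightarrow> algebraic_int z"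
  shows "\<exists>P::int poly. lead_coeff P = 1 \<and> p dvd map_poly of_int P"
  using assms
proof (induction "degree p" arbitrary: p)
  case 0
  then have "p dvd 1" by (simp add: is_unit_iff_degree)
  then show ?case by (intro exI[of _ 1]) (simp add: map_poly_1')
next
  case (Suc d)
  then obtain z where z: "poly p z = 0"
    by (metis Fundamental_Theorem_Algebra.fundamental_theorem_of_algebra constant_degree nat.distinct(1))
  then obtain q where q: "p = [:-z, 1:] * q" unfolding poly_eq_0_iff_dvd dvd_def by blast
  have "q \<noteq> 0" using q Suc.prems(1) by auto
  have "degree q = d"
    using Suc.hyps(2) \<open>q \<noteq> 0\<close> unfolding q by (subst (asm) degree_mult_eq) auto
  have "\<exists>P::int poly. lead_coeff P = 1 \<and> q dvd map_poly of_int P"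
  proof (rule Suc.hyps(1))
    fix y assume "poly q y = 0"
    then have "poly p y = 0" unfolding q by (simp only: poly_mult mult_zero_right)
    then show "algebraic_int y" by (rule Suc.prems)
  qed (use \<open>degree q = d\<close> \<open>q \<noteq> 0\<close> in auto)
  then obtain P :: "int poly" where P: "lead_coeff P = 1" "q dvd map_poly of_int P" by blast
  obtain R :: "int poly" where R: "lead_coeff R = 1" "poly (map_poly of_int R) z = 0"
    using Suc.prems(2)[OF z] by (auto simp: algebraic_int_altdef_ipoly)
  have "map_poly complex_of_int (R * P) = map_poly of_int R * map_poly of_int P"
    by (intro poly_eqI) (simp add: coeff_map_poly coeff_mult)
  moreover have "p dvd map_poly of_int R * map_poly of_int P"
    unfolding q using R(2) P(2) by (intro mult_dvd_mono) (simp_all only: poly_eq_0_iff_dvd)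
  ultimately show ?case
    using P(1) R(1) by (intro exI[of _ "R * P"]) (simp add: lead_coeff_mult)
qed

section \<open>The character of \<open>\<alpha>\<close> and its values along orbits of the
  expansion\<close>

lemma unit_char_add: "unit_char \<alpha> (x + y) = unit_char \<alpha> x * unit_char \<alpha> y"
  by (simp add: unit_char_def inner_add_left distrib_left exp_add)

lemma unit_char_0 [simp]: "unit_char \<alpha> 0 = 1"
  by (simp add: unit_char_def)

lemma unit_char_eq_cis: "unit_char \<alpha> x = cis (2 * pi * (x \<bullet> \<alpha>))"
  by (simp add: unit_char_def cis_conv_exp mult_ac)

lemma norm_unit_char [simp]: "cmod (unit_char \<alpha> x) = 1"
  by (simp add: unit_char_eq_cis)

lemma unit_char_ne_0 [simp]: "unit_char \<alpha> x \<noteq> 0"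
  by (simp add: unit_char_def)

lemma unit_char_minus: "unit_char \<alpha> (- x) = inverse (unit_char \<alpha> x)"
  by (simp add: unit_char_def exp_minus)

text \<open>The distance to 1 is subadditive because the character is unimodular; expansions of
  return vectors can thus be estimated term by term.\<close>

lemma unit_char_diff_bound: "cmod (unit_char \<alpha> (x + y) - 1) \<le>
    cmod (unit_char \<alpha> x - 1) + cmod (unit_char \<alpha> y - 1)"
proof -
  have "unit_char \<alpha> (x + y) - 1 = unit_char \<alpha> x * (unit_char \<alpha> y - 1) + (unit_char \<alpha> x - 1)"
    by (simp add: unit_char_add algebra_simps)
  then have "cmod (unit_char \<alpha> (x + y) - 1) \<le>
      cmod (unit_char \<alpha> x * (unit_char \<alpha> y - 1)) + cmod (unit_char \<alpha> x - 1)"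
    by (simp only: norm_triangle_ineq)
  then show ?thesis by (simp add: norm_mult)
qed

lemma unit_char_minus_bound: "cmod (unit_char \<alpha> (- x) - 1) = cmod (unit_char \<alpha> x - 1)"
proof -
  have "unit_char \<alpha> (- x) - 1 = - (unit_char \<alpha> (- x)) * (unit_char \<alpha> x - 1)"
    by (simp add: unit_char_minus algebra_simps)
  then have "cmod (unit_char \<alpha> (- x) - 1) = cmod (- (unit_char \<alpha> (- x)) * (unit_char \<alpha> x - 1))" by simp
  also have "\<dots> = cmod (unit_char \<alpha> x - 1)" by (subst norm_mult) simp
  finally show ?thesis .
qed

lemma cmod_cis_minus_1: "cmod (cis t - 1) \<le> \<bar>t\<bar>"
  using dist_exp_i_1[of t] abs_sin_x_le_abs_x[of "t / 2"]
  by (simp add: cis_conv_exp mult.commute)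

lemma unit_char_small: "cmod (unit_char \<alpha> x - 1) \<le> 2 * pi * norm \<alpha> * norm x"
proof -
  have "\<bar>2 * pi * (x \<bullet> \<alpha>)\<bar> \<le> 2 * pi * (norm x * norm \<alpha>)"
    by (simp add: abs_mult Cauchy_Schwarz_ineq2)
  then show ?thesis
    using cmod_cis_minus_1[of "2 * pi * (x \<bullet> \<alpha>)"] by (simp add: unit_char_eq_cis mult_ac)
qed

text \<open>Write the inner product of \<open>Q\<^sup>n u\<close> with \<open>\<alpha>\<close> as \<open>e n + k n\<close> with \<open>k n\<close> an integer and \<open>e\<close> a null
  sequence. A monic integer recurrence sends \<open>e\<close> to a null sequence of integers, so \<open>e\<close> eventually
  satisfies the same recurrence and decays geometrically.\<close>

lemma unit_char_orbit_summable:
  fixes Q :: "real^'n \<Rightarrow> real^'n"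
  assumes lin: "linear Q" and alg: "\<And>z. complex_eigenvalue Q z \<Longrightarrow> algebraic_int z"
    and lim: "(\<lambda>n. unit_char \<alpha> ((Q ^^ n) u)) \<longlonglongrightarrow> 1"
  shows "summable (\<lambda>n. cmod (unit_char \<alpha> ((Q ^^ n) u) - 1))"
proof -
  define M where "M = complex_matrix Q"
  define V where "V k n = ((*v) M ^^ n) (complexify u) $ k" for k n
  define x where "x n = (Q ^^ n) u \<bullet> \<alpha>" for n
  \<comment> \<open>The principal argument over \<open>2 * pi\<close>, the representative of the
    phase in (-1/2, 1/2]. It tends to 0 because \<open>Ln\<close> is continuous at 1.\<close>
  define e where "e n = Im (Ln (unit_char \<alpha> ((Q ^^ n) u))) / (2 * pi)" for n
  have char: "unit_char \<alpha> ((Q ^^ n) u) = cis (2 * pi * e n)" for n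
  proof -
    let ?z = "unit_char \<alpha> ((Q ^^ n) u)"
    have "Ln ?z = \<i> * Im (Ln ?z)"
      using Re_Ln[OF unit_char_ne_0, of \<alpha> "(Q ^^ n) u"] by (simp add: complex_eq_iff del: Re_Ln)
    then have "?z = exp (\<i> * Im (Ln ?z))" by (metis exp_Ln unit_char_ne_0)
    then show ?thesis by (simp add: cis_conv_exp e_def mult_ac)
  qed
  have "\<exists>k::int. x n = e n + of_int k" for n
  proof -
    have "cis (2 * pi * x n) = cis (2 * pi * e n)"
      using char[of n] by (simp add: unit_char_eq_cis x_def)
    then have "exp (\<i> * complex_of_real (2 * pi * x n)) = exp (\<i> * complex_of_real (2 * pi * e n))"
      by (simp add: cis_conv_exp)
    then obtain k :: int where
      "\<i> * complex_of_real (2 * pi * x n) = \<i> * complex_of_real (2 * pi * e n) + (of_int (2 * k) *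
          pi) * \<i>"
      unfolding exp_eq by blast
    then have "2 * pi * x n = 2 * pi * e n + 2 * real_of_int k * pi"
      by (simp add: complex_eq_iff)
    then have "(2 * pi) * x n = (2 * pi) * (e n + k)" by (simp add: algebra_simps)
    then have "x n = e n + k" by simp
    then show ?thesis by blast
  qed
  then obtain k :: "nat \<Rightarrow> int" where k: "\<And>n. x n = e n + of_int (k n)" by metis
  have e0: "e \<longlonglongrightarrow> 0"
  proof -
    have "(\<lambda>n. Im (Ln (unit_char \<alpha> ((Q ^^ n) u))) / (2 * pi)) \<longlonglongrightarrow> Im (Ln 1) / (2 * pi)"
      by (intro tendsto_intros lim) auto
    then show ?thesis by (simp add: e_def[abs_def])
  qed
  obtain p where p: "p \<noteq> 0" "\<And>k n. seq_act p (V k) n = 0"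
      "\<And>z. poly p z = 0 \<Longrightarrow> \<exists>w. w \<noteq> 0 \<and> M *v w = z *s w"
    unfolding V_def[abs_def] using orbit_annihilator[of M "complexify u"] by blast
  have "algebraic_int z" if "poly p z = 0" for z
    using p(3)[OF that] alg by (simp add: M_def complex_eigenvalue_iff)
  then obtain P :: "int poly" where P: "lead_coeff P = 1" "p dvd map_poly of_int P"
    using monic_int_multiple[OF p(1)] by blast
  define P' where "P' = map_poly complex_of_int P"
  obtain q where q: "P' = q * p" using P(2) by (auto simp: P'_def dvd_def mult.commute)
  have V0: "seq_act P' (V j) n = 0" for j n
    using p(2)[of j] by (simp add: q seq_act_mult) (simp add: seq_act_def)
  have Vx: "complex_of_real (x n) = (\<Sum>j\<in>UNIV. complex_of_real (\<alpha> $ j) * V j n)" for n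
    unfolding V_def M_def complex_matrix_funpow[OF lin]
    by (simp add: x_def complexify_def inner_vec_def mult.commute)
  have "seq_act P' (\<lambda>n. complex_of_real (x n)) n = 0" for n
    unfolding Vx seq_act_sum by (simp add: V0)
  then have int: "seq_act P' (\<lambda>n. complex_of_real (e n)) n =
      - of_int (\<Sum>i\<le>degree P'. coeff P i * k (n + i))" for n
    by (simp add: k seq_act_def distrib_left sum.distrib P'_def coeff_map_poly eq_neg_iff_add_eq_0)
  have "(\<lambda>n. seq_act P' (\<lambda>n. complex_of_real (e n)) n) \<longlonglongrightarrow> (\<Sum>i\<le>degree P'. coeff P' i * complex_of_real 0)"
    unfolding seq_act_def by (intro tendsto_intros LIMSEQ_ignore_initial_segment e0)
  then have "eventually (\<lambda>n. cmod (seq_act P' (\<lambda>n. complex_of_real (e n)) n) < 1) sequentially"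
    by (auto dest!: tendstoD[where e = 1])
  then obtain N where N: "\<And>n. n \<ge> N \<Longrightarrow> cmod (seq_act P' (\<lambda>n. complex_of_real (e n)) n) < 1"
    by (auto simp: eventually_sequentially)
  have zero: "seq_act P' (\<lambda>n. complex_of_real (e n)) n = 0" if "n \<ge> N" for n
  proof -
    have "\<bar>real_of_int (\<Sum>i\<le>degree P'. coeff P i * k (n + i))\<bar> < 1"
      using N[OF that] by (simp only: int norm_minus_cancel norm_of_int)
    then have "(\<Sum>i\<le>degree P'. coeff P i * k (n + i)) = 0" by linarith
    then show ?thesis by (simp only: int of_int_0 minus_zero)
  qed
  have "P' \<noteq> 0"
    using P(1) by (metis P'_def coeff_0 coeff_map_poly of_int_0 of_int_eq_0_iff zero_neq_one)
  moreover have "seq_act P' (\<lambda>n. complex_of_real (e (n + N))) n = 0" for n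
    using seq_act_shift[of P' "\<lambda>n. complex_of_real (e n)" N n] zero[of "n + N"] by simp
  moreover have "(\<lambda>n. complex_of_real (e (n + N))) \<longlonglongrightarrow> 0"
    using tendsto_of_real[OF LIMSEQ_ignore_initial_segment[OF e0, of N]] by simp
  ultimately obtain C r where r: "0 < r" "r < 1" and C: "\<And>n. cmod (complex_of_real (e (n + N))) \<le>
      C * r ^ n"
    using linear_recurrence_geometric_decay[of P' "\<lambda>n. complex_of_real (e (n + N))"] by blast
  have "summable (\<lambda>n. 2 * pi * (C * r ^ n))"
    using r by (intro summable_mult summable_geometric) auto
  then have "summable (\<lambda>n. cmod (unit_char \<alpha> ((Q ^^ (n + N)) u) - 1))"
  proof (rule summable_comparison_test')
    fix n
    have "cmod (unit_char \<alpha> ((Q ^^ (n + N)) u) - 1) \<le> 2 * pi * \<bar>e (n + N)\<bar>"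
      using cmod_cis_minus_1[of "2 * pi * e (n + N)"] by (simp add: char abs_mult)
    also have "\<dots> \<le> 2 * pi * (C * r ^ n)" using C[of n] by (intro mult_left_mono) auto
    finally show "norm (cmod (unit_char \<alpha> ((Q ^^ (n + N)) u) - 1)) \<le> 2 * pi * (C * r ^ n)" by simp
  qed
  then show ?thesis by (subst (asm) summable_iff_shift)
qed

section \<open>The metric space of tilings\<close>

lemma shift_tile_shift_tile [simp]: "shift_tile g (shift_tile h t) = shift_tile (g + h) t"
  by (auto simp: shift_tile_def image_image add.assoc)

lemma shift_tile_0 [simp]: "shift_tile 0 t = t"
  by (simp add: shift_tile_def)

lemma shift_tiles_shift_tiles [simp]: "shift_tiles g (shift_tiles h S) = shift_tiles (g + h) S"
  by (simp add: shift_tiles_def image_image)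

lemma shift_tiles_0 [simp]: "shift_tiles 0 S = S"
  by (simp add: shift_tiles_def)

lemma mem_shift_tiles: "t \<in> shift_tiles g S \<longleftrightarrow> shift_tile (- g) t \<in> S"
proof
  assume "shift_tile (- g) t \<in> S"
  then show "t \<in> shift_tiles g S" unfolding shift_tiles_def
    by (intro image_eqI[of _ _ "shift_tile (- g) t"]) auto
qed (auto simp: shift_tiles_def)

text \<open>A nonzero translation pushes the farthest point in its own direction out of the set.
  Consequently support and type of a tile determine its position, and passing to coloured points
  loses nothing.\<close>

lemma compact_translation_unique:
  fixes K :: "'a::real_inner set"
  assumes K: "compact K" "K \<noteq> {}" and eq: "(+) x ` K = (+) y ` K"
  shows "x = y"
proof (rule ccontr)
  assume "x \<noteq> y"
  define w where "w = x - y"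
  obtain a where a: "a \<in> K" "\<And>b. b \<in> K \<Longrightarrow> b \<bullet> w \<le> a \<bullet> w"
    using continuous_attains_sup[OF K, of "\<lambda>b. b \<bullet> w"] continuous_on_inner[OF continuous_on_id
        continuous_on_const, of K w]
    by auto
  have "x + a \<in> (+) y ` K" using a(1) eq by blast
  then obtain b where b: "b \<in> K" "x + a = y + b" by blast
  have "b = a + w" using b(2) by (simp add: w_def algebra_simps)
  then have "w \<bullet> w \<le> 0" using a(2)[OF b(1)] by (simp add: inner_add_left)
  moreover have "w \<bullet> w > 0" using \<open>x \<noteq> y\<close> by (simp add: w_def)
  ultimately show False by linarith
qed

lemma mem_translate: "p \<in> (+) x ` X \<longleftrightarrow> p - x \<in> X" for x :: "'a::ab_group_add"
proof
  assume "p - x \<in> X"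
  then show "p \<in> (+) x ` X" by (intro image_eqI[of _ _ "p - x"]) auto
qed auto

text \<open>One half of \<open>close_tilings\<close>, stated for arbitrary coloured sets so that
  each inclusion can be carried separately through translation, substitution and limits.\<close>

definition near_set :: "real \<Rightarrow> ('a::real_normed_vector \<times> 'k) set \<Rightarrow> ('a \<times> 'k) set \<Rightarrow> bool" where
  "near_set \<epsilon> L1 L2 \<longleftrightarrow> (\<forall>x i. (x, i) \<in> L2 \<longrightarrow> norm x < 1 / \<epsilon> \<longrightarrow> (\<exists>y. (y, i) \<in> L1 \<and> dist x y < \<epsilon>))"

lemma near_set_mono:
  assumes "near_set \<epsilon> L1 L2" "0 < \<epsilon>" "\<epsilon> \<le> \<delta>" shows "near_set \<delta> L1 L2"
  unfolding near_set_def
proof (intro allI impI)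
  fix x i assume "(x, i) \<in> L2" "norm x < 1 / \<delta>"
  moreover have "1 / \<delta> \<le> 1 / \<epsilon>" using assms by (simp add: frac_le)
  ultimately obtain y where "(y, i) \<in> L1" "dist x y < \<epsilon>"
    using assms(1) unfolding near_set_def by (meson less_le_trans)
  then show "\<exists>y. (y, i) \<in> L1 \<and> dist x y < \<delta>" using assms(3) by force
qed

text \<open>The intermediate point may leave the ball of radius \<open>1 / (a + b)\<close> by up to
  \<open>b\<close>, so \<open>1 / (a + b) + b \<le> 1 / a\<close> is wanted, that is
  \<open>a * (a + b) \<le> 1\<close>. The cap \<open>1 / sqrt 2\<close> in the metric secures this;
  above the cap the triangle inequality is trivial.\<close>

lemma near_set_trans:
  assumes n: "near_set a L1 L2" "near_set b L2 L3" and ab: "a > 0" "b > 0" "a + b \<le> 1 / sqrt 2"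
  shows "near_set (a + b) L1 L3"
  unfolding near_set_def
proof (intro allI impI)
  fix x i assume x: "(x, i) \<in> L3" "norm x < 1 / (a + b)"
  have le1: "(a + b) * (a + b) \<le> 1"
  proof -
    have "a + b \<le> 1" using ab(3) real_sqrt_ge_1_iff[of 2] by (smt (verit) divide_le_eq_1)
    then show ?thesis using ab by (simp add: mult_le_one)
  qed
  have "1 / (a + b) \<le> 1 / b" using ab by (simp add: frac_le)
  then obtain y where y: "(y, i) \<in> L2" "dist x y < b"
    using n(2) x unfolding near_set_def by force
  have "a * (a + b) \<le> 1"
    using le1 ab by (smt (verit, ccfv_SIG) mult_right_mono)
  then have "1 / (a + b) + b \<le> 1 / a"
    using ab mult_left_mono[OF \<open>a * (a + b) \<le> 1\<close>, of b] by (simp add: field_simps)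
  moreover have "norm y < 1 / (a + b) + b"
    using x(2) y(2) norm_triangle_sub[of y x] by (simp add: dist_norm norm_minus_commute)
  ultimately obtain z where "(z, i) \<in> L1" "dist y z < a"
    using n(1) y unfolding near_set_def by force
  then show "\<exists>y. (y, i) \<in> L1 \<and> dist x y < a + b"
    using y(2) dist_triangle[of x z y] by (intro exI[of _ z]) auto
qed

lemma near_set_refl: "0 < \<epsilon> \<Longrightarrow> near_set \<epsilon> L L"
  unfolding near_set_def by (metis dist_self)

lemma close_tilings_iff:
  "close_tilings A \<epsilon> S1 S2 \<longleftrightarrow> near_set \<epsilon> (Lam A S1) (Lam A S2) \<and> near_set \<epsilon> (Lam A S2) (Lam A S1)"
proof -
  have "(ball 0 (1 / \<epsilon>) \<times> UNIV) \<inter> L2 \<subseteq> {(x + y, i) | x y i. (x, i) \<in> L1 \<and> y \<in> ball 0 \<epsilon>} \<longleftrightarrow>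
      near_set \<epsilon> L1 L2"
    for L1 L2 :: "((real^'b) \<times> 'a) set"
  proof -
    have "(x, i) \<in> {(x + y, i) | x y i. (x, i) \<in> L1 \<and> y \<in> ball 0 \<epsilon>} \<longleftrightarrow> (\<exists>y. (y, i) \<in> L1 \<and>
        dist x y < \<epsilon>)" for x i
    proof
      assume "\<exists>y. (y, i) \<in> L1 \<and> dist x y < \<epsilon>"
      then obtain y where "(y, i) \<in> L1" "dist x y < \<epsilon>" by blast
      then have "(x, i) = (y + (x - y), i) \<and> (y, i) \<in> L1 \<and> x - y \<in> ball 0 \<epsilon>"
        by (simp add: dist_norm norm_minus_commute)
      then show "(x, i) \<in> {(x + y, i) | x y i. (x, i) \<in> L1 \<and> y \<in> ball 0 \<epsilon>}" by blast
    qed (auto simp: dist_norm)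
    moreover have "(ball 0 (1 / \<epsilon>) \<times> UNIV) \<inter> L2 \<subseteq> R \<longleftrightarrow>
        (\<forall>x i. (x, i) \<in> L2 \<longrightarrow> norm x < 1 / \<epsilon> \<longrightarrow> (x, i) \<in> R)" for R
      by (auto simp: subset_iff)
    ultimately show ?thesis unfolding near_set_def by (simp only:)
  qed
  then show ?thesis unfolding close_tilings_def by blast
qed

lemma close_tilings_mono: "close_tilings A \<epsilon> S1 S2 \<Longrightarrow> 0 < \<epsilon> \<Longrightarrow> \<epsilon> \<le> \<delta> \<Longrightarrow> close_tilings A \<delta> S1 S2"
  unfolding close_tilings_iff by (blast intro: near_set_mono)

lemma close_tilings_sym: "close_tilings A \<epsilon> S1 S2 \<longleftrightarrow> close_tilings A \<epsilon> S2 S1"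
  unfolding close_tilings_iff by blast

lemma tiling_dist_bdd_below: "bdd_below (insert (1 / sqrt 2) {\<epsilon>. \<epsilon> > 0 \<and> close_tilings A \<epsilon> S1 S2})"
  by (intro bdd_belowI[of _ 0]) auto

lemma tiling_dist_nonneg: "0 \<le> tiling_dist A S1 S2"
  unfolding tiling_dist_def by (intro cInf_greatest) auto

lemma tiling_dist_le: "tiling_dist A S1 S2 \<le> 1 / sqrt 2"
  unfolding tiling_dist_def by (intro cInf_lower tiling_dist_bdd_below) auto

lemma tiling_dist_le_if_close: "close_tilings A \<epsilon> S1 S2 \<Longrightarrow> 0 < \<epsilon> \<Longrightarrow> tiling_dist A S1 S2 \<le> \<epsilon>"
  unfolding tiling_dist_def by (intro cInf_lower tiling_dist_bdd_below) auto

lemma close_if_tiling_dist_less: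
  assumes "tiling_dist A S1 S2 < \<epsilon>" "\<epsilon> \<le> 1 / sqrt 2"
  shows "close_tilings A \<epsilon> S1 S2"
proof -
  obtain \<delta> where "\<delta> \<in> insert (1 / sqrt 2) {\<epsilon>. \<epsilon> > 0 \<and> close_tilings A \<epsilon> S1 S2}" "\<delta> < \<epsilon>"
    using assms(1) unfolding tiling_dist_def by (meson cInf_lessD insert_not_empty)
  then show ?thesis using assms(2) close_tilings_mono[of A \<delta> S1 S2 \<epsilon>] by auto
qed

lemma tiling_dist_commute: "tiling_dist A S1 S2 = tiling_dist A S2 S1"
  unfolding tiling_dist_def by (simp add: close_tilings_sym)

lemma tiling_dist_triangle: "tiling_dist A S1 S3 \<le> tiling_dist A S1 S2 + tiling_dist A S2 S3"
proof (rule field_le_epsilon)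
  fix e :: real assume e: "e > 0"
  define a where "a = tiling_dist A S1 S2 + e / 2"
  define b where "b = tiling_dist A S2 S3 + e / 2"
  have pos: "a > 0" "b > 0"
    using e tiling_dist_nonneg[of A S1 S2] tiling_dist_nonneg[of A S2 S3] by (auto simp: a_def b_def)
  have "tiling_dist A S1 S3 \<le> a + b"
  proof (cases "a + b \<le> 1 / sqrt 2")
    case True
    then have "close_tilings A a S1 S2" "close_tilings A b S2 S3"
      using e pos by (auto intro!: close_if_tiling_dist_less simp: a_def b_def)
    then have "close_tilings A (a + b) S1 S3"
      using True pos near_set_trans[of a "Lam A S1" "Lam A S2" b "Lam A S3"]
        near_set_trans[of b "Lam A S3" "Lam A S2" a "Lam A S1"]
      by (simp add: close_tilings_iff add.commute)
    then show ?thesis using pos by (intro tiling_dist_le_if_close) auto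
  next
    case False
    then show ?thesis using tiling_dist_le[of A S1 S3] by simp
  qed
  then show "tiling_dist A S1 S3 \<le> tiling_dist A S1 S2 + tiling_dist A S2 S3 + e"
    by (simp add: a_def b_def)
qed

section \<open>Tilings as coloured point sets\<close>

definition tiling_points :: "('k::finite \<Rightarrow> (real^'n) set) \<Rightarrow> ((real^'n) \<times> 'k) set \<Rightarrow> bool" where
  "tiling_points A L \<longleftrightarrow> (\<forall>p. \<exists>x i. (x, i) \<in> L \<and> p \<in> (+) x ` A i) \<and>
     (\<forall>x i y j. (x, i) \<in> L \<longrightarrow> (y, j) \<in> L \<longrightarrow>
        interior ((+) x ` A i) \<inter> interior ((+) y ` A j) \<noteq> {} \<longrightarrow> x = y \<and> i = j)"

definition tiles_at :: "('k::finite \<Rightarrow> (real^'n) set) \<Rightarrow> ((real^'n) \<times> 'k) set \<Rightarrow> ('n, 'k) tile set" where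
  "tiles_at A L = (\<lambda>(x, i). shift_tile x (prototile A i)) ` L"

lemma Lam_iff: "(x, i) \<in> Lam A S \<longleftrightarrow> shift_tile x (prototile A i) \<in> S"
  by (simp add: Lam_def)

lemma Lam_shift_tiles: "(x, i) \<in> Lam A (shift_tiles g S) \<longleftrightarrow> (x - g, i) \<in> Lam A S"
  by (simp add: Lam_iff mem_shift_tiles)

locale prototile_family =
  fixes A :: "'k::finite \<Rightarrow> (real^'n) set"
  assumes proto: "prototiles A"
begin

lemma proto_compact: "compact (A i)" and proto_nonempty: "A i \<noteq> {}"
  and proto_regular: "closure (interior (A i)) = A i"
  using proto by (auto simp: prototiles_def)

lemma placed_tile_eq_iff:
  "shift_tile x (prototile A i) = shift_tile y (prototile A j) \<longleftrightarrow> x = y \<and> i = j"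
  using compact_translation_unique[OF proto_compact proto_nonempty]
  by (auto simp: shift_tile_def prototile_def)

lemma Lam_tiles_at [simp]: "Lam A (tiles_at A L) = L"
  by (auto simp: Lam_def tiles_at_def placed_tile_eq_iff)

lemma tiles_at_Lam: "S \<subseteq> tiles A \<Longrightarrow> tiles_at A (Lam A S) = S"
  by (fastforce simp: Lam_def tiles_at_def tiles_def image_iff)

lemma Lam_inject: "S \<subseteq> tiles A \<Longrightarrow> S' \<subseteq> tiles A \<Longrightarrow> Lam A S = Lam A S' \<Longrightarrow> S = S'"
  using tiles_at_Lam by metis

lemma tiles_at_subset: "tiles_at A L \<subseteq> tiles A"
  by (auto simp: tiles_at_def tiles_def)

lemma tilings_subset: "S \<in> tilings A \<Longrightarrow> S \<subseteq> tiles A"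
  by (simp add: tilings_def)

lemma tiles_at_in_tilings_iff: "tiles_at A L \<in> tilings A \<longleftrightarrow> tiling_points A L"
proof -
  have cover: "(\<Union>t\<in>tiles_at A L. fst t) = UNIV \<longleftrightarrow> (\<forall>p. \<exists>x i. (x, i) \<in> L \<and> p \<in> (+) x ` A i)"
    by (auto simp: tiles_at_def shift_tile_def prototile_def set_eq_iff Bex_def split_def)
  have disj: "disjoint_interiors (tiles_at A L) \<longleftrightarrow> (\<forall>x i y j. (x, i) \<in> L \<longrightarrow> (y, j) \<in> L \<longrightarrow>
        interior ((+) x ` A i) \<inter> interior ((+) y ` A j) \<noteq> {} \<longrightarrow> x = y \<and> i = j)" (is "_ \<longleftrightarrow> ?R")
  proof
    assume "disjoint_interiors (tiles_at A L)"
    then show ?R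
      by (simp add: disjoint_interiors_def pairwise_def tiles_at_def split_beta placed_tile_eq_iff)
        (force simp: shift_tile_def prototile_def)
  next
    assume R: ?R
    show "disjoint_interiors (tiles_at A L)"
      unfolding disjoint_interiors_def pairwise_def tiles_at_def
    proof (intro ballI impI)
      fix t t' assume "t \<in> (\<lambda>(x, i). shift_tile x (prototile A i)) ` L"
        "t' \<in> (\<lambda>(x, i). shift_tile x (prototile A i)) ` L" "t \<noteq> t'"
      then obtain x i y j where xy: "(x, i) \<in> L" "(y, j) \<in> L" "\<not> (x = y \<and> i = j)"
        and t: "t = shift_tile x (prototile A i)" "t' = shift_tile y (prototile A j)"
        by auto
      have "interior ((+) x ` A i) \<inter> interior ((+) y ` A j) = {}"
        using R xy by meson
      then show "interior (fst t) \<inter> interior (fst t') = {}"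
        by (simp add: t shift_tile_def prototile_def)
    qed
  qed
  show ?thesis
    unfolding tilings_def tiling_points_def using tiles_at_subset[of L]
    by (simp only: mem_Collect_eq cover disj simp_thms)
qed

lemma in_tilings_iff: "S \<in> tilings A \<longleftrightarrow> S \<subseteq> tiles A \<and> tiling_points A (Lam A S)"
proof (cases "S \<subseteq> tiles A")
  case True
  then show ?thesis using tiles_at_in_tilings_iff[of "Lam A S"] by (simp add: tiles_at_Lam)
next
  case False
  then show ?thesis using tilings_subset by blast
qed

lemma proto_bounded: obtains \<rho> where "\<rho> > 0" "\<And>i a. a \<in> A i \<Longrightarrow> norm a < \<rho>"
proof -
  have "bounded (\<Union>i. A i)"
    using proto_compact by (intro bounded_UN) (auto intro: compact_imp_bounded)
  then obtain \<rho> where "\<rho> > 0" "\<And>a. a \<in> (\<Union>i. A i) \<Longrightarrow> norm a < \<rho>"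
    using bounded_pos_less by metis
  then show thesis using that by blast
qed

lemma proto_inner_ball: obtains r c where "r > 0" "\<And>i. ball (c i) r \<subseteq> interior (A i)"
proof -
  have "\<exists>c r. r > 0 \<and> ball c r \<subseteq> interior (A i)" for i
  proof -
    have "interior (A i) \<noteq> {}" using proto_regular[of i] proto_nonempty[of i] by auto
    then show ?thesis using open_interior openE by (metis ex_in_conv)
  qed
  then obtain c r where cr: "\<And>i. r i > 0 \<and> ball (c i) (r i) \<subseteq> interior (A i)" by metis
  define s where "s = Min (range r)"
  have "s > 0" using cr by (simp add: s_def)
  moreover have "ball (c i) s \<subseteq> interior (A i)" for i
  proof -
    have "s \<le> r i" by (simp add: s_def)
    then have "ball (c i) s \<subseteq> ball (c i) (r i)" by (rule subset_ball)
    then show ?thesis using cr by blast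
  qed
  ultimately show thesis using that by blast
qed

lemma interior_placed: "interior ((+) x ` A i) = (+) x ` interior (A i)"
  by (rule interior_translation)

lemma placed_regular: "closure (interior ((+) x ` A i)) = (+) x ` A i"
  by (simp add: interior_placed closure_translation proto_regular)

text \<open>Every tile of type \<open>i\<close> contains a ball of radius \<open>r\<close> at the
  same offset \<open>c i\<close>, so two such tiles at distance below \<open>r\<close> overlap. The
  constant is common to all tilings.\<close>

lemma tiling_points_separated:
  obtains r where "r > 0" "\<And>L x y i. tiling_points A L \<Longrightarrow> (x, i) \<in> L \<Longrightarrow> (y, i) \<in> L \<Longrightarrow> dist x y < r \<Longrightarrow> x = y"
proof -
  obtain r c where r: "r > 0" "\<And>i. ball (c i) r \<subseteq> interior (A i)" using proto_inner_ball by blast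
  show thesis
  proof (rule that[OF r(1)])
    fix L x y i assume L: "tiling_points A L" "(x, i) \<in> L" "(y, i) \<in> L" "dist x y < r"
    have "c i \<in> interior (A i)" using r by (metis centre_in_ball subsetD)
    then have "x + c i \<in> interior ((+) x ` A i)" by (simp add: interior_placed)
    moreover have "c i + (x - y) \<in> interior (A i)"
        using L(4) r(2)[of i] by (auto simp: dist_norm norm_minus_commute subset_iff)
    then have "y + (c i + (x - y)) \<in> interior ((+) y ` A i)" unfolding interior_placed by (rule imageI)
    then have "x + c i \<in> interior ((+) y ` A i)" by (simp add: algebra_simps)
    ultimately show "x = y" using L unfolding tiling_points_def by blast
  qed
qed

lemma tiling_points_finite:
  assumes "tiling_points A L" shows "finite {(x, i). (x, i) \<in> L \<and> norm x \<le> R}"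
proof -
  obtain r where r: "r > 0" "\<And>L x y i. tiling_points A L \<Longrightarrow> (x, i) \<in> L \<Longrightarrow> (y, i) \<in> L \<Longrightarrow> dist x y < r \<Longrightarrow>
      x = y"
    using tiling_points_separated by blast
  have "finite {x. (x, i) \<in> L \<and> norm x \<le> R}" for i
  proof -
    have "\<not> z islimpt {x. (x, i) \<in> L \<and> norm x \<le> R}" for z
    proof (rule discrete_imp_not_islimpt[OF r(1)])
      fix x y assume "x \<in> {x. (x, i) \<in> L \<and> norm x \<le> R}" "y \<in> {x. (x, i) \<in> L \<and> norm x \<le> R}" "dist y x < r"
      then show "y = x" using r(2)[OF assms, of y i x] by simp
    qed
    moreover have bd: "bounded {x. (x, i) \<in> L \<and> norm x \<le> R}"
      by (intro boundedI[of _ R]) auto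
    ultimately show ?thesis using bounded_infinite_imp_islimpt[OF subset_refl bd] by blast
  qed
  then have "finite (\<Union>i. (\<lambda>x. (x, i)) ` {x. (x, i) \<in> L \<and> norm x \<le> R})" by auto
  then show ?thesis by (rule rev_finite_subset) auto
qed

lemma tiling_dist_0_iff:
  assumes S: "S \<in> tilings A" "S' \<in> tilings A"
  shows "tiling_dist A S S' = 0 \<longleftrightarrow> S = S'"
proof
  assume "S = S'"
  have "tiling_dist A S S \<le> e" if "e > 0" for e
    using that by (intro tiling_dist_le_if_close) (simp_all add: close_tilings_iff near_set_refl)
  then show "tiling_dist A S S' = 0"
    using tiling_dist_nonneg[of A S S] \<open>S = S'\<close> by (metis field_le_epsilon add_0 order_antisym)
next
  assume d: "tiling_dist A S S' = 0"
  obtain r where r: "r > 0" "\<And>L x y i. tiling_points A L \<Longrightarrow> (x, i) \<in> L \<Longrightarrow> (y, i) \<in> L \<Longrightarrow> dist x y < r \<Longrightarrow>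
      x = y"
    using tiling_points_separated by blast
  have close: "close_tilings A e S S'" if "e > 0" "e \<le> 1 / sqrt 2" for e
    using d that by (intro close_if_tiling_dist_less) auto
  have sub: "(x, i) \<in> Lam A S2" if x: "(x, i) \<in> Lam A S1" and S2: "S2 \<in> tilings A"
      and n: "\<And>e. e > 0 \<Longrightarrow> e \<le> 1 / sqrt 2 \<Longrightarrow> near_set e (Lam A S2) (Lam A S1)" for S1 S2 x i
  proof -
    have ex: "\<exists>y. (y, i) \<in> Lam A S2 \<and> dist x y < e" if "e > 0" for e
    proof -
      \<comment> \<open>The last entry makes the ball of radius \<open>1 / e'\<close> contain
        \<open>x\<close>; the middle one keeps \<open>e'\<close> in the range where the distance
        controls closeness.\<close>
      define e' where "e' = min e (min (1 / sqrt 2) (1 / (norm x + 1)))"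
      have pos: "norm x + 1 > 0" by (smt (verit) norm_ge_zero)
      have e': "e' > 0" "e' \<le> 1 / sqrt 2" "e' \<le> e" "e' \<le> 1 / (norm x + 1)"
        using that pos by (auto simp: e'_def)
      have "norm x < 1 / e'" using e'(1,4) pos by (simp add: field_simps)
      then obtain y where "(y, i) \<in> Lam A S2" "dist x y < e'"
        using n[OF e'(1,2)] x unfolding near_set_def by blast
      then show ?thesis using e'(3) by force
    qed
    obtain y where y: "(y, i) \<in> Lam A S2" "dist x y < r / 2" using ex[of "r / 2"] r(1) by auto
    \<comment> \<open>Otherwise a point \<open>z\<close> strictly closer to \<open>x\<close> than
      \<open>y\<close> exists. Both lie within \<open>r / 2\<close> of \<open>x\<close>, so
      separation forces \<open>z = y\<close>, a contradiction.\<close>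
    have "x = y"
    proof (rule ccontr)
      assume "x \<noteq> y"
      then obtain z where z: "(z, i) \<in> Lam A S2" "dist x z < min (r / 2) (dist x y)"
        using ex[of "min (r / 2) (dist x y)"] r(1) by auto
      have "dist y z < r" using y(2) z(2) dist_triangle[of y z x] by (simp add: dist_commute)
      then have "y = z" using r(2) y(1) z(1) S2 in_tilings_iff by blast
      then show False using z(2) by simp
    qed
    then show ?thesis using y(1) by simp
  qed
  have "Lam A S = Lam A S'"
    using sub[of _ _ S S'] sub[of _ _ S' S] S close unfolding close_tilings_iff by auto
  then show "S = S'" using S tilings_subset Lam_inject by blast
qed

sublocale tilings: Metric_space "tilings A" "tiling_dist A"
proof unfold_locales
  fix x y z :: "('n, 'k) tile set"
  show "0 \<le> tiling_dist A x y" by (rule tiling_dist_nonneg)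
  show "tiling_dist A x y = tiling_dist A y x" by (rule tiling_dist_commute)
  show "tiling_dist A x y = 0 \<longleftrightarrow> x = y" if "x \<in> tilings A" "y \<in> tilings A"
    using that by (rule tiling_dist_0_iff)
  show "tiling_dist A x z \<le> tiling_dist A x y + tiling_dist A y z" by (rule tiling_dist_triangle)
qed

lemma tilings_topology_eq: "tilings_topology A = tilings.mtopology"
  by (simp add: tilings_topology_def)

end

section \<open>The tile-substitution on coloured point sets\<close>

definition shift_pts :: "'a::group_add \<Rightarrow> ('a \<times> 'k) set \<Rightarrow> ('a \<times> 'k) set" where
  "shift_pts g L = (\<lambda>(x, i). (x + g, i)) ` L"

lemma mem_shift_pts [simp]: "(x, i) \<in> shift_pts g L \<longleftrightarrow> (x - g, i) \<in> L"
proof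
  assume "(x - g, i) \<in> L"
  then show "(x, i) \<in> shift_pts g L"
    unfolding shift_pts_def by (intro image_eqI[of _ _ "(x - g, i)"]) auto
qed (auto simp: shift_pts_def)

lemma Lam_shift: "Lam A (shift_tiles g S) = shift_pts g (Lam A S)"
proof (rule set_eqI)
  show "p \<in> Lam A (shift_tiles g S) \<longleftrightarrow> p \<in> shift_pts g (Lam A S)" for p
    by (cases p) (simp add: Lam_shift_tiles)
qed

locale tile_subst_system = prototile_family A
  for A :: "'k::finite \<Rightarrow> (real^'n) set" +
  fixes Q :: "real^'n \<Rightarrow> real^'n" and D :: "'k \<Rightarrow> 'k \<Rightarrow> (real^'n) set"
  assumes subst: "tile_substitution A Q D"
begin

lemma expQ: "expansive Q"
  using subst by (simp add: tile_substitution_def)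

lemma finD: "finite (D i j)"
  using subst by (simp add: tile_substitution_def)

lemma Q_image: "Q ` A j = (\<Union>i. \<Union>u\<in>D i j. (+) u ` A i)"
  using subst by (simp add: tile_substitution_def)

lemma D_disjoint:
  assumes "u \<in> D i j" "u' \<in> D i' j" "interior ((+) u ` A i) \<inter> interior ((+) u' ` A i') \<noteq> {}"
  shows "u = u' \<and> i = i'"
proof -
  have "\<forall>j i u i' u'. u \<in> D i j \<longrightarrow> u' \<in> D i' j \<longrightarrow> (u, i) \<noteq> (u', i') \<longrightarrow>
        interior ((+) u ` A i) \<inter> interior ((+) u' ` A i') = {}"
    using subst by (simp add: tile_substitution_def)
  from this[rule_format, of u i j u' i'] show ?thesis using assms by auto
qed

lemma linQ: "linear Q" and bijQ: "bij Q" and linQi: "linear (inv Q)"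
  using expQ by (auto intro: expansive_linear expansive_bij linear_inv_bij)

lemma linQn: "linear (Q ^^ n)" and linQin: "linear (inv Q ^^ n)"
  using linQ linQi by (auto intro: linear_funpow)

lemma Q_add: "Q (x + y) = Q x + Q y" and Q_diff: "Q (x - y) = Q x - Q y"
  using linQ by (auto intro: linear_add linear_diff)

lemma Qn_add: "(Q ^^ n) (x + y) = (Q ^^ n) x + (Q ^^ n) y" and Qn_diff: "(Q ^^ n) (x - y) =
    (Q ^^ n) x - (Q ^^ n) y"
  and Qn_minus: "(Q ^^ n) (- x) = - (Q ^^ n) x" and Qn_0 [simp]: "(Q ^^ n) 0 = 0"
  using linQn[of n] by (auto intro: linear_add linear_diff linear_neg linear_0)

lemma Q_Qi [simp]: "Q (inv Q x) = x" and Qi_Q [simp]: "inv Q (Q x) = x"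
  using bijQ by (simp_all add: bij_is_surj surj_f_inv_f bij_is_inj inv_f_f)

lemma Qn_Qin [simp]: "(Q ^^ n) ((inv Q ^^ n) x) = x"
proof (induction n arbitrary: x)
  case (Suc n)
  have "(Q ^^ Suc n) ((inv Q ^^ Suc n) x) = Q ((Q ^^ n) ((inv Q ^^ n) (inv Q x)))"
    by (simp add: funpow_swap1)
  then show ?case by (simp add: Suc)
qed simp

lemma Qin_Qn [simp]: "(inv Q ^^ n) ((Q ^^ n) x) = x"
proof (induction n arbitrary: x)
  case (Suc n)
  have "(inv Q ^^ Suc n) ((Q ^^ Suc n) x) = inv Q ((inv Q ^^ n) ((Q ^^ n) (Q x)))"
    by (simp add: funpow_swap1)
  then show ?case by (simp add: Suc)
qed simp

definition subst_pts :: "((real^'n) \<times> 'k) set \<Rightarrow> ((real^'n) \<times> 'k) set" where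
  "subst_pts L = (\<Union>(x, j)\<in>L. \<Union>i. (\<lambda>u. (Q x + u, i)) ` D i j)"

definition supp :: "((real^'n) \<times> 'k) set \<Rightarrow> (real^'n) set" where
  "supp L = (\<Union>(x, i)\<in>L. (+) x ` A i)"

lemma mem_subst_pts: "(y, i) \<in> subst_pts L \<longleftrightarrow> (\<exists>x j. (x, j) \<in> L \<and> y - Q x \<in> D i j)"
proof
  assume "(y, i) \<in> subst_pts L"
  then show "\<exists>x j. (x, j) \<in> L \<and> y - Q x \<in> D i j" unfolding subst_pts_def by force
next
  assume "\<exists>x j. (x, j) \<in> L \<and> y - Q x \<in> D i j"
  then obtain x j where x: "(x, j) \<in> L" "y - Q x \<in> D i j" by blast
  then have "(y, i) \<in> (\<lambda>u. (Q x + u, i)) ` D i j"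
    by (intro image_eqI[of _ _ "y - Q x"]) auto
  then show "(y, i) \<in> subst_pts L" unfolding subst_pts_def using x(1) by blast
qed

lemma subst_pts_mono: "L \<subseteq> L' \<Longrightarrow> subst_pts L \<subseteq> subst_pts L'"
  unfolding subst_pts_def by blast

lemma subst_pts_pow_mono: "L \<subseteq> L' \<Longrightarrow> (subst_pts ^^ n) L \<subseteq> (subst_pts ^^ n) L'"
  by (induction n) (auto dest: subst_pts_mono)

lemma finite_subst_pts: "finite L \<Longrightarrow> finite (subst_pts L)"
  unfolding subst_pts_def by (auto simp: finD)

lemma finite_subst_pts_pow: "finite L \<Longrightarrow> finite ((subst_pts ^^ n) L)"
  by (induction n) (auto simp: finite_subst_pts)

lemma subst_pts_shift: "subst_pts (shift_pts g L) = shift_pts (Q g) (subst_pts L)"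
proof -
  have "(y, i) \<in> subst_pts (shift_pts g L) \<longleftrightarrow> (y, i) \<in> shift_pts (Q g) (subst_pts L)" for y i
  proof
    assume "(y, i) \<in> subst_pts (shift_pts g L)"
    then obtain x j where "(x - g, j) \<in> L" "y - Q x \<in> D i j" by (auto simp: mem_subst_pts)
    then show "(y, i) \<in> shift_pts (Q g) (subst_pts L)"
      by (auto simp: mem_subst_pts Q_diff intro!: exI[of _ "x - g"] exI[of _ j])
  next
    assume "(y, i) \<in> shift_pts (Q g) (subst_pts L)"
    then obtain x j where "(x, j) \<in> L" "y - Q g - Q x \<in> D i j" by (auto simp: mem_subst_pts)
    then show "(y, i) \<in> subst_pts (shift_pts g L)"
      by (auto simp: mem_subst_pts Q_add algebra_simps intro!: exI[of _ "x + g"] exI[of _ j])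
  qed
  then show ?thesis by (simp add: set_eq_iff)
qed

lemma subst_pts_pow_shift: "(subst_pts ^^ n) (shift_pts g L) =
    shift_pts ((Q ^^ n) g) ((subst_pts ^^ n) L)"
  by (induction n) (auto simp: subst_pts_shift)

lemma subst_pts_UN: "subst_pts (\<Union>a\<in>I. F a) = (\<Union>a\<in>I. subst_pts (F a))"
  unfolding subst_pts_def by blast

lemma subst_pts_pow_UN: "(subst_pts ^^ n) (\<Union>a\<in>I. F a) = (\<Union>a\<in>I. (subst_pts ^^ n) (F a))"
  by (induction n) (auto simp: subst_pts_UN)

text \<open>Substitution commutes with unions and turns a shift by \<open>g\<close> into one by
  \<open>Q g\<close>, so the \<open>n\<close>-th image splits into the order-\<open>n\<close>
  supertiles of the single points. Descending to a supertile always goes through this form.\<close>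

lemma mem_subst_pts_pow: "(y, i) \<in> (subst_pts ^^ n) L \<longleftrightarrow> (\<exists>x j. (x, j) \<in> L \<and>
    (y - (Q ^^ n) x, i) \<in> (subst_pts ^^ n) {(0, j)})"
proof -
  have L: "L = (\<Union>a\<in>L. shift_pts (fst a) {(0, snd a)})"
    by (auto simp: shift_pts_def)
  have "(subst_pts ^^ n) L = (\<Union>a\<in>L. shift_pts ((Q ^^ n) (fst a)) ((subst_pts ^^ n) {(0, snd a)}))"
    by (subst L) (simp only: subst_pts_pow_UN subst_pts_pow_shift)
  then show ?thesis by (auto simp: Bex_def)
qed

lemma Lam_tile_subst: "Lam A (tile_subst A Q D S) = subst_pts (Lam A S)"
proof -
  have "Lam A (subst_proto A D j) = {(u, i). u \<in> D i j}" for j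
    by (auto simp: Lam_def subst_proto_def placed_tile_eq_iff)
  then have *: "(y, i) \<in> Lam A (shift_tiles g (subst_proto A D j)) \<longleftrightarrow> y - g \<in> D i j" for y i g j
    by (simp add: Lam_shift_tiles)
  have "(y, i) \<in> Lam A (tile_subst A Q D S) \<longleftrightarrow> (\<exists>x j. (x, j) \<in> Lam A S \<and>
      (y, i) \<in> Lam A (shift_tiles (Q x) (subst_proto A D j)))" for y i
    unfolding tile_subst_def Lam_def by blast
  then show ?thesis by (auto simp: mem_subst_pts *)
qed

lemma tile_subst_subset: "tile_subst A Q D S \<subseteq> tiles A"
proof -
  have "shift_tile u (prototile A i) \<in> tiles A" for u i unfolding tiles_def by blast
  then show ?thesis by (auto simp: tile_subst_def subst_proto_def shift_tiles_def)
qed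

lemma Lam_tile_subst_pow: "Lam A ((tile_subst A Q D ^^ n) S) = (subst_pts ^^ n) (Lam A S)"
  by (induction n) (auto simp: Lam_tile_subst)

lemma Lam_single: "Lam A {prototile A i} = {(0, i)}"
  using placed_tile_eq_iff[of _ _ 0 i] by (auto simp: Lam_def)

lemma mem_supp: "p \<in> supp L \<longleftrightarrow> (\<exists>x i. (x, i) \<in> L \<and> p - x \<in> A i)"
  unfolding supp_def by (auto simp: mem_translate Bex_def)

lemma mem_Q_image: "p \<in> Q ` X \<longleftrightarrow> inv Q p \<in> X"
proof
  assume "inv Q p \<in> X"
  then show "p \<in> Q ` X" by (intro image_eqI[of _ _ "inv Q p"]) auto
qed auto

lemma inv_Q_diff: "inv Q (x - y) = inv Q x - inv Q y"
  using linQi by (rule linear_diff)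

lemma supp_subst_pts: "supp (subst_pts L) = Q ` supp L"
proof (rule set_eqI)
  fix p
  have "p \<in> Q ` supp L \<longleftrightarrow> (\<exists>x j. (x, j) \<in> L \<and> inv Q p - x \<in> A j)"
    by (simp add: mem_Q_image mem_supp)
  also have "\<dots> \<longleftrightarrow> (\<exists>x j. (x, j) \<in> L \<and> p - Q x \<in> Q ` A j)"
    by (simp add: mem_Q_image inv_Q_diff)
  also have "\<dots> \<longleftrightarrow> (\<exists>x j i u. (x, j) \<in> L \<and> u \<in> D i j \<and> p - Q x - u \<in> A i)"
    by (simp add: Q_image mem_translate Bex_def)
  also have "\<dots> \<longleftrightarrow> p \<in> supp (subst_pts L)"
  proof
    assume "\<exists>x j i u. (x, j) \<in> L \<and> u \<in> D i j \<and> p - Q x - u \<in> A i"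
    then obtain x j i u where "(x, j) \<in> L" "u \<in> D i j" "p - Q x - u \<in> A i" by blast
    then show "p \<in> supp (subst_pts L)"
      unfolding mem_supp mem_subst_pts
      by (intro exI[of _ "Q x + u"] exI[of _ i] conjI exI[of _ x] exI[of _ j]) (auto simp: diff_diff_eq)
  next
    assume "p \<in> supp (subst_pts L)"
    then obtain y i x j where "(x, j) \<in> L" "y - Q x \<in> D i j" "p - y \<in> A i"
      unfolding mem_supp mem_subst_pts by blast
    then show "\<exists>x j i u. (x, j) \<in> L \<and> u \<in> D i j \<and> p - Q x - u \<in> A i"
      by (intro exI[of _ x] exI[of _ j] exI[of _ i] exI[of _ "y - Q x"]) auto
  qed
  finally show "p \<in> supp (subst_pts L) \<longleftrightarrow> p \<in> Q ` supp L" by blast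
qed

lemma supp_subst_pts_pow: "supp ((subst_pts ^^ n) L) = (Q ^^ n) ` supp L"
  by (induction n) (auto simp: supp_subst_pts image_comp)

lemma tiling_points_iff_supp: "tiling_points A L \<longleftrightarrow> supp L = UNIV \<and>
    (\<forall>x i y j. (x, i) \<in> L \<longrightarrow> (y, j) \<in> L \<longrightarrow>
        interior ((+) x ` A i) \<inter> interior ((+) y ` A j) \<noteq> {} \<longrightarrow> x = y \<and> i = j)"
proof -
  have "supp L = UNIV \<longleftrightarrow> (\<forall>p. \<exists>x i. (x, i) \<in> L \<and> p \<in> (+) x ` A i)"
    unfolding supp_def by (auto simp: set_eq_iff Bex_def)
  then show ?thesis unfolding tiling_points_def by simp
qed

text \<open>A child lies in the inflated parent and \<open>Q\<close> carries interiors to interiors,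
  so overlapping children have overlapping and therefore equal parents. Within one parent the
  disjointness required of the substitution applies.\<close>

lemma tiling_points_subst_pts:
  assumes L: "tiling_points A L" shows "tiling_points A (subst_pts L)"
  unfolding tiling_points_iff_supp
proof (rule conjI; (intro allI impI)?)
  show "supp (subst_pts L) = UNIV"
    using L bijQ by (simp add: supp_subst_pts tiling_points_iff_supp bij_is_surj)
next
  fix y i y' i'
  assume "(y, i) \<in> subst_pts L" "(y', i') \<in> subst_pts L"
    and ne: "interior ((+) y ` A i) \<inter> interior ((+) y' ` A i') \<noteq> {}"
  then obtain x j x' j' where x: "(x, j) \<in> L" "y - Q x \<in> D i j" "(x', j') \<in> L" "y' - Q x' \<in> D i' j'"
    by (auto simp: mem_subst_pts)
  have int: "interior ((+) y ` A i) \<subseteq> Q ` interior ((+) x ` A j)" if "y - Q x \<in> D i j" for x y i j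
  proof -
    have "(+) (y - Q x) ` A i \<subseteq> Q ` A j" using Q_image that by blast
    then have "(+) (Q x) ` (+) (y - Q x) ` A i \<subseteq> (+) (Q x) ` Q ` A j" by (rule image_mono)
    then have "(+) y ` A i \<subseteq> Q ` (+) x ` A j" by (simp add: image_image Q_add add.commute)
    then show ?thesis
      using interior_mono interior_injective_linear_image[OF linQ bij_is_inj[OF bijQ]] by metis
  qed
  have "interior ((+) x ` A j) \<inter> interior ((+) x' ` A j') \<noteq> {}"
  proof -
    obtain p where p: "p \<in> interior ((+) y ` A i)" "p \<in> interior ((+) y' ` A i')" using ne by blast
    then obtain q q' where "p = Q q" "p = Q q'" "q \<in> interior ((+) x ` A j)" "q' \<in> interior ((+) x'
        ` A j')"
      using int x by blast
    moreover have "q = q'" using calculation bij_is_inj[OF bijQ] by (metis injD)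
    ultimately show ?thesis by blast
  qed
  then have eq: "x = x'" "j = j'" using L x unfolding tiling_points_def by blast+
  have "interior ((+) (y - Q x) ` A i) \<inter> interior ((+) (y' - Q x) ` A i') \<noteq> {}"
  proof -
    obtain p where "p \<in> interior ((+) y ` A i)" "p \<in> interior ((+) y' ` A i')" using ne by blast
    then have "p - Q x \<in> interior ((+) (y - Q x) ` A i)" "p - Q x \<in> interior ((+) (y' - Q x) ` A i')"
      by (simp_all add: interior_placed mem_translate)
    then show ?thesis by blast
  qed
  then show "y = y' \<and> i = i'" using D_disjoint x eq by fastforce
qed

text \<open>An interior point of the tile lies in some tile of \<open>P\<close>, which is the
  closure of its interior; so the two interiors meet and the tiles coincide. This turns covering of
  a region into membership in a patch.\<close>

lemma covered_tile_mem:
  assumes L: "tiling_points A L" and P: "P \<subseteq> L" and x: "(x, i) \<in> L" "(+) x ` A i \<subseteq> supp P"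
  shows "(x, i) \<in> P"
proof -
  have "interior ((+) x ` A i) \<noteq> {}"
    using placed_regular[of x i] proto_nonempty[of i] by auto
  then obtain w where w: "w \<in> interior ((+) x ` A i)" by blast
  then have "w \<in> supp P" using x(2) interior_subset by blast
  then obtain y j where y: "(y, j) \<in> P" "w \<in> (+) y ` A j" unfolding supp_def by blast
  then have "w \<in> closure (interior ((+) y ` A j))" by (simp add: placed_regular)
  then have "interior ((+) x ` A i) \<inter> interior ((+) y ` A j) \<noteq> {}"
    using w open_interior by (metis IntI closure_iff_nhds_not_empty inf_commute interior_subset
        order_refl)
  then show ?thesis using L P x(1) y(1) unfolding tiling_points_def by blast
qed

text \<open>The margin \<open>\<rho>\<close> bounds the size of the prototiles: a tile placed within
  \<open>1 / \<epsilon>\<close> of the origin lies in the ball of radius \<open>R\<close>, hence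
  belongs to the shared patch.\<close>

lemma common_patch_near_set:
  assumes L: "tiling_points A L" and P: "P \<subseteq> L" "P \<subseteq> L'" "ball 0 R \<subseteq> supp P"
    and \<rho>: "\<And>i a. a \<in> A i \<Longrightarrow> norm a < \<rho>" and \<epsilon>: "\<epsilon> > 0" "1 / \<epsilon> + \<rho> \<le> R"
  shows "near_set \<epsilon> L' L"
  unfolding near_set_def
proof (intro allI impI)
  fix x i assume x: "(x, i) \<in> L" "norm x < 1 / \<epsilon>"
  have "(+) x ` A i \<subseteq> ball 0 R"
  proof
    fix p assume "p \<in> (+) x ` A i"
    then obtain a where "a \<in> A i" "p = x + a" by blast
    then have "norm p < 1 / \<epsilon> + \<rho>" using x(2) \<rho>[of a i] norm_triangle_ineq[of x a] by simp
    then show "p \<in> ball 0 R" using \<epsilon>(2) by simp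
  qed
  then have "(x, i) \<in> P" using covered_tile_mem[OF L P(1) x(1)] P(3) by blast
  then show "\<exists>y. (y, i) \<in> L' \<and> dist x y < \<epsilon>" using P(2) \<epsilon>(1) by (intro exI[of _ x]) auto
qed

lemma shift_tiles_subset:
  assumes "S \<subseteq> tiles A" shows "shift_tiles g S \<subseteq> tiles A"
proof
  fix t assume "t \<in> shift_tiles g S"
  then have "shift_tile (- g) t \<in> tiles A" using assms by (auto simp: mem_shift_tiles)
  then obtain x i where "shift_tile (- g) t = shift_tile x (prototile A i)"
    unfolding tiles_def by blast
  then have "shift_tile g (shift_tile (- g) t) = shift_tile g (shift_tile x (prototile A i))" by simp
  then have "t = shift_tile (g + x) (prototile A i)" by simp
  then show "t \<in> tiles A" unfolding tiles_def by blast
qed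

lemma shift_in_tilings: assumes "S \<in> tilings A" shows "shift_tiles g S \<in> tilings A"
proof -
  have "tiling_points A (shift_pts g (Lam A S))"
    unfolding tiling_points_iff_supp
  proof (rule conjI; (intro allI impI)?)
    have L: "tiling_points A (Lam A S)" using assms by (simp add: in_tilings_iff)
    show "supp (shift_pts g (Lam A S)) = UNIV"
    proof -
      have "p \<in> supp (shift_pts g (Lam A S))" for p
      proof -
        have "p - g \<in> supp (Lam A S)" using L by (simp add: tiling_points_iff_supp)
        then obtain x i where "(x, i) \<in> Lam A S" "p - g - x \<in> A i" unfolding mem_supp by blast
        then show ?thesis unfolding mem_supp by (intro exI[of _ "x + g"] exI[of _ i]) (auto simp:
            algebra_simps)
      qed
      then show ?thesis by blast
    qed
    fix x i y j assume xy: "(x, i) \<in> shift_pts g (Lam A S)" "(y, j) \<in> shift_pts g (Lam A S)"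
      "interior ((+) x ` A i) \<inter> interior ((+) y ` A j) \<noteq> {}"
    then obtain p where "p \<in> interior ((+) x ` A i)" "p \<in> interior ((+) y ` A j)" by blast
    then have "p - g \<in> interior ((+) (x - g) ` A i)" "p - g \<in> interior ((+) (y - g) ` A j)"
      by (simp_all add: interior_placed mem_translate)
    then have "x - g = y - g \<and> i = j" using L xy(1,2) unfolding tiling_points_def mem_shift_pts by blast
    then show "x = y \<and> i = j" by simp
  qed
  moreover have "shift_tiles g S \<subseteq> tiles A"
    using tilings_subset[OF assms] by (rule shift_tiles_subset)
  ultimately show ?thesis by (simp add: in_tilings_iff Lam_shift)
qed

lemma tile_subst_in_tilings: "S \<in> tilings A \<Longrightarrow> tile_subst A Q D S \<in> tilings A"
  by (simp add: in_tilings_iff tile_subst_subset Lam_tile_subst tiling_points_subst_pts)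

lemma tile_subst_pow_in_tilings: "S \<in> tilings A \<Longrightarrow> (tile_subst A Q D ^^ n) S \<in> tilings A"
  by (induction n) (auto intro: tile_subst_in_tilings)

lemma tile_subst_shift: "tile_subst A Q D (shift_tiles g S) = shift_tiles (Q g) (tile_subst A Q D S)"
proof (rule Lam_inject)
  show "shift_tiles (Q g) (tile_subst A Q D S) \<subseteq> tiles A"
    by (intro shift_tiles_subset tile_subst_subset)
qed (simp_all add: tile_subst_subset Lam_tile_subst Lam_shift subst_pts_shift)

lemma tile_subst_pow_shift: "(tile_subst A Q D ^^ n) (shift_tiles g S) =
    shift_tiles ((Q ^^ n) g) ((tile_subst A Q D ^^ n) S)"
  by (induction n) (auto simp: tile_subst_shift)

section \<open>Uniform continuity of translation and substitution\<close>

lemma shift_uniformly_continuous: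
  assumes e: "e > 0"
  obtains d where "d > 0"
    "\<And>S S'. tiling_dist A S S' < d \<Longrightarrow> tiling_dist A (shift_tiles g S) (shift_tiles g S') < e"
proof -
  define e' where "e' = e / 2"
  have e': "e' > 0" "e' < e" using e by (auto simp: e'_def)
  \<comment> \<open>The last entry makes the ball of radius \<open>1 / d\<close> contain the
    translate by \<open>-g\<close> of the ball of radius \<open>1 / e'\<close>.\<close>
  define d where "d = min (1 / sqrt 2) (min e' (1 / (1 / e' + norm g)))"
  have pos: "1 / e' + norm g > 0" using e' by (simp add: add_pos_nonneg)
  then have d: "d > 0" "d \<le> 1 / sqrt 2" "d \<le> e'" "d \<le> 1 / (1 / e' + norm g)"
    using e' by (auto simp: d_def)
  have d': "1 / e' + norm g \<le> 1 / d" using d(1,4) pos by (simp add: field_simps)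
  have near: "near_set e' (shift_pts g L) (shift_pts g L')"
      if n: "near_set d L L'" for L L' :: "((real^'n) \<times> 'k) set"
    unfolding near_set_def
  proof (intro allI impI)
    fix x i assume x: "(x, i) \<in> shift_pts g L'" "norm x < 1 / e'"
    have "norm (x - g) < 1 / d" using x(2) d' norm_triangle_ineq4[of x g] by simp
    then obtain y where y: "(y, i) \<in> L" "dist (x - g) y < d"
      using n x(1) unfolding near_set_def by auto
    then show "\<exists>y. (y, i) \<in> shift_pts g L \<and> dist x y < e'"
      using d(3) by (intro exI[of _ "y + g"]) (auto simp: dist_norm algebra_simps)
  qed
  show thesis
  proof (rule that[OF d(1)])
    fix S S' assume "tiling_dist A S S' < d"
    then have "close_tilings A d S S'" using d(2) by (rule close_if_tiling_dist_less)
    then have "close_tilings A e' (shift_tiles g S) (shift_tiles g S')"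
      using near by (simp add: close_tilings_iff Lam_shift)
    then show "tiling_dist A (shift_tiles g S) (shift_tiles g S') < e"
      using tiling_dist_le_if_close e' by fastforce
  qed
qed

lemma tile_subst_uniformly_continuous:
  assumes e: "e > 0"
  obtains d where "d > 0"
    "\<And>S S'. tiling_dist A S S' < d \<Longrightarrow> tiling_dist A (tile_subst A Q D S) (tile_subst A Q D S') < e"
proof -
  define e' where "e' = e / 2"
  have e': "e' > 0" "e' < e" using e by (auto simp: e'_def)
  obtain B where B: "B > 0" "\<And>x. norm (Q x) \<le> B * norm x" using linear_bounded_pos[OF linQ] by blast
  obtain K where K: "K > 0" "\<And>x. norm (inv Q x) \<le> K * norm x" using linear_bounded_pos[OF linQi] by blast
  have "finite (\<Union>i j. D i j)" using finD by auto
  then obtain C where C: "C > 0" "\<And>u i j. u \<in> D i j \<Longrightarrow> norm u \<le> C"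
    using finite_imp_bounded[of "\<Union>i j. D i j"] unfolding bounded_pos by (metis UN_I UNIV_I)
  \<comment> \<open>The entry \<open>e' / B\<close> allows for the stretching of displacements by
    \<open>Q\<close>. The last one makes the ball of radius \<open>1 / d\<close> contain the parents
    of all tiles placed within \<open>1 / e'\<close>: undo an offset of norm at most
    \<open>C\<close>, then apply \<open>inv Q\<close>.\<close>
  define d where "d = min (1 / sqrt 2) (min (e' / B) (1 / (K * (1 / e' + C))))"
  have pos: "K * (1 / e' + C) > 0" using e' K(1) C(1) by (simp add: add_pos_pos)
  then have d: "d > 0" "d \<le> 1 / sqrt 2" "d \<le> e' / B" "d \<le> 1 / (K * (1 / e' + C))"
    using e' B by (auto simp: d_def)
  have d': "K * (1 / e' + C) \<le> 1 / d" using d(1,4) pos by (simp add: field_simps)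
  have near: "near_set e' (subst_pts L) (subst_pts L')" if n: "near_set d L L'" for L L'
    unfolding near_set_def
  proof (intro allI impI)
    fix y i assume y: "(y, i) \<in> subst_pts L'" "norm y < 1 / e'"
    then obtain x j where x: "(x, j) \<in> L'" "y - Q x \<in> D i j" by (auto simp: mem_subst_pts)
    have "norm (Q x) < 1 / e' + C"
      using y(2) C(2)[OF x(2)] norm_triangle_ineq4[of y "y - Q x"] by simp
    then have "K * norm (Q x) < K * (1 / e' + C)" using K(1) by simp
    moreover have "norm x \<le> K * norm (Q x)"
      using K(2)[of "Q x"] bijQ by (simp add: bij_is_inj inv_f_f)
    ultimately have "norm x < 1 / d" using d' by linarith
    then obtain z where z: "(z, j) \<in> L" "dist x z < d" using n x(1) unfolding near_set_def by blast
    have "norm (Q (z - x)) \<le> B * norm (z - x)" by (rule B)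
    also have "\<dots> < B * d" using z(2) B(1) by (simp add: dist_norm norm_minus_commute)
    also have "\<dots> \<le> e'" using d(3) B(1) by (simp add: field_simps)
    finally have "dist y (y + Q (z - x)) < e'" by (simp add: dist_norm)
    moreover have "(y + Q (z - x), i) \<in> subst_pts L"
      using z(1) x(2) by (auto simp: mem_subst_pts Q_diff intro!: exI[of _ z] exI[of _ j])
    ultimately show "\<exists>z. (z, i) \<in> subst_pts L \<and> dist y z < e'" by blast
  qed
  show thesis
  proof (rule that[OF d(1)])
    fix S S' assume "tiling_dist A S S' < d"
    then have "close_tilings A d S S'" using d(2) by (rule close_if_tiling_dist_less)
    then have "close_tilings A e' (tile_subst A Q D S) (tile_subst A Q D S')"
      using near by (simp add: close_tilings_iff Lam_tile_subst)
    then show "tiling_dist A (tile_subst A Q D S) (tile_subst A Q D S') < e"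
      using tiling_dist_le_if_close e' by fastforce
  qed
qed

lemma continuous_map_shift: "continuous_map (tilings_topology A) (tilings_topology A) (shift_tiles g)"
  unfolding tilings_topology_eq tilings.metric_continuous_map[OF tilings.Metric_space_axioms]
proof (intro conjI ballI allI impI)
  fix e :: real assume "e > 0"
  then obtain d where "d > 0"
    "\<And>S S'. tiling_dist A S S' < d \<Longrightarrow> tiling_dist A (shift_tiles g S) (shift_tiles g S') < e"
    using shift_uniformly_continuous by blast
  then show "\<exists>d>0. \<forall>S'. S' \<in> tilings A \<and> tiling_dist A S S' < d \<longrightarrow>
      tiling_dist A (shift_tiles g S) (shift_tiles g S') < e" for S
    by blast
qed (auto intro: shift_in_tilings)

lemma continuous_map_tile_subst: "continuous_map (tilings_topology A) (tilings_topology A)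
    (tile_subst A Q D)"
  unfolding tilings_topology_eq tilings.metric_continuous_map[OF tilings.Metric_space_axioms]
proof (intro conjI ballI allI impI)
  fix e :: real assume "e > 0"
  then obtain d where "d > 0"
    "\<And>S S'. tiling_dist A S S' < d \<Longrightarrow> tiling_dist A (tile_subst A Q D S) (tile_subst A Q D S') < e"
    using tile_subst_uniformly_continuous by blast
  then show "\<exists>d>0. \<forall>S'. S' \<in> tilings A \<and> tiling_dist A S S' < d \<longrightarrow>
      tiling_dist A (tile_subst A Q D S) (tile_subst A Q D S') < e" for S
    by blast
qed (auto intro: tile_subst_in_tilings)

lemma continuous_map_tile_subst_pow: "continuous_map (tilings_topology A) (tilings_topology A)
    (tile_subst A Q D ^^ n)"
proof (induction n)
  case (Suc n)
  then show ?case unfolding funpow.simps using continuous_map_tile_subst by (rule continuous_map_compose)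
qed (simp add: id_def)

end

section \<open>The hull\<close>

locale primitive_subst_tiling = tile_subst_system A Q D
  for A :: "'k::finite \<Rightarrow> (real^'n) set" and Q D +
  fixes T :: "('n, 'k) tile set"
  assumes T_tiling: "T \<in> tilings A" and T_fixed: "tile_subst A Q D T = T" and prim: "primitive D"
begin

lemma subst_pts_entry:
  assumes "((\<lambda>N. subst_matrix D ** N) ^^ m) (mat 1) $ i $ j \<noteq> 0"
  shows "\<exists>u. (u, i) \<in> (subst_pts ^^ m) {(0, j)}"
  using assms
proof (induction m arbitrary: i)
  case 0
  then show ?case by (auto simp: mat_def split: if_splits)
next
  case (Suc m)
  have "(\<Sum>l\<in>UNIV. subst_matrix D $ i $ l * ((\<lambda>N. subst_matrix D ** N) ^^ m) (mat 1) $ l $ j) \<noteq> 0"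
    using Suc.prems by (simp add: matrix_matrix_mult_def)
  then obtain l where l: "subst_matrix D $ i $ l * ((\<lambda>N. subst_matrix D ** N) ^^ m) (mat 1) $ l $ j \<noteq> 0"
    by (meson sum.neutral)
  then obtain v where v: "(v, l) \<in> (subst_pts ^^ m) {(0, j)}" using Suc.IH by auto
  have "card (D i l) \<noteq> 0" using l by (simp add: subst_matrix_def)
  then obtain u where "u \<in> D i l" by fastforce
  then have "(Q v + u, i) \<in> subst_pts ((subst_pts ^^ m) {(0, j)})"
    unfolding mem_subst_pts using v by (intro exI[of _ v] exI[of _ l]) simp
  then show ?case by auto
qed

text \<open>Primitivity read geometrically: every order-\<open>m\<close> supertile contains tiles of
  all types.\<close>

definition covers_types :: "nat \<Rightarrow> bool" where
  "covers_types m \<longleftrightarrow> (\<forall>i j. \<exists>u. (u, i) \<in> (subst_pts ^^ m) {(0, j)})"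

lemma covers_types_add:
  assumes "covers_types a" "covers_types b" shows "covers_types (a + b)"
  unfolding covers_types_def
proof (intro allI)
  fix i j
  obtain v where v: "(v, i) \<in> (subst_pts ^^ b) {(0, j)}"
      using assms(2) unfolding covers_types_def by blast
  obtain u where u: "(u, i) \<in> (subst_pts ^^ a) {(0, i)}"
      using assms(1) unfolding covers_types_def by blast
  have "((Q ^^ a) v + u, i) \<in> (subst_pts ^^ a) ((subst_pts ^^ b) {(0, j)})"
    unfolding mem_subst_pts_pow[of _ _ a "(subst_pts ^^ b) {(0, j)}"] using u v
    by (intro exI[of _ v] exI[of _ i]) simp
  then show "\<exists>u. (u, i) \<in> (subst_pts ^^ (a + b)) {(0, j)}" by (auto simp: funpow_add)
qed

lemma ex_covers_types: obtains m where "m > 0" "covers_types m"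
  using prim subst_pts_entry unfolding primitive_def covers_types_def by blast

lemma covers_types_mult: "covers_types m \<Longrightarrow> covers_types (m * Suc k)"
  by (induction k) (auto intro: covers_types_add)

lemma T_fixed_pow: "(tile_subst A Q D ^^ n) T = T"
  by (induction n) (auto simp: T_fixed)

text \<open>Since \<open>T\<close> is fixed, each translate has an \<open>n\<close>-fold preimage
  that is again a translate of \<open>T\<close>, with its position known.\<close>

lemma shift_T_desubst: "shift_tiles g T = (tile_subst A Q D ^^ n) (shift_tiles ((inv Q ^^ n) g) T)"
  by (simp add: tile_subst_pow_shift T_fixed_pow)

lemma Lam_shift_T_desubst: "Lam A (shift_tiles g T) =
    (subst_pts ^^ n) (Lam A (shift_tiles ((inv Q ^^ n) g) T))"
  using shift_T_desubst[of g n] Lam_tile_subst_pow[of n "shift_tiles ((inv Q ^^ n) g) T"] by simp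

abbreviation "XT \<equiv> tiling_hull A T"

lemma shift_T_tiling: "shift_tiles g T \<in> tilings A"
  by (intro shift_in_tilings T_tiling)

lemma tiling_points_shift_T: "tiling_points A (Lam A (shift_tiles g T))"
  using shift_T_tiling in_tilings_iff by blast

lemma orbit_eq: "{shift_tiles (- g) T | g. True} = range (\<lambda>g. shift_tiles g T)"
proof -
  have "shift_tiles g T \<in> {shift_tiles (- g) T | g. True}" for g
    by (intro CollectI exI[of _ "- g"]) simp
  then show ?thesis by blast
qed

lemma hull_eq: "XT = tilings_topology A closure_of range (\<lambda>g. shift_tiles g T)"
  unfolding tiling_hull_def orbit_eq ..

lemma topspace_tilings [simp]: "topspace (tilings_topology A) = tilings A"
  by (simp add: tilings_topology_eq)

lemma hull_subset: "XT \<subseteq> tilings A"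
  unfolding hull_eq using closure_of_subset_topspace[of "tilings_topology A"] by simp

lemma shift_T_in_hull: "shift_tiles g T \<in> XT"
  unfolding hull_eq
  using closure_of_subset[of "range (\<lambda>g. shift_tiles g T)" "tilings_topology A"] shift_T_tiling by auto

text \<open>The transfer principle from the orbit to the hull: a closed condition need only be
  tested on translates of \<open>T\<close>.\<close>

lemma hull_minimal:
  assumes "closedin (tilings_topology A) C" "\<And>g. shift_tiles g T \<in> C" shows "XT \<subseteq> C"
  unfolding hull_eq using assms by (intro closure_of_minimal) auto

lemma hull_image:
  assumes f: "continuous_map (tilings_topology A) (tilings_topology A) f"
    and orbit: "\<And>g. f (shift_tiles g T) \<in> XT" and S: "S \<in> XT"
  shows "f S \<in> XT"
proof -
  have "f ` XT \<subseteq> tilings_topology A closure_of (f ` range (\<lambda>g. shift_tiles g T))"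
    unfolding hull_eq by (rule continuous_map_image_closure_subset[OF f])
  also have "\<dots> \<subseteq> XT"
  proof (rule closure_of_minimal)
    show "closedin (tilings_topology A) XT" unfolding hull_eq by simp
  qed (use orbit in auto)
  finally show ?thesis using S by blast
qed

lemma shift_in_hull: "S \<in> XT \<Longrightarrow> shift_tiles g S \<in> XT"
  by (rule hull_image[OF continuous_map_shift]) (simp_all add: shift_T_in_hull)

lemma tile_subst_in_hull: "S \<in> XT \<Longrightarrow> tile_subst A Q D S \<in> XT"
  by (rule hull_image[OF continuous_map_tile_subst]) (simp_all add:
      shift_T_in_hull tile_subst_shift T_fixed)

lemma tile_subst_pow_in_hull: "S \<in> XT \<Longrightarrow> (tile_subst A Q D ^^ n) S \<in> XT"
  by (induction n) (auto intro: tile_subst_in_hull)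

lemma continuous_map_tiling_dist:
  assumes "continuous_map X (tilings_topology A) f" "continuous_map X (tilings_topology A) g"
  shows "continuous_map X euclideanreal (\<lambda>S. tiling_dist A (f S) (g S))"
proof -
  have "mtopology_of tilings.Self = tilings_topology A"
    by (simp add: mtopology_of_def tilings_topology_eq)
  then show ?thesis using continuous_map_mdist[of X tilings.Self f g] assms by simp
qed

lemma closedin_tiling_dist_le:
  "closedin (tilings_topology A) {S \<in> tilings A. tiling_dist A (shift_tiles g S) (shift_tiles h S) \<le> e}"
proof -
  have "closedin (tilings_topology A) {S \<in> topspace (tilings_topology A). tiling_dist A (shift_tiles
      g S) (shift_tiles h S) \<in> {..e}}"
    by (rule closedin_continuous_map_preimage[OF continuous_map_tiling_dist[OF continuous_map_shift
        continuous_map_shift]]) simp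
  then show ?thesis by simp
qed

text \<open>Translations commute, so a period of \<open>T\<close> fixes every translate of
  \<open>T\<close>; being at distance 0 from one's own translate is a closed condition.\<close>

lemma periods_fix_hull:
  assumes "k \<in> periods T" "S \<in> XT" shows "shift_tiles (- k) S = S"
proof -
  let ?C = "{S \<in> tilings A. tiling_dist A (shift_tiles (- k) S) (shift_tiles 0 S) \<le> 0}"
  have "XT \<subseteq> ?C"
  proof (rule hull_minimal[OF closedin_tiling_dist_le])
    fix g
    have "shift_tiles (- k) (shift_tiles g T) = shift_tiles g (shift_tiles (- k) T)"
      by (simp add: add.commute)
    also have "shift_tiles (- k) T = T" using assms(1) by (simp only: periods_def mem_Collect_eq)
    finally have "shift_tiles (- k) (shift_tiles g T) = shift_tiles g T" .
    then show "shift_tiles g T \<in> ?C"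
      using shift_T_tiling by simp
  qed
  then have "tiling_dist A (shift_tiles (- k) S) S \<le> 0" "S \<in> tilings A" using assms(2) by auto
  then show ?thesis
    using tiling_dist_nonneg[of A "shift_tiles (- k) S" S] tiling_dist_0_iff[OF shift_in_tilings] by
        force
qed

section \<open>Recurrence of legal pairs\<close>

lemma Xi_legal_occurrence:
  assumes "z \<in> Xi_legal A Q D T"
  obtains w j k l where "(w, j) \<in> (subst_pts ^^ k) {(0, l)}" "(w + z, j) \<in> (subst_pts ^^ k) {(0, l)}"
proof -
  obtain P t t' where P: "legal A Q D P" "t \<in> P" "t' \<in> P" "t' = shift_tile z t"
    using assms unfolding Xi_legal_def by blast
  obtain g k i where g: "P \<subseteq> shift_tiles g ((tile_subst A Q D ^^ k) {prototile A i})" and "P \<subseteq> tiles A"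
    using P(1) unfolding legal_def patch_def by blast
  then obtain x j where t: "t = shift_tile x (prototile A j)" using P(2) unfolding tiles_def by blast
  have mem: "(y - g, j) \<in> (subst_pts ^^ k) {(0, i)}" if "shift_tile y (prototile A j) \<in> P" for y
  proof -
    have "(y, j) \<in> Lam A (shift_tiles g ((tile_subst A Q D ^^ k) {prototile A i}))"
      using g that by (auto simp: Lam_iff)
    then show ?thesis by (simp add: Lam_shift Lam_tile_subst_pow Lam_single)
  qed
  have "t' = shift_tile (z + x) (prototile A j)" by (simp add: P(4) t)
  then have "(x - g, j) \<in> (subst_pts ^^ k) {(0, i)}" "(z + x - g, j) \<in> (subst_pts ^^ k) {(0, i)}"
    using mem P(2,3) t by auto
  moreover have "z + x - g = x - g + z" by simp
  ultimately show thesis using that by metis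
qed

text \<open>Desubstitute \<open>k + m\<close> times and take the tile over the origin. Its
  order-\<open>m\<close> supertile contains a tile of type \<open>l\<close> by primitivity, and the
  order-\<open>k\<close> supertile of that one contains the pair. The bound involves neither the
  translation \<open>h\<close> nor the tiling around.\<close>

lemma legal_pair_recurrent:
  assumes "z \<in> Xi_legal A Q D T"
  obtains R j where "\<And>h. \<exists>y. norm y \<le> R \<and> (y, j) \<in> Lam A (shift_tiles h T) \<and>
      (y + z, j) \<in> Lam A (shift_tiles h T)"
proof -
  obtain w j k l where w: "(w, j) \<in> (subst_pts ^^ k) {(0, l)}" "(w + z, j) \<in> (subst_pts ^^ k) {(0, l)}"
    using Xi_legal_occurrence[OF assms] by blast
  obtain m where m: "covers_types m" using ex_covers_types by blast
  obtain u where u: "\<And>i. (u i, l) \<in> (subst_pts ^^ m) {(0, i)}"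
      using m unfolding covers_types_def by metis
  define C where "C = Max (range (\<lambda>i. norm (u i)))"
  have C: "norm (u i) \<le> C" for i by (simp add: C_def)
  obtain \<rho> where \<rho>: "\<rho> > 0" "\<And>i a. a \<in> A i \<Longrightarrow> norm a < \<rho>" using proto_bounded by blast
  obtain B where B: "B > 0" "\<And>x. norm ((Q ^^ m) x) \<le> B * norm x"
      using linear_bounded_pos[OF linQn] by blast
  obtain B' where B': "B' > 0" "\<And>x. norm ((Q ^^ k) x) \<le> B' * norm x"
      using linear_bounded_pos[OF linQn] by blast
  show thesis
  \<comment> \<open>The constant follows the descent: a tile over the origin sits within
    \<open>\<rho>\<close>, then come \<open>Q^m\<close> and an offset of norm at most
    \<open>C\<close>, then \<open>Q^k\<close> and the offset \<open>w\<close>.\<close>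
  proof (rule that[of "B' * (B * \<rho> + C) + norm w" j])
    fix h
    define L where "L = Lam A (shift_tiles ((inv Q ^^ (k + m)) h) T)"
    have L: "Lam A (shift_tiles h T) = (subst_pts ^^ k) ((subst_pts ^^ m) L)"
      using Lam_shift_T_desubst[of h "k + m"] by (simp add: L_def funpow_add)
    have "0 \<in> supp L" using tiling_points_shift_T unfolding L_def tiling_points_iff_supp by simp
    then obtain x i where x: "(x, i) \<in> L" "- x \<in> A i" unfolding mem_supp by auto
    have "norm x \<le> \<rho>" using \<rho>(2)[OF x(2)] by simp
    define v where "v = (Q ^^ m) x + u i"
    have v: "(v, l) \<in> (subst_pts ^^ m) L"
      unfolding v_def mem_subst_pts_pow[of _ _ m L] using x(1) u by (intro exI[of _ x] exI[of _ i]) simp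
    define y where "y = (Q ^^ k) v + w"
    have "(y, j) \<in> Lam A (shift_tiles h T)"
      unfolding L mem_subst_pts_pow[of _ _ k "(subst_pts ^^ m) L"]
          using v w(1) by (intro exI[of _ v] exI[of _ l]) (simp add: y_def)
    moreover have "(y + z, j) \<in> Lam A (shift_tiles h T)"
      unfolding L mem_subst_pts_pow[of _ _ k "(subst_pts ^^ m) L"] using v w(2)
      by (intro exI[of _ v] exI[of _ l]) (simp add: y_def algebra_simps)
    moreover have "norm y \<le> B' * (B * \<rho> + C) + norm w"
    proof -
      have "norm v \<le> norm ((Q ^^ m) x) + norm (u i)" unfolding v_def by (rule norm_triangle_ineq)
      also have "norm ((Q ^^ m) x) \<le> B * \<rho>"
        using B \<open>norm x \<le> \<rho>\<close> by (meson mult_left_mono order_trans less_imp_le)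
      finally have "norm v \<le> B * \<rho> + C" using C[of i] by linarith
      then have "norm ((Q ^^ k) v) \<le> B' * (B * \<rho> + C)"
        using B' by (meson mult_left_mono order_trans less_imp_le)
      then show ?thesis unfolding y_def using norm_triangle_ineq[of "(Q ^^ k) v" w] by linarith
    qed
    ultimately show "\<exists>y. norm y \<le> B' * (B * \<rho> + C) + norm w \<and> (y, j) \<in> Lam A (shift_tiles h T) \<and>
        (y + z, j) \<in> Lam A (shift_tiles h T)"
      by blast
  qed
qed

lemma Qn_covers_ball:
  assumes "r > 0"
  obtains n0 where "\<And>n. n \<ge> n0 \<Longrightarrow> ball 0 R \<subseteq> (Q ^^ n) ` ball 0 r"
proof -
  obtain \<kappa> where \<kappa>: "\<kappa> \<longlonglongrightarrow> 0" "\<And>n v. norm ((inv Q ^^ n) v) \<le> \<kappa> n * norm v" "\<And>n. \<kappa> n \<ge> 0"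
    using expansive_inverse_decay[OF expQ] by blast
  have "(\<lambda>n. \<kappa> n * R) \<longlonglongrightarrow> 0 * R" by (intro tendsto_intros \<kappa>(1))
  then have "eventually (\<lambda>n. \<kappa> n * R < r) sequentially"
    using assms by (auto dest: order_tendstoD(2)[where a = r])
  then obtain n0 where n0: "\<And>n. n \<ge> n0 \<Longrightarrow> \<kappa> n * R < r" by (auto simp: eventually_sequentially)
  show thesis
  proof (rule that[of n0], rule subsetI)
    fix n p assume n: "n \<ge> n0" and p: "p \<in> ball (0 :: real^'n) R"
    have "norm ((inv Q ^^ n) p) \<le> \<kappa> n * R"
      using \<kappa>(2)[of n p] mult_left_mono[OF _ \<kappa>(3)[of n], of "norm p" R] p by simp
    then have "(inv Q ^^ n) p \<in> ball 0 r" using n0[OF n] by simp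
    then show "p \<in> (Q ^^ n) ` ball 0 r" by (intro image_eqI[of _ _ "(inv Q ^^ n) p"]) auto
  qed
qed

theorem legal_return_close:
  assumes "z \<in> Xi_legal A Q D T"
  obtains F where "finite F" "F \<noteq> {}"
    "\<And>e. e > 0 \<Longrightarrow> \<exists>n0. \<forall>n\<ge>n0. \<forall>S\<in>XT. \<exists>x\<in>F.
       tiling_dist A (shift_tiles (- (Q ^^ n) x) S) (shift_tiles (- (Q ^^ n) x - (Q ^^ n) z) S) \<le> e"
proof -
  obtain R j where R: "\<And>h. \<exists>y. norm y \<le> R \<and> (y, j) \<in> Lam A (shift_tiles h T) \<and>
      (y + z, j) \<in> Lam A (shift_tiles h T)"
    using legal_pair_recurrent[OF assms] by blast
  obtain r c where r: "r > 0" "\<And>i. ball (c i) r \<subseteq> interior (A i)" using proto_inner_ball by blast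
  obtain \<rho> where \<rho>: "\<rho> > 0" "\<And>i a. a \<in> A i \<Longrightarrow> norm a < \<rho>" using proto_bounded by blast
  \<comment> \<open>The first tile of the pair contains the ball of radius \<open>r\<close> about
    \<open>c j + y\<close>, which ranges over \<open>cball (c j) R\<close>. For a net point within
    \<open>r / 2\<close> of that centre, the ball of radius \<open>r / 2\<close> about the net point
    lies in the tile. The net depends neither on \<open>n\<close> nor on the precision.\<close>
  have "\<exists>F. finite F \<and> cball (c j) R \<subseteq> (\<Union>x\<in>F. ball x (r / 2))"
    using compact_cball[of "c j" R] r(1) unfolding compact_eq_totally_bounded by force
  then obtain F where F: "finite F" "cball (c j) R \<subseteq> (\<Union>x\<in>F. ball x (r / 2))" by blast
  have "F \<noteq> {}"
  proof -
    obtain y :: "real^'n" where "norm y \<le> R" using R[of 0] by blast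
    then have "0 \<le> R" using norm_ge_zero order_trans by blast
    then have "c j \<in> cball (c j) R" by simp
    then show ?thesis using F(2) by blast
  qed
  show thesis
  proof (rule that[OF F(1) \<open>F \<noteq> {}\<close>])
    fix e :: real assume e: "e > 0"
    \<comment> \<open>At these levels the supertile of a tile containing the ball of radius
      \<open>r / 2\<close> about the origin covers all tiles placed within
      \<open>1 / e\<close>.\<close>
    obtain n0 where n0: "\<And>n. n \<ge> n0 \<Longrightarrow> ball 0 (1 / e + \<rho>) \<subseteq> (Q ^^ n) ` ball 0 (r / 2)"
      using Qn_covers_ball[of "r / 2"] r(1) by (meson half_gt_zero)
    show "\<exists>n0. \<forall>n\<ge>n0. \<forall>S\<in>XT. \<exists>x\<in>F.
       tiling_dist A (shift_tiles (- (Q ^^ n) x) S) (shift_tiles (- (Q ^^ n) x - (Q ^^ n) z) S) \<le> e"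
    proof (intro exI[of _ n0] allI impI)
      fix n assume n: "n \<ge> n0"
      \<comment> \<open>A union of closed sets over the finite set \<open>F\<close>, hence closed
        although the choice of \<open>x\<close> depends on the tiling.\<close>
      let ?C = "\<Union>x\<in>F. {S \<in> tilings A. tiling_dist A (shift_tiles (- (Q ^^ n) x) S) (shift_tiles (-
          (Q ^^ n) x - (Q ^^ n) z) S) \<le> e}"
      have "XT \<subseteq> ?C"
      proof (rule hull_minimal)
        show "closedin (tilings_topology A) ?C"
          using F(1) by (intro closedin_Union) (auto intro: closedin_tiling_dist_le)
      next
        fix h
        define h' where "h' = (inv Q ^^ n) h"
        define L where "L = Lam A (shift_tiles h' T)"
        have L: "Lam A (shift_tiles h T) = (subst_pts ^^ n) L"
          unfolding L_def h'_def by (rule Lam_shift_T_desubst)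
        obtain y where y: "norm y \<le> R" "(y, j) \<in> L" "(y + z, j) \<in> L"
          using R[of h'] unfolding L_def by blast
        have "c j + y \<in> cball (c j) R" using y(1) by (simp add: dist_norm)
        then obtain x where x: "x \<in> F" "dist x (c j + y) < r / 2" using F(2) by auto
        \<comment> \<open>The shared patch: the tile at \<open>y\<close> moved by \<open>-x\<close>
          and the tile at \<open>y + z\<close> moved by \<open>-x - z\<close> land at the same
          place, and so do their order-\<open>n\<close> supertiles.\<close>
        define P where "P = (subst_pts ^^ n) {(y - x, j)}"
        define S1 where "S1 = shift_tiles (- (Q ^^ n) x) (shift_tiles h T)"
        define S2 where "S2 = shift_tiles (- (Q ^^ n) x - (Q ^^ n) z) (shift_tiles h T)"
        have S1: "Lam A S1 = (subst_pts ^^ n) (shift_pts (- x) L)"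
          unfolding S1_def Lam_shift[of A "- (Q ^^ n) x"] L subst_pts_pow_shift by (simp add: Qn_minus)
        have S2: "Lam A S2 = (subst_pts ^^ n) (shift_pts (- x - z) L)"
          unfolding S2_def Lam_shift[of A "- (Q ^^ n) x - (Q ^^ n) z"] L subst_pts_pow_shift
              by (simp add: Qn_minus Qn_diff)
        have P: "P \<subseteq> Lam A S1" "P \<subseteq> Lam A S2"
          unfolding P_def S1 S2 using y by (auto intro!: subst_pts_pow_mono simp: algebra_simps)
        have sub: "ball 0 (1 / e + \<rho>) \<subseteq> supp P"
        proof -
          have "ball 0 (r / 2) \<subseteq> supp {(y - x, j)}"
          proof
            fix q :: "real^'n" assume q: "q \<in> ball 0 (r / 2)"
            have "dist (c j) (q - (y - x)) = norm ((c j + y - x) - q)"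
                by (simp add: dist_norm algebra_simps)
            also have "\<dots> \<le> norm (c j + y - x) + norm q" by (rule norm_triangle_ineq4)
            also have "\<dots> < r" using q x(2) by (simp add: dist_norm norm_minus_commute)
            finally have "q - (y - x) \<in> ball (c j) r" by simp
            then have "q - (y - x) \<in> A j" using r(2)[of j] interior_subset by blast
            then show "q \<in> supp {(y - x, j)}" unfolding mem_supp by auto
          qed
          then have "(Q ^^ n) ` ball 0 (r / 2) \<subseteq> supp P"
            unfolding P_def supp_subst_pts_pow by (rule image_mono)
          then show ?thesis using n0[OF n] by blast
        qed
        have tp: "tiling_points A (Lam A S1)" "tiling_points A (Lam A S2)"
          unfolding S1_def S2_def shift_tiles_shift_tiles by (rule tiling_points_shift_T)+
        have "near_set e (Lam A S2) (Lam A S1)" "near_set e (Lam A S1) (Lam A S2)"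
          using common_patch_near_set[OF tp(1) P(1,2) sub \<rho>(2) e] common_patch_near_set[OF tp(2)
              P(2,1) sub \<rho>(2) e] by simp_all
        then have "tiling_dist A S1 S2 \<le> e"
          using e by (intro tiling_dist_le_if_close) (simp_all add: close_tilings_iff)
        then show "shift_tiles h T \<in> ?C"
          using x(1) shift_T_tiling unfolding S1_def S2_def by blast
      qed
      then show "\<forall>S\<in>XT. \<exists>x\<in>F. tiling_dist A (shift_tiles (- (Q ^^ n) x) S) (shift_tiles (- (Q ^^ n)
          x - (Q ^^ n) z) S) \<le> e"
        by blast
    qed
  qed
qed

end

section \<open>Eigenvalues of an invariant measure\<close>

locale invariant_tiling_measure = primitive_subst_tiling A Q D T
  for A :: "'k::finite \<Rightarrow> (real^'n) set" and Q D T +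
  fixes \<mu> :: "('n, 'k) tile set measure"
  assumes invariant: "invariant_prob A T \<mu>"
begin

sublocale prob_space \<mu>
  using invariant by (simp add: invariant_prob_def)

lemma space_\<mu>: "space \<mu> = XT"
  using invariant by (simp add: invariant_prob_def)

lemma topspace_hull_topology: "topspace (hull_topology A T) = XT"
  using hull_subset by (auto simp: hull_topology_def)

lemma opens_subset: "{U. openin (hull_topology A T) U} \<subseteq> Pow XT"
  using openin_subset[of "hull_topology A T"] by (auto simp: topspace_hull_topology)

lemma sets_\<mu>: "sets \<mu> = sigma_sets XT {U. openin (hull_topology A T) U}"
  using invariant opens_subset by (simp add: invariant_prob_def hull_borel_def sets_measure_of)

lemma open_in_sets: "openin (hull_topology A T) U \<Longrightarrow> U \<in> sets \<mu>"
  by (simp add: sets_\<mu> sigma_sets.Basic)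

lemma shift_measurable: "shift_tiles g \<in> measurable \<mu> \<mu>"
  using invariant unfolding invariant_prob_def by (metis minus_minus)

lemma shift_preimage_sets: "B \<in> sets \<mu> \<Longrightarrow> {S \<in> XT. shift_tiles g S \<in> B} \<in> sets \<mu>"
  using measurable_sets[OF shift_measurable, of B g]
      by (simp add: vimage_def space_\<mu> Collect_conj_eq Int_commute)

lemma measure_shift_preimage:
  assumes "B \<in> sets \<mu>" shows "measure \<mu> {S \<in> XT. shift_tiles g S \<in> B} = measure \<mu> B"
proof -
  have "distr \<mu> \<mu> (shift_tiles g) = \<mu>"
    using invariant unfolding invariant_prob_def by (metis minus_minus)
  then have "measure \<mu> B = measure \<mu> (shift_tiles g -` B \<inter> space \<mu>)"
    using measure_distr[OF shift_measurable assms, of g] by simp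
  then show ?thesis by (simp add: vimage_def space_\<mu> Collect_conj_eq Int_commute)
qed

lemma continuous_map_hull_shift: "continuous_map (hull_topology A T) (tilings_topology A)
    (shift_tiles g)"
  unfolding hull_topology_def by (intro continuous_map_from_subtopology continuous_map_shift)

lemma openin_dist_less:
  assumes "continuous_map (hull_topology A T) euclideanreal f"
  shows "openin (hull_topology A T) {S \<in> XT. f S < e}"
proof -
  have "openin (hull_topology A T) {S \<in> topspace (hull_topology A T). f S \<in> {..<e}}"
    by (rule openin_continuous_map_preimage[OF assms]) simp
  then show ?thesis by (simp add: topspace_hull_topology)
qed

lemma openin_shift_close: "openin (hull_topology A T) {S \<in> XT. tiling_dist A S (shift_tiles v S) < e}"
  using openin_dist_less[OF continuous_map_tiling_dist[OF continuous_map_hull_shift[of 0]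
      continuous_map_hull_shift]]
  by simp

lemma openin_hull_ball: "S' \<in> tilings A \<Longrightarrow> openin (hull_topology A T) {S \<in> XT. tiling_dist A S S' < e}"
  using openin_dist_less[OF continuous_map_tiling_dist[OF continuous_map_hull_shift[of 0], of "\<lambda>_. S'"]]
  by simp

text \<open>The tilings on which \<open>B\<close> fails to respect closeness to the translate by
  \<open>v\<close>. Smallness of this set, uniformly in \<open>v\<close>, replaces continuity of the
  indicator of \<open>B\<close>.\<close>

definition separated_set :: "real \<Rightarrow> real^'n \<Rightarrow> ('n, 'k) tile set set \<Rightarrow> ('n, 'k) tile set set" where
  "separated_set e v B = {S \<in> XT. tiling_dist A S (shift_tiles v S) < e \<and>
      (S \<in> B) \<noteq> (shift_tiles v S \<in> B)}"

lemma separated_set_sets: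
  assumes B: "B \<in> sets \<mu>" shows "separated_set e v B \<in> sets \<mu>"
proof -
  have "separated_set e v B = {S \<in> XT. tiling_dist A S (shift_tiles v S) < e} \<inter>
      ((B - {S \<in> XT. shift_tiles v S \<in> B}) \<union> ({S \<in> XT. shift_tiles v S \<in> B} - B))"
    using sets.sets_into_space[OF B] by (auto simp: separated_set_def space_\<mu>)
  also have "\<dots> \<in> sets \<mu>"
    by (intro sets.Int sets.Un sets.Diff open_in_sets openin_shift_close shift_preimage_sets B)
  finally show ?thesis .
qed

text \<open>If exactly one of two close tilings lies in \<open>U\<close>, that one belongs to
  \<open>N k\<close>, the points of \<open>U\<close> near the complement. These sets shrink to the
  empty set because \<open>U\<close> is open, and by invariance it costs only a factor 2 that either
  the tiling or its translate may be the one in \<open>N k\<close>; hence no dependence on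
  \<open>v\<close>.\<close>

lemma separated_set_open:
  assumes U: "openin (hull_topology A T) U" and \<delta>: "\<delta> > 0"
  shows "\<exists>e>0. \<forall>v. measure \<mu> (separated_set e v U) \<le> \<delta>"
proof -
  define N where "N k = U \<inter> (\<Union>C\<in>XT - U. {S \<in> XT. tiling_dist A S C < 1 / real (Suc k)})" for k
  have UX: "U \<subseteq> XT" using openin_subset[OF U] by (simp add: topspace_hull_topology)
  have "openin (hull_topology A T) (N k)" for k
    unfolding N_def using U hull_subset by (intro openin_Int openin_clauses(3)) (auto intro!:
        openin_hull_ball)
  then have sets: "N k \<in> sets \<mu>" for k by (rule open_in_sets)
  have "decseq N"
  proof (rule antimonoI)
    fix a b :: nat assume "a \<le> b"
    then have "1 / real (Suc b) \<le> 1 / real (Suc a)" by (simp add: frac_le)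
    then show "N b \<subseteq> N a" unfolding N_def by (auto dest: order_less_le_trans)
  qed
  moreover have "(\<Inter>k. N k) = {}"
  proof (rule ccontr)
    assume "(\<Inter>k. N k) \<noteq> {}"
    then obtain S where S: "\<And>k. S \<in> N k" by blast
    have "S \<in> U" using S unfolding N_def by blast
    obtain V where V: "openin (tilings_topology A) V" "U = V \<inter> XT"
      using U unfolding hull_topology_def openin_subtopology by blast
    obtain r where r: "r > 0" "tilings.mball S r \<subseteq> V"
      using V \<open>S \<in> U\<close> unfolding tilings_topology_eq tilings.openin_mtopology by blast
    obtain k where k: "1 / real (Suc k) < r" using r(1) by (metis nat_approx_posE)
    obtain C where C: "C \<in> XT - U" "tiling_dist A S C < 1 / real (Suc k)"
        using S[of k] unfolding N_def by blast
    have "C \<in> tilings.mball S r" using C k \<open>S \<in> U\<close> UX hull_subset by auto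
    then show False using r(2) V(2) C(1) by blast
  qed
  ultimately have "(\<lambda>k. measure \<mu> (N k)) \<longlonglongrightarrow> 0"
    using finite_Lim_measure_decseq[of N] sets by auto
  then have "eventually (\<lambda>k. measure \<mu> (N k) < \<delta> / 2) sequentially"
    using \<delta> by (intro order_tendstoD(2)) auto
  then obtain k where k: "measure \<mu> (N k) < \<delta> / 2" by (auto simp: eventually_sequentially)
  have "measure \<mu> (separated_set (1 / real (Suc k)) v U) \<le> \<delta>" for v
  proof -
    have "separated_set (1 / real (Suc k)) v U \<subseteq> N k \<union> {S \<in> XT. shift_tiles v S \<in> N k}"
    proof
      fix S assume "S \<in> separated_set (1 / real (Suc k)) v U"
      then have S: "S \<in> XT" "tiling_dist A S (shift_tiles v S) < 1 / real (Suc k)"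
        "(S \<in> U) \<noteq> (shift_tiles v S \<in> U)" by (auto simp: separated_set_def)
      have "shift_tiles v S \<in> XT" using S(1) by (rule shift_in_hull)
      then show "S \<in> N k \<union> {S \<in> XT. shift_tiles v S \<in> N k}"
        using S tiling_dist_commute[of A S] unfolding N_def by auto
    qed
    then have "measure \<mu> (separated_set (1 / real (Suc k)) v U) \<le>
        measure \<mu> (N k \<union> {S \<in> XT. shift_tiles v S \<in> N k})"
      by (intro finite_measure_mono sets.Un sets shift_preimage_sets)
    also have "\<dots> \<le> measure \<mu> (N k) + measure \<mu> {S \<in> XT. shift_tiles v S \<in> N k}"
      by (intro measure_Un_le sets shift_preimage_sets)
    also have "\<dots> \<le> \<delta>" using k measure_shift_preimage[OF sets] by simp
    finally show ?thesis .
  qed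
  then show ?thesis by (intro exI[of _ "1 / real (Suc k)"]) simp
qed

text \<open>Only finitely many \<open>F i\<close> matter: the rest of the union, \<open>C n\<close>,
  has small measure, and so has its preimage under the translation. For the finitely many the
  smallest \<open>e i\<close> works.\<close>

lemma separated_set_union:
  fixes F :: "nat \<Rightarrow> ('n, 'k) tile set set"
  assumes sets: "\<And>i. F i \<in> sets \<mu>" and F: "\<And>i \<delta>. \<delta> > 0 \<Longrightarrow>
      \<exists>e>0. \<forall>v. measure \<mu> (separated_set e v (F i)) \<le> \<delta>"
    and \<delta>: "\<delta> > 0"
  shows "\<exists>e>0. \<forall>v. measure \<mu> (separated_set e v (\<Union>i. F i)) \<le> \<delta>"
proof -
  define C where "C n = (\<Union>i. F i) - (\<Union>i<n. F i)" for n
  have Csets: "C n \<in> sets \<mu>" for n unfolding C_def using sets by auto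
  have "decseq C" unfolding C_def by (intro antimonoI) auto
  moreover have "(\<Inter>n. C n) = {}" unfolding C_def by auto
  ultimately have "(\<lambda>n. measure \<mu> (C n)) \<longlonglongrightarrow> 0"
    using finite_Lim_measure_decseq[of C] Csets by auto
  then have "eventually (\<lambda>n. measure \<mu> (C n) < \<delta> / 4) sequentially"
    using \<delta> by (intro order_tendstoD(2)) auto
  then obtain n where n: "measure \<mu> (C n) < \<delta> / 4" by (auto simp: eventually_sequentially)
  \<comment> \<open>Half of \<open>\<delta>\<close> is for the \<open>n\<close> sets and half for
    the two copies of \<open>C n\<close>; the summand 1 keeps the denominator positive when
    \<open>n = 0\<close>.\<close>
  define \<eta> where "\<eta> = \<delta> / (2 * (real n + 1))"
  have "\<eta> > 0" using \<delta> by (simp add: \<eta>_def)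
  then obtain e where e: "\<And>i. e i > 0" "\<And>i v. measure \<mu> (separated_set (e i) v (F i)) \<le> \<eta>"
    using F by metis
  define m where "m = Min (insert 1 (e ` {..<n}))"
  have m: "m > 0" "\<And>i. i < n \<Longrightarrow> m \<le> e i" using e(1) by (auto simp: m_def)
  have "measure \<mu> (separated_set m v (\<Union>i. F i)) \<le> \<delta>" for v
  proof -
    let ?U = "\<Union>i<n. separated_set (e i) v (F i)"
    have "separated_set m v (\<Union>i. F i) \<subseteq> ?U \<union> (C n \<union> {S \<in> XT. shift_tiles v S \<in> C n})"
    proof
      fix S assume "S \<in> separated_set m v (\<Union>i. F i)"
      then have S: "S \<in> XT" "tiling_dist A S (shift_tiles v S) < m"
        "(S \<in> (\<Union>i. F i)) \<noteq> (shift_tiles v S \<in> (\<Union>i. F i))" by (auto simp: separated_set_def)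
      show "S \<in> ?U \<union> (C n \<union> {S \<in> XT. shift_tiles v S \<in> C n})"
      proof (cases "\<exists>i<n. S \<in> F i \<or> shift_tiles v S \<in> F i")
        case True
        then obtain i where i: "i < n" "S \<in> F i \<or> shift_tiles v S \<in> F i" by blast
        then have "(S \<in> F i) \<noteq> (shift_tiles v S \<in> F i)" using S(3) by blast
        moreover have "tiling_dist A S (shift_tiles v S) < e i" using S(2) m(2)[OF i(1)] by simp
        ultimately have "S \<in> separated_set (e i) v (F i)" using S(1) by (simp add: separated_set_def)
        then show ?thesis using i(1) by blast
      next
        case False
        then show ?thesis using S(1,3) unfolding C_def by blast
      qed
    qed
    then have "measure \<mu> (separated_set m v (\<Union>i. F i)) \<le>
        measure \<mu> (?U \<union> (C n \<union> {S \<in> XT. shift_tiles v S \<in> C n}))"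
      by (intro finite_measure_mono sets.Un sets.finite_UN separated_set_sets sets Csets
          shift_preimage_sets) auto
    also have "\<dots> \<le> measure \<mu> ?U + (measure \<mu> (C n) + measure \<mu> {S \<in> XT. shift_tiles v S \<in> C n})"
      by (intro order_trans[OF measure_Un_le] add_left_mono measure_Un_le
          sets.Un sets.finite_UN separated_set_sets sets Csets shift_preimage_sets) auto
    also have "\<dots> = measure \<mu> ?U + 2 * measure \<mu> (C n)"
      using measure_shift_preimage[OF Csets] by simp
    also have "measure \<mu> ?U \<le> (\<Sum>i<n. measure \<mu> (separated_set (e i) v (F i)))"
      by (intro finite_measure_subadditive_finite) (auto intro: separated_set_sets sets)
    also have "\<dots> \<le> (\<Sum>i<n. \<eta>)" by (intro sum_mono e)
    also have "\<dots> \<le> \<delta> / 2" using \<delta> by (simp add: \<eta>_def field_simps)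
    finally show ?thesis using n by simp
  qed
  then show ?thesis using m(1) by blast
qed

text \<open>The uniformity in \<open>v\<close> makes the statement stable under countable unions.\<close>

lemma separated_set_small:
  assumes "B \<in> sets \<mu>" "\<delta> > 0"
  shows "\<exists>e>0. \<forall>v. measure \<mu> (separated_set e v B) \<le> \<delta>"
proof -
  let ?G = "{U. openin (hull_topology A T) U}"
  have stable: "Int_stable ?G" by (auto simp: Int_stable_def)
  have "B \<in> sigma_sets XT ?G" using assms(1) by (simp add: sets_\<mu>)
  from stable opens_subset this have "\<forall>\<delta>>0. \<exists>e>0. \<forall>v. measure \<mu> (separated_set e v B) \<le> \<delta>"
  proof (induction rule: sigma_sets_induct_disjoint)
    case (basic U) then show ?case using separated_set_open by simp
  next
    case empty
    have "separated_set e v {} = {}" for e v by (simp add: separated_set_def)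
    then show ?case by (auto intro: exI[of _ 1])
  next
    case (compl B)
    \<comment> \<open>Being split by a set and by its complement is the same, the hull being
      translation invariant.\<close>
    have "separated_set e v (XT - B) = separated_set e v B" for e v
      using shift_in_hull by (auto simp: separated_set_def)
    then show ?case using compl.IH by simp
  next
    case (union F)
    have "F i \<in> sets \<mu>" for i using union.hyps by (auto simp: sets_\<mu>)
    moreover have "\<exists>e>0. \<forall>v. measure \<mu> (separated_set e v (F i)) \<le> \<delta>" if "\<delta> > 0" for i \<delta>
      using union.IH that by blast
    ultimately show ?case using separated_set_union by simp
  qed
  then show ?thesis using assms(2) by blast
qed

section \<open>Necessity of the two conditions\<close>

theorem eigenvalue_imp_periods:
  assumes "dyn_eigenvalue \<mu> \<alpha>" shows "period_condition T \<alpha>"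
  unfolding period_condition_def
proof
  fix g assume g: "g \<in> periods T"
  obtain f where f: "eigenfunction \<mu> \<alpha> f" using assms unfolding dyn_eigenvalue_def by blast
  have "AE S in \<mu>. f (shift_tiles (- g) S) = unit_char \<alpha> g * f S"
      using f unfolding eigenfunction_def by blast
  then have "AE S in \<mu>. f S = unit_char \<alpha> g * f S"
  proof (rule AE_mp[OF _ AE_I2], intro impI)
    fix S assume "S \<in> space \<mu>" "f (shift_tiles (- g) S) = unit_char \<alpha> g * f S"
    then show "f S = unit_char \<alpha> g * f S" using periods_fix_hull[OF g] by (simp add: space_\<mu>)
  qed
  show "unit_char \<alpha> g = 1"
  proof (rule ccontr)
    assume ne: "unit_char \<alpha> g \<noteq> 1"
    have "AE S in \<mu>. f S = 0"
      using \<open>AE S in \<mu>. f S = unit_char \<alpha> g * f S\<close> by eventually_elim (use ne in auto)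
    then show False using f unfolding eigenfunction_def by blast
  qed
qed

theorem eigenvalue_imp_legal_limit:
  assumes "dyn_eigenvalue \<mu> \<alpha>" shows "legal_limit_condition A Q D T \<alpha>"
  unfolding legal_limit_condition_def
proof (intro ballI LIMSEQ_I)
  fix z and \<epsilon> :: real assume z: "z \<in> Xi_legal A Q D T" and \<epsilon>: "0 < \<epsilon>"
  obtain f where "eigenfunction \<mu> \<alpha> f" using assms unfolding dyn_eigenvalue_def by blast
  then have [measurable]: "f \<in> borel_measurable \<mu>" and nz: "\<not> (AE S in \<mu>. f S = 0)"
    and eig: "\<And>x. AE S in \<mu>. f (shift_tiles (- x) S) = unit_char \<alpha> x * f S"
    unfolding eigenfunction_def by blast+
  define E where "E = {S \<in> space \<mu>. f S \<noteq> 0}"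
  have E [measurable]: "E \<in> sets \<mu>" unfolding E_def by measurable
  define p where "p = measure \<mu> E"
  have "p > 0"
  proof (rule ccontr)
    assume "\<not> p > 0"
    then have "measure \<mu> E = 0" unfolding p_def by (simp add: zero_less_measure_iff)
    then have "AE S in \<mu>. S \<notin> E" using E by (simp add: prob_eq_0)
    then have "AE S in \<mu>. f S = 0"
      by (rule AE_mp[OF _ AE_I2]) (simp add: E_def)
    then show False using nz by blast
  qed
  obtain F where F: "finite F" "F \<noteq> {}"
    "\<And>e. e > 0 \<Longrightarrow> \<exists>n0. \<forall>n\<ge>n0. \<forall>S\<in>XT. \<exists>x\<in>F.
       tiling_dist A (shift_tiles (- (Q ^^ n) x) S) (shift_tiles (- (Q ^^ n) x - (Q ^^ n) z) S) \<le> e"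
    using legal_return_close[OF z] by blast
  have "card F > 0" using F(1,2) by (simp add: card_gt_0_iff)
  \<comment> \<open>The modulus of \<open>f\<close> may vary from tiling to tiling; dividing it out
    on \<open>E\<close> leaves the phase, which takes values in the compact circle and satisfies the
    same equation.\<close>
  define h where "h S = f S / complex_of_real (cmod (f S))" for S
  have [measurable]: "h \<in> borel_measurable \<mu>" unfolding h_def[abs_def] by measurable
  have "\<exists>K. finite K \<and> sphere (0::complex) 1 \<subseteq> (\<Union>c\<in>K. ball c (\<epsilon> / 3))"
    using compact_sphere[of "0::complex" 1] \<epsilon> unfolding compact_eq_totally_bounded by force
  then obtain K where K: "finite K" "sphere (0::complex) 1 \<subseteq> (\<Union>c\<in>K. ball c (\<epsilon> / 3))" by blast
  \<comment> \<open>Level sets of the phase at scale \<open>\<epsilon> / 3\<close>: two tilings in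
    the same \<open>B c\<close> have phases less than \<open>2 * \<epsilon> / 3\<close>
    apart.\<close>
  define B where "B c = {S \<in> space \<mu>. f S \<noteq> 0 \<and> dist c (h S) < \<epsilon> / 3}" for c
  have B: "B c \<in> sets \<mu>" for c unfolding B_def by measurable
  \<comment> \<open>Chosen so that the exceptional sets of all \<open>c \<in> K\<close> together
    have measure below \<open>p / card F\<close>, the lower bound for
    \<open>G \<inter> E\<close>.\<close>
  define \<delta> where "\<delta> = p / (2 * real (card F) * (real (card K) + 1))"
  have "\<delta> > 0" using \<open>p > 0\<close> \<open>card F > 0\<close> by (simp add: \<delta>_def)
  then have "\<forall>c. \<exists>e>0. \<forall>v. measure \<mu> (separated_set e v (B c)) \<le> \<delta>"
    using separated_set_small[OF B] by blast
  then obtain e where e: "\<And>c. e c > 0" "\<And>c v. measure \<mu> (separated_set (e c) v (B c)) \<le> \<delta>" by metis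
  define m where "m = Min (insert 1 (e ` K))"
  have m: "m > 0" "\<And>c. c \<in> K \<Longrightarrow> m \<le> e c" using e(1) K(1) by (auto simp: m_def)
  \<comment> \<open>The halving turns the weak inequality supplied by the closed condition into the
    strict one that defines the open set \<open>G\<close>.\<close>
  obtain n0 where n0: "\<And>n S. n \<ge> n0 \<Longrightarrow> S \<in> XT \<Longrightarrow> \<exists>x\<in>F.
       tiling_dist A (shift_tiles (- (Q ^^ n) x) S) (shift_tiles (- (Q ^^ n) x - (Q ^^ n) z) S) \<le> m / 2"
    using F(3)[of "m / 2"] m(1) by (meson half_gt_zero)
  have "cmod (unit_char \<alpha> ((Q ^^ n) z) - 1) < \<epsilon>" if n: "n \<ge> n0" for n
  proof -
    define v where "v = (Q ^^ n) z"
    define G where "G = {S \<in> XT. tiling_dist A S (shift_tiles (- v) S) < m}"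
    have G: "G \<in> sets \<mu>" unfolding G_def by (intro open_in_sets openin_shift_close)
    \<comment> \<open>Almost every tiling of \<open>E\<close> is moved into \<open>G\<close> by some
      \<open>-Q^n x\<close> with \<open>x \<in> F\<close>, and stays in \<open>E\<close> by the
      eigenfunction equation. The translated copies of \<open>G \<inter> E\<close> have equal
      measure, so the resulting bound does not depend on \<open>n\<close>.\<close>
    have "p \<le> measure \<mu> (\<Union>x\<in>F. {S \<in> XT. shift_tiles (- (Q ^^ n) x) S \<in> G \<inter> E})"
      unfolding p_def
    proof (rule finite_measure_mono_AE)
      have "AE S in \<mu>. \<forall>x\<in>F. f (shift_tiles (- (Q ^^ n) x) S) = unit_char \<alpha> ((Q ^^ n) x) * f S"
        using F(1) eig by (intro AE_finite_allI) auto
      then show "AE S in \<mu>. S \<in> E \<longrightarrow> S \<in> (\<Union>x\<in>F. {S \<in> XT. shift_tiles (- (Q ^^ n) x) S \<in> G \<inter> E})"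
      proof (rule AE_mp[OF _ AE_I2], intro impI)
        fix S assume "S \<in> space \<mu>" and eqs: "\<forall>x\<in>F. f (shift_tiles (- (Q ^^ n) x) S) =
            unit_char \<alpha> ((Q ^^ n) x) * f S"
          and "S \<in> E"
        then have S: "S \<in> XT" "f S \<noteq> 0" by (auto simp: space_\<mu> E_def)
        obtain x where x: "x \<in> F" "tiling_dist A (shift_tiles (- (Q ^^ n) x) S) (shift_tiles (- (Q
            ^^ n) x - v) S) \<le> m / 2"
          using n0[OF n S(1)] unfolding v_def by blast
        have "- v + - (Q ^^ n) x = - (Q ^^ n) x - v" by simp
        then have "shift_tiles (- v) (shift_tiles (- (Q ^^ n) x) S) = shift_tiles (- (Q ^^ n) x - v) S"
          by (simp only: shift_tiles_shift_tiles)
        then have "shift_tiles (- (Q ^^ n) x) S \<in> G"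
          using x(2) m(1) shift_in_hull[OF S(1)] by (simp add: G_def)
        moreover have "shift_tiles (- (Q ^^ n) x) S \<in> E"
          using eqs x(1) S shift_in_hull[OF S(1)] by (simp add: E_def space_\<mu>)
        ultimately show "S \<in> (\<Union>x\<in>F. {S \<in> XT. shift_tiles (- (Q ^^ n) x) S \<in> G \<inter> E})"
          using x(1) S(1) by blast
      qed
    qed (intro sets.finite_UN F(1) shift_preimage_sets sets.Int G E)
    also have "\<dots> \<le> (\<Sum>x\<in>F. measure \<mu> {S \<in> XT. shift_tiles (- (Q ^^ n) x) S \<in> G \<inter> E})"
      by (intro finite_measure_subadditive_finite F(1) image_subsetI shift_preimage_sets sets.Int G E)
    also have "\<dots> = real (card F) * measure \<mu> (G \<inter> E)"
      using measure_shift_preimage[OF sets.Int[OF G E]] by simp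
    finally have GE: "p / real (card F) \<le> measure \<mu> (G \<inter> E)"
      using \<open>card F > 0\<close> by (simp add: field_simps)
    define bad where "bad = (\<Union>c\<in>K. separated_set (e c) (- v) (B c))"
    have bad: "bad \<in> sets \<mu>" unfolding bad_def by (intro sets.finite_UN K(1) separated_set_sets B)
    have "measure \<mu> bad \<le> (\<Sum>c\<in>K. measure \<mu> (separated_set (e c) (- v) (B c)))"
      unfolding bad_def by (intro finite_measure_subadditive_finite K(1)) (auto intro!:
          separated_set_sets B)
    also have "\<dots> \<le> (\<Sum>c\<in>K. \<delta>)" by (intro sum_mono e)
    also have "\<dots> < p / real (card F)"
    proof -
      define q where "q = p / real (card F)"
      have "q > 0" using \<open>p > 0\<close> \<open>card F > 0\<close> by (simp add: q_def)
      have "\<delta> = q / (2 * (real (card K) + 1))" by (simp add: \<delta>_def q_def)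
      then have "real (card K) * \<delta> = q * (real (card K) / (2 * (real (card K) + 1)))" by simp
      also have "\<dots> < q * 1"
        using \<open>q > 0\<close> by (intro mult_strict_left_mono) (auto simp: field_simps)
      finally show ?thesis by (simp add: q_def)
    qed
    finally have less: "measure \<mu> bad < measure \<mu> (G \<inter> E)" using GE by linarith
    \<comment> \<open>One good tiling suffices, since the factor \<open>unit_char \<alpha> v\<close>
      is the same for all of them.\<close>
    have "\<exists>S. S \<in> G \<inter> E - bad \<and> f (shift_tiles (- v) S) = unit_char \<alpha> v * f S"
    proof (rule ccontr)
      assume none: "\<nexists>S. S \<in> G \<inter> E - bad \<and> f (shift_tiles (- v) S) = unit_char \<alpha> v * f S"
      have "AE S in \<mu>. S \<in> G \<inter> E \<longrightarrow> S \<in> bad"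
        by (rule AE_mp[OF eig[of v] AE_I2]) (use none in blast)
      then have "measure \<mu> (G \<inter> E) \<le> measure \<mu> bad"
        using bad by (rule finite_measure_mono_AE)
      then show False using less by simp
    qed
    then obtain S where S: "S \<in> G" "S \<in> E" "S \<notin> bad" and fS: "f (shift_tiles (- v) S) =
        unit_char \<alpha> v * f S"
      by blast
    have "f S \<noteq> 0" using S(2) by (simp add: E_def)
    then have "cmod (h S) = 1" by (simp add: h_def norm_divide)
    then have "h S \<in> sphere 0 1" by simp
    then obtain c where c: "c \<in> K" "dist c (h S) < \<epsilon> / 3" using K(2) by auto
    have "S \<in> B c" using S(2) c(2) by (simp add: B_def E_def)
    moreover have "S \<notin> separated_set (e c) (- v) (B c)" using S(3) c(1) by (auto simp: bad_def)
    ultimately have "shift_tiles (- v) S \<in> B c"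
      using S(1) m(2)[OF c(1)] by (auto simp: separated_set_def G_def)
    then have "dist c (h (shift_tiles (- v) S)) < \<epsilon> / 3" by (simp add: B_def)
    moreover have "h (shift_tiles (- v) S) = unit_char \<alpha> v * h S" by (simp add: h_def fS norm_mult)
    ultimately have "dist (unit_char \<alpha> v * h S) (h S) < \<epsilon>"
      using c(2) dist_triangle[of "unit_char \<alpha> v * h S" "h S" c] \<epsilon> by (simp add: dist_commute)
    moreover have "unit_char \<alpha> v * h S - h S = (unit_char \<alpha> v - 1) * h S" by (simp add: algebra_simps)
    ultimately show ?thesis using \<open>cmod (h S) = 1\<close> by (simp add: dist_norm norm_mult v_def)
  qed
  then show "\<exists>no. \<forall>n\<ge>no. norm (unit_char \<alpha> ((Q ^^ n) z) - 1) < \<epsilon>" by blast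
qed

end

section \<open>Compactness\<close>

text \<open>Diagonal argument: stage \<open>n\<close> thins the sequence until the
  \<open>n\<close>-th test is constant, and from index \<open>n + 1\<close> on the diagonal runs
  inside that stage.\<close>

lemma eventually_constant_subsequence:
  fixes h :: "nat \<Rightarrow> nat \<Rightarrow> bool"
  obtains \<phi> :: "nat \<Rightarrow> nat" where "strict_mono \<phi>"
    "\<And>n. (\<forall>\<^sub>F j in sequentially. h (\<phi> j) n) \<or> (\<forall>\<^sub>F j in sequentially. \<not> h (\<phi> j) n)"
proof -
  define P where "P n s \<longleftrightarrow> (\<forall>j. h (s j) n) \<or> (\<forall>j. \<not> h (s j) n)" for n and s :: "nat \<Rightarrow> nat"
  interpret subseqs P
  proof
    fix n and s :: "nat \<Rightarrow> nat" assume "strict_mono s"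
    have "infinite {j. h (s j) n} \<or> infinite {j. \<not> h (s j) n}"
    proof (rule ccontr)
      assume "\<not> (infinite {j. h (s j) n} \<or> infinite {j. \<not> h (s j) n})"
      then have "finite ({j. h (s j) n} \<union> {j. \<not> h (s j) n})" by simp
      moreover have "{j. h (s j) n} \<union> {j. \<not> h (s j) n} = UNIV" by blast
      ultimately show False using infinite_UNIV_nat by simp
    qed
    then obtain J :: "nat set" where J: "infinite J" "J = {j. h (s j) n} \<or> J = {j. \<not> h (s j) n}" by blast
    have "enumerate J j \<in> J" for j using J(1) by (rule enumerate_in_set)
    then have "P n (s \<circ> enumerate J)" using J(2) by (auto simp: P_def)
    then show "\<exists>r. strict_mono r \<and> P n (s \<circ> r)" using strict_mono_enumerate[OF J(1)] by blast
  qed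
  have "P n (diagseq \<circ> ((+) (Suc n)))" for n
    by (rule diagseq_holds) (auto simp: P_def)
  then have "(\<forall>j. h (diagseq (Suc n + j)) n) \<or> (\<forall>j. \<not> h (diagseq (Suc n + j)) n)" for n
    by (simp add: P_def)
  then have "(\<forall>j\<ge>Suc n. h (diagseq j) n) \<or> (\<forall>j\<ge>Suc n. \<not> h (diagseq j) n)" for n
    by (metis le_Suc_ex)
  then have "(\<forall>\<^sub>F j in sequentially. h (diagseq j) n) \<or> (\<forall>\<^sub>F j in sequentially. \<not> h (diagseq j) n)" for n
    unfolding eventually_sequentially by blast
  then show thesis using that subseq_diagseq by blast
qed

text \<open>The type is made constant by the pigeonhole principle, then compactness is used. The
  index set \<open>J\<close> allows restriction to the indices where some property fails.\<close>

lemma frequently_convergent_subsequence: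
  fixes x :: "nat \<Rightarrow> 'a::heine_borel" and i :: "nat \<Rightarrow> 'k::finite"
  assumes J: "infinite J" and K: "compact K" "\<And>j. j \<in> J \<Longrightarrow> x j \<in> K"
  shows "\<exists>s a l. strict_mono s \<and> (\<forall>n. s n \<in> J) \<and> (\<forall>n. i (s n) = l) \<and> (\<lambda>n. x (s n)) \<longlonglongrightarrow> a"
proof -
  have "\<exists>l\<in>UNIV. infinite {j \<in> J. i j = l}"
    using pigeonhole_infinite[OF J, of i] by (metis (full_types) UNIV_I finite finite_imageI
        image_iff rangeI)
  then obtain l where "infinite {j \<in> J. i j = l}" by blast
  then have inf: "infinite {j \<in> J. i j = l}" .
  define r where "r = enumerate {j \<in> J. i j = l}"
  have r: "strict_mono r" "\<And>n. r n \<in> J \<and> i (r n) = l"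
    using strict_mono_enumerate[OF inf] enumerate_in_set[OF inf] by (auto simp: r_def)
  have "\<forall>n. (x \<circ> r) n \<in> K" using K(2) r(2) by auto
  then obtain a t where t: "strict_mono t" "((x \<circ> r) \<circ> t) \<longlonglongrightarrow> a"
    using K(1) unfolding compact_eq_seq_compact_metric seq_compact_def by blast
  have "strict_mono (r \<circ> t)" using r(1) t(1) by (rule strict_mono_o)
  moreover have "\<forall>n. (r \<circ> t) n \<in> J" "\<forall>n. i ((r \<circ> t) n) = l" using r(2) by simp_all
  moreover have "(\<lambda>n. x ((r \<circ> t) n)) \<longlonglongrightarrow> a" using t(2) by (simp add: o_def)
  ultimately show ?thesis by blast
qed

context prototile_family
begin

text \<open>Pass to a subsequence along which, for every colour and every set of a countable base, the set is
  either eventually met or eventually missed by the points of that colour.\<close>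

theorem tilings_sequentially_compact:
  assumes S: "\<And>j. S j \<in> tilings A"
  obtains \<phi> :: "nat \<Rightarrow> nat" and S' where "strict_mono \<phi>" "S' \<in> tilings A"
    "(\<lambda>j. tiling_dist A (S (\<phi> j)) S') \<longlonglongrightarrow> 0"
proof -
  obtain B :: "(real^'n) set set" where B: "countable B" "topological_basis B"
    using ex_countable_basis by blast
  have basis: "\<exists>U\<in>B. p \<in> U \<and> U \<subseteq> V" if "open V" "p \<in> V" for p V
    using B(2) that topological_basisE by metis
  define BB where "BB = B \<times> (UNIV :: 'k set)"
  have cBB: "countable BB" unfolding BB_def by (intro countable_SIGMA B(1)) auto
  have "B \<noteq> {}" using basis[of UNIV] by blast
  then have neBB: "BB \<noteq> {}" by (simp add: BB_def)
  define hit where "hit j b \<longleftrightarrow> (\<exists>y\<in>fst b. (y, snd b) \<in> Lam A (S j))" for j b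
  obtain \<phi> :: "nat \<Rightarrow> nat" where \<phi>: "strict_mono \<phi>" and
    ec: "\<And>n. (\<forall>\<^sub>F j in sequentially. hit (\<phi> j) (from_nat_into BB n)) \<or>
         (\<forall>\<^sub>F j in sequentially. \<not> hit (\<phi> j) (from_nat_into BB n))"
    using eventually_constant_subsequence[of "\<lambda>j n. hit j (from_nat_into BB n)"] by blast
  define M where "M j = Lam A (S (\<phi> j))" for j
  have M: "tiling_points A (M j)" for j using S unfolding M_def in_tilings_iff by blast
  have EC: "(\<forall>\<^sub>F j in sequentially. \<exists>y\<in>U. (y, i) \<in> M j) \<or> (\<forall>\<^sub>F j in sequentially. \<not> (\<exists>y\<in>U. (y, i) \<in>
      M j))"
    if "U \<in> B" for U i
  proof -
    have "(U, i) \<in> BB" using that by (simp add: BB_def)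
    then obtain n where "from_nat_into BB n = (U, i)"
      using from_nat_into_surj[OF cBB] by blast
    then show ?thesis using ec[of n] by (simp add: hit_def M_def)
  qed
  define \<Lambda> where "\<Lambda> = {(x, i). \<forall>U\<in>B. x \<in> U \<longrightarrow> (\<forall>\<^sub>F j in sequentially. \<exists>y\<in>U. (y, i) \<in> M j)}"
  \<comment> \<open>A basic set around an accumulation point is met infinitely often, so it is not
    eventually missed; by \<open>EC\<close> it is eventually met along the whole sequence, not only
    along \<open>s\<close>.\<close>
  have limit: "(a, l) \<in> \<Lambda>" if s: "strict_mono s" "\<And>n. (x (s n), l) \<in> M (s n)" "(\<lambda>n. x (s n)) \<longlonglongrightarrow> a"
      for s :: "nat \<Rightarrow> nat" and x a l
  proof -
    have "\<forall>\<^sub>F j in sequentially. \<exists>y\<in>U. (y, l) \<in> M j" if U: "U \<in> B" "a \<in> U" for U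
    proof (rule ccontr)
      assume "\<not> (\<forall>\<^sub>F j in sequentially. \<exists>y\<in>U. (y, l) \<in> M j)"
      then have "\<forall>\<^sub>F j in sequentially. \<not> (\<exists>y\<in>U. (y, l) \<in> M j)" using EC[OF U(1)] by blast
      then have "\<forall>\<^sub>F n in sequentially. \<not> (\<exists>y\<in>U. (y, l) \<in> M (s n))"
        using s(1) by (rule eventually_subseq[rotated])
      moreover have "\<forall>\<^sub>F n in sequentially. x (s n) \<in> U"
        using s(3) topological_basis_open[OF B(2) U(1)] U(2) by (rule topological_tendstoD)
      ultimately have "\<forall>\<^sub>F n in sequentially. False"
        by eventually_elim (use s(2) in blast)
      then show False by simp
    qed
    then show ?thesis by (simp add: \<Lambda>_def)
  qed
  have approx: "\<forall>\<^sub>F j in sequentially. \<exists>y. (y, i) \<in> M j \<and> dist x y < e"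
      if xi: "(x, i) \<in> \<Lambda>" and e: "e > 0" for x i e
  proof -
    obtain U where U: "U \<in> B" "x \<in> U" "U \<subseteq> ball x e" using basis[of "ball x e" x] e by auto
    then have "\<forall>\<^sub>F j in sequentially. \<exists>y\<in>U. (y, i) \<in> M j" using xi unfolding \<Lambda>_def by blast
    then show ?thesis by eventually_elim (use U(3) in \<open>auto simp: subset_iff\<close>)
  qed
  obtain \<rho> where \<rho>: "\<rho> > 0" "\<And>i a. a \<in> A i \<Longrightarrow> norm a < \<rho>" using proto_bounded by blast
  have "tiling_points A \<Lambda>"
    unfolding tiling_points_def
  proof (rule conjI; intro allI impI)
    fix p :: "real^'n"
    have "\<forall>j. \<exists>x i. (x, i) \<in> M j \<and> p \<in> (+) x ` A i" using M unfolding tiling_points_def by blast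
    then obtain x i where x: "\<And>j. (x j, i j) \<in> M j" "\<And>j. p \<in> (+) (x j) ` A (i j)" by metis
    have diff: "p - x j \<in> A (i j)" for j using x(2)[of j] by auto
    have "x j \<in> cball p \<rho>" for j using \<rho>(2)[OF diff[of j]] by (simp add: dist_norm)
    then have "\<exists>s a l. strict_mono s \<and> (\<forall>n. s n \<in> (UNIV :: nat set)) \<and> (\<forall>n. i (s n) = l) \<and>
        (\<lambda>n. x (s n)) \<longlonglongrightarrow> a"
      by (intro frequently_convergent_subsequence[OF infinite_UNIV_nat compact_cball])
    then obtain s a l where s: "strict_mono s" "\<And>n. i (s n) = l" "(\<lambda>n. x (s n)) \<longlonglongrightarrow> a"
      by auto
    have "(x (s n), l) \<in> M (s n)" for n using x(1)[of "s n"] s(2)[of n] by simp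
    then have "(a, l) \<in> \<Lambda>" using limit[OF s(1) _ s(3)] by blast
    moreover have "p - a \<in> A l"
    proof (rule closed_sequentially[OF compact_imp_closed[OF proto_compact[of l]]])
      show "p - x (s n) \<in> A l" for n using diff[of "s n"] s(2)[of n] by simp
      show "(\<lambda>n. p - x (s n)) \<longlonglongrightarrow> p - a" by (intro tendsto_intros s(3))
    qed
    then have "p \<in> (+) a ` A l" by (intro image_eqI[of _ _ "p - a"]) auto
    ultimately show "\<exists>x i. (x, i) \<in> \<Lambda> \<and> p \<in> (+) x ` A i" by blast
  next
    fix x i y j assume xy: "(x, i) \<in> \<Lambda>" "(y, j) \<in> \<Lambda>" "interior ((+) x ` A i) \<inter> interior ((+) y ` A
        j) \<noteq> {}"
    then obtain p where "p \<in> interior ((+) x ` A i)" "p \<in> interior ((+) y ` A j)" by blast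
    then have p: "p - x \<in> interior (A i)" "p - y \<in> interior (A j)"
        by (simp_all add: interior_placed mem_translate)
    obtain d1 where d1: "d1 > 0" "ball (p - x) d1 \<subseteq> interior (A i)"
        using p(1) open_interior openE by metis
    obtain d2 where d2: "d2 > 0" "ball (p - y) d2 \<subseteq> interior (A j)"
        using p(2) open_interior openE by metis
    \<comment> \<open>Interiors are open, so an overlap of limit tiles persists for tiles of some
      \<open>M n\<close> close to them. Those coincide, which fixes the type and brings
      \<open>x\<close> and \<open>y\<close> within any \<open>e\<close>.\<close>
    have eq: "i = j \<and> dist x y < e" if "e > 0" for e
    proof -
      define d where "d = min (e / 2) (min d1 d2)"
      have d: "d > 0" "d \<le> e / 2" "d \<le> d1" "d \<le> d2" using that d1(1) d2(1) by (auto simp: d_def)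
      have "\<forall>\<^sub>F n in sequentially. (\<exists>x'. (x', i) \<in> M n \<and> dist x x' < d) \<and> (\<exists>y'. (y', j) \<in> M n \<and>
          dist y y' < d)"
        using approx[OF xy(1) d(1)] approx[OF xy(2) d(1)] by (rule eventually_conj)
      then obtain n x' y' where n: "(x', i) \<in> M n" "dist x x' < d" "(y', j) \<in> M n" "dist y y' < d"
        unfolding eventually_sequentially by (metis order_refl)
      have "p - x' \<in> ball (p - x) d1" "p - y' \<in> ball (p - y) d2"
        using n(2,4) d by (auto simp: dist_norm norm_minus_commute)
      then have "p - x' \<in> interior (A i)" "p - y' \<in> interior (A j)" using d1(2) d2(2) by blast+
      then have "x' + (p - x') \<in> interior ((+) x' ` A i)" "y' + (p - y') \<in> interior ((+) y' ` A j)"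
        unfolding interior_placed by blast+
      then have "p \<in> interior ((+) x' ` A i) \<inter> interior ((+) y' ` A j)" by simp
      then have "x' = y' \<and> i = j" using M[of n] n(1,3) unfolding tiling_points_def by blast
      then show ?thesis using n(2,4) d(2) dist_triangle[of x y x'] by (simp add: dist_commute)
    qed
    have "i = j" using eq[of 1] by simp
    moreover have "x = y"
    proof (rule ccontr)
      assume "x \<noteq> y"
      then show False using eq[of "dist x y"] by simp
    qed
    ultimately show "x = y \<and> i = j" by simp
  qed
  define S' where "S' = tiles_at A \<Lambda>"
  have S': "S' \<in> tilings A" "Lam A S' = \<Lambda>"
    using \<open>tiling_points A \<Lambda>\<close> by (simp_all add: S'_def tiles_at_in_tilings_iff)
  \<comment> \<open>Pointwise approximation becomes simultaneous because only finitely many limit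
    points lie in the ball.\<close>
  have near1: "\<forall>\<^sub>F j in sequentially. near_set e (M j) \<Lambda>" if e: "e > 0" for e
  proof -
    let ?F = "{(x, i). (x, i) \<in> \<Lambda> \<and> norm x \<le> 1 / e}"
    have "finite ?F" using \<open>tiling_points A \<Lambda>\<close> by (rule tiling_points_finite)
    moreover have "\<forall>b\<in>?F. \<forall>\<^sub>F j in sequentially. \<exists>y. (y, snd b) \<in> M j \<and> dist (fst b) y < e"
      using approx e by auto
    ultimately have "\<forall>\<^sub>F j in sequentially. \<forall>b\<in>?F. \<exists>y. (y, snd b) \<in> M j \<and> dist (fst b) y < e"
      by (rule eventually_ball_finite)
    then show ?thesis
      by eventually_elim (fastforce simp: near_set_def)
  qed
  \<comment> \<open>Stray points at infinitely many indices would stay in a ball and accumulate at a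
    point of \<open>\<Lambda>\<close>, to which they are not allowed to be close.\<close>
  have near2: "\<forall>\<^sub>F j in sequentially. near_set e \<Lambda> (M j)" if e: "e > 0" for e
  proof (rule ccontr)
    assume "\<not> (\<forall>\<^sub>F j in sequentially. near_set e \<Lambda> (M j))"
    then have inf: "infinite {j. \<not> near_set e \<Lambda> (M j)}"
      by (simp add: cofinite_eq_sequentially[symmetric] eventually_cofinite)
    have "\<forall>j\<in>{j. \<not> near_set e \<Lambda> (M j)}. \<exists>x i. (x, i) \<in> M j \<and> norm x < 1 / e \<and> (\<forall>y. (y, i) \<in> \<Lambda> \<longrightarrow>
        \<not> dist x y < e)"
      unfolding near_set_def by blast
    then obtain x i where x: "\<And>j. j \<in> {j. \<not> near_set e \<Lambda> (M j)} \<Longrightarrow> (x j, i j) \<in> M j \<and>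
        norm (x j) < 1 / e \<and> (\<forall>y. (y, i j) \<in> \<Lambda> \<longrightarrow> \<not> dist (x j) y < e)"
      by metis
    have "x j \<in> cball 0 (1 / e)" if "j \<in> {j. \<not> near_set e \<Lambda> (M j)}" for j
      using x[OF that] by simp
    then have "\<exists>s a l. strict_mono s \<and> (\<forall>n. s n \<in> {j. \<not> near_set e \<Lambda> (M j)}) \<and> (\<forall>n. i (s n) = l) \<and>
        (\<lambda>n. x (s n)) \<longlonglongrightarrow> a"
      by (intro frequently_convergent_subsequence[OF inf compact_cball])
    then obtain s a l where s: "strict_mono s" "\<And>n. s n \<in> {j. \<not> near_set e \<Lambda> (M j)}" "\<And>n. i (s n) =
        l" "(\<lambda>n. x (s n)) \<longlonglongrightarrow> a"
      by blast
    have "(x (s n), l) \<in> M (s n)" for n using x[OF s(2)[of n]] s(3)[of n] by simp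
    then have "(a, l) \<in> \<Lambda>" using limit[OF s(1) _ s(4)] by blast
    then have "\<not> dist (x (s n)) a < e" for n using x[OF s(2)[of n]] s(3)[of n] by simp
    moreover have "\<forall>\<^sub>F n in sequentially. dist (x (s n)) a < e" using s(4) e by (rule tendstoD)
    ultimately show False by simp
  qed
  show thesis
  proof (rule that[OF \<phi> S'(1)])
    show "(\<lambda>j. tiling_dist A (S (\<phi> j)) S') \<longlonglongrightarrow> 0"
    proof (rule tendstoI)
      fix e :: real assume "e > 0"
      then have "\<forall>\<^sub>F j in sequentially. near_set (e / 2) (M j) \<Lambda> \<and> near_set (e / 2) \<Lambda> (M j)"
        by (intro eventually_conj near1 near2) auto
      then show "\<forall>\<^sub>F j in sequentially. dist (tiling_dist A (S (\<phi> j)) S') 0 < e"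
      proof eventually_elim
        case (elim j)
        then have "tiling_dist A (S (\<phi> j)) S' \<le> e / 2"
          using \<open>e > 0\<close> by (intro tiling_dist_le_if_close) (simp_all add: close_tilings_iff S'(2) M_def)
        then show ?case using \<open>e > 0\<close> tiling_dist_nonneg[of A "S (\<phi> j)" S'] by simp
      qed
    qed
  qed
qed

end

section \<open>Return vectors and continuous eigenfunctions\<close>

context primitive_subst_tiling
begin

definition return_vectors :: "(real^'n) set" where
  "return_vectors = {w. \<exists>x i. (x, i) \<in> Lam A T \<and> (x + w, i) \<in> Lam A T}"

lemma tiling_points_T: "tiling_points A (Lam A T)"
  using T_tiling in_tilings_iff by blast

lemma subst_pts_pow_Lam_T: "(subst_pts ^^ n) (Lam A T) = Lam A T"
  by (metis Lam_tile_subst_pow T_fixed_pow)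

text \<open>Any two tiles of \<open>T\<close> form a patch. By repetitivity a copy of it lies in any
  ball of a certain radius, in particular in one covered by a single supertile; so the patch is
  legal.\<close>

lemma return_vectors_legal:
  assumes "repetitive A T" shows "return_vectors \<subseteq> Xi_legal A Q D T"
proof
  fix w assume "w \<in> return_vectors"
  then obtain x i where x: "(x, i) \<in> Lam A T" "(x + w, i) \<in> Lam A T"
      unfolding return_vectors_def by blast
  define t where "t = shift_tile x (prototile A i)"
  define t' where "t' = shift_tile (x + w) (prototile A i)"
  define P where "P = {t, t'}"
  have PT: "P \<subseteq> T" using x by (simp add: P_def t_def t'_def Lam_iff)
  have "disjoint_interiors P"
    using T_tiling PT unfolding tilings_def disjoint_interiors_def by (blast intro: pairwise_subset)
  then have patch: "patch A P"
    using PT tilings_subset[OF T_tiling] by (auto simp: patch_def P_def)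
  then obtain M where M: "\<And>y. \<exists>g. shift_tiles g P \<subseteq> T \<and> (\<Union>t\<in>shift_tiles g P. fst t) \<subseteq> ball y M"
    using assms PT unfolding repetitive_def by blast
  obtain r c where r: "r > 0" "\<And>i. ball (c i) r \<subseteq> interior (A i)" using proto_inner_ball by blast
  have "0 \<in> supp (Lam A T)" using tiling_points_T by (simp add: tiling_points_iff_supp)
  then obtain x0 j where x0: "(x0, j) \<in> Lam A T" unfolding mem_supp by blast
  obtain n where "\<forall>k\<ge>n. ball 0 M \<subseteq> (Q ^^ k) ` ball 0 r"
    using Qn_covers_ball[OF r(1), of M] by meson
  then have n: "ball 0 M \<subseteq> (Q ^^ n) ` ball 0 r" by simp
  \<comment> \<open>The image of the centre of a ball inside the tile at \<open>x0\<close>, so that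
    the ball of radius \<open>M\<close> about it is covered by the order-\<open>n\<close>
    supertile.\<close>
  define y where "y = (Q ^^ n) (x0 + c j)"
  define L where "L = (subst_pts ^^ n) {(x0, j)}"
  have LT: "L \<subseteq> Lam A T" unfolding L_def using subst_pts_pow_mono[of "{(x0, j)}" "Lam A T" n] x0
      by (simp add: subst_pts_pow_Lam_T)
  have ball: "ball y M \<subseteq> supp L"
  proof
    fix p assume "p \<in> ball y M"
    then have "p - y \<in> ball 0 M" by (simp add: dist_norm norm_minus_commute)
    then obtain q where q: "q \<in> ball 0 r" "p - y = (Q ^^ n) q" using n by blast
    have "c j + q \<in> ball (c j) r" using q(1) by (simp add: dist_norm)
    then have "c j + q \<in> A j" using r(2)[of j] interior_subset by blast
    then have "x0 + c j + q \<in> supp {(x0, j)}" unfolding mem_supp by (simp add: algebra_simps)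
    moreover have "p = (Q ^^ n) (x0 + c j + q)" using q(2) by (simp add: y_def Qn_add algebra_simps)
    ultimately show "p \<in> supp L" unfolding L_def supp_subst_pts_pow by blast
  qed
  obtain g where g: "shift_tiles g P \<subseteq> T" "(\<Union>t\<in>shift_tiles g P. fst t) \<subseteq> ball y M" using M by blast
  have mem: "(v + g, i) \<in> L" if "shift_tile v (prototile A i) \<in> P" for v
  proof -
    have "shift_tile (g + v) (prototile A i) \<in> shift_tiles g P"
      using that unfolding shift_tiles_def by (intro image_eqI[of _ _ "shift_tile v (prototile A
          i)"]) auto
    moreover have "fst (shift_tile (g + v) (prototile A i)) = (+) (v + g) ` A i"
      by (simp add: shift_tile_def prototile_def add.commute)
    ultimately have "(v + g, i) \<in> Lam A T" "(+) (v + g) ` A i \<subseteq> supp L"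
      using g ball by (auto simp: Lam_iff add.commute)
    then show ?thesis using covered_tile_mem[OF tiling_points_T LT] by blast
  qed
  have inP: "shift_tile v (prototile A i) \<in> shift_tiles ((Q ^^ n) x0 - g) ((tile_subst A Q D ^^ n)
      {prototile A j})"
    if "shift_tile v (prototile A i) \<in> P" for v
  proof -
    have "(v + g - (Q ^^ n) x0, i) \<in> (subst_pts ^^ n) {(0, j)}"
      using mem[OF that] unfolding L_def mem_subst_pts_pow[of _ _ n "{(x0, j)}"] by simp
    moreover have "v + g - (Q ^^ n) x0 = v - ((Q ^^ n) x0 - g)" by simp
    ultimately have "(v, i) \<in> Lam A (shift_tiles ((Q ^^ n) x0 - g) ((tile_subst A Q D ^^ n)
        {prototile A j}))"
      by (simp only: Lam_shift mem_shift_pts Lam_tile_subst_pow Lam_single)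
    then show ?thesis by (simp add: Lam_iff)
  qed
  have "P \<subseteq> shift_tiles ((Q ^^ n) x0 - g) ((tile_subst A Q D ^^ n) {prototile A j})"
    using inP by (auto simp: P_def t_def t'_def)
  then have "legal A Q D P" using patch unfolding legal_def by blast
  moreover have "t' = shift_tile w t" by (simp add: t_def t'_def add.commute)
  ultimately show "w \<in> Xi_legal A Q D T"
    using PT unfolding Xi_legal_def P_def by blast
qed

text \<open>Multiples of a primitivity exponent are again such exponents, so one can be taken large
  enough for contraction by the factor 1/2.\<close>

lemma ex_contracting_power:
  obtains m where "m > 0" "covers_types m" "\<And>v. norm ((inv Q ^^ m) v) \<le> norm v / 2"
proof -
  obtain m0 where m0: "m0 > 0" "covers_types m0" using ex_covers_types by blast
  obtain \<kappa> where \<kappa>: "\<kappa> \<longlonglongrightarrow> 0" "\<And>n v. norm ((inv Q ^^ n) v) \<le> \<kappa> n * norm v"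
    using expansive_inverse_decay[OF expQ] by metis
  obtain n0 where n0: "\<And>n. n \<ge> n0 \<Longrightarrow> \<kappa> n < 1 / 2"
    using order_tendstoD(2)[OF \<kappa>(1), of "1 / 2"] by (auto simp: eventually_sequentially)
  define m where "m = m0 * Suc n0"
  have "n0 \<le> m" using m0(1) by (cases m0) (auto simp: m_def)
  show thesis
  proof (rule that[of m])
    show "m > 0" using m0(1) by (simp add: m_def)
    show "covers_types m" unfolding m_def by (rule covers_types_mult[OF m0(2)])
    show "norm ((inv Q ^^ m) v) \<le> norm v / 2" for v
      using \<kappa>(2)[of m v] mult_right_mono[of "\<kappa> m" "1 / 2" "norm v"] n0[OF \<open>n0 \<le> m\<close>] by simp
  qed
qed

text \<open>\<open>y a\<close> is the position of a tile of the fixed type \<open>i0\<close> inside the \<open>m\<close>-th order supertile of \<open>a\<close>, so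
  all differences \<open>y a - y b\<close> are return vectors. A tile of type \<open>i0\<close> at \<open>q\<close> yields one at \<open>Q\<^sup>m q + c i0\<close>;
  the constant \<open>c i0\<close> cancels in differences, which gives the expansion along the supertiles.\<close>

theorem return_vectors_uniform:
  assumes summ: "\<And>u. u \<in> return_vectors \<Longrightarrow> summable (\<lambda>n. cmod (unit_char \<alpha> ((Q ^^ n) u) - 1))"
    and \<epsilon>: "\<epsilon> > 0"
  shows "\<exists>n. \<forall>w\<in>return_vectors. cmod (unit_char \<alpha> ((Q ^^ n) w) - 1) < \<epsilon>"
proof -
  obtain m where m: "m > 0" "covers_types m" "\<And>v. norm ((inv Q ^^ m) v) \<le> norm v / 2"
    using ex_contracting_power by blast
  define i0 :: 'k where "i0 = undefined"
  obtain c where c: "\<And>j. (c j, i0) \<in> (subst_pts ^^ m) {(0, j)}"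
    using m(2) unfolding covers_types_def by metis
  define y where "y a = (Q ^^ m) (fst a) + c (snd a)" for a
  have LT: "(v, i) \<in> Lam A T \<longleftrightarrow> (\<exists>x j. (x, j) \<in> Lam A T \<and>
      (v - (Q ^^ m) x, i) \<in> (subst_pts ^^ m) {(0, j)})" for v i
    using mem_subst_pts_pow[of v i m "Lam A T"] by (simp only: subst_pts_pow_Lam_T)
  have yT: "(y a, i0) \<in> Lam A T" if "a \<in> Lam A T" for a
    using that c unfolding LT[of "y a"] by (intro exI[of _ "fst a"] exI[of _ "snd a"]) (simp add: y_def)
  have y_ret: "y a - y b \<in> return_vectors" if "a \<in> Lam A T" "b \<in> Lam A T" for a b
    using yT[OF that(1)] yT[OF that(2)] unfolding return_vectors_def
        by (auto intro!: exI[of _ "y b"] exI[of _ i0])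
  define Dg where "Dg = (\<Union>j. (subst_pts ^^ m) {(0, j)})"
  have "finite Dg" unfolding Dg_def by (auto simp: finite_subst_pts_pow)
  obtain C where C: "C > 0" "\<And>d i. (d, i) \<in> Dg \<Longrightarrow> norm d \<le> C"
  proof -
    have "bounded (fst ` Dg)" using \<open>finite Dg\<close> by (simp add: finite_imp_bounded)
    then obtain C where "C > 0" "\<And>d. d \<in> fst ` Dg \<Longrightarrow> norm d \<le> C" unfolding bounded_pos by blast
    then show thesis using that by (metis fst_conv imageI)
  qed
  \<comment> \<open>All corrections that one descent can produce: they depend only on an entry of
    the finite set \<open>Dg\<close> and on the type of the supertile.\<close>
  define U where "U = (\<lambda>(a, j). (Q ^^ m) (fst a) + c (snd a) - (Q ^^ m) (c j) - c i0) ` (Dg \<times> UNIV)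
      \<inter> return_vectors"
  \<comment> \<open>The descent maps the norm \<open>C + t\<close> to at most
    \<open>C + t / 2\<close>, so it is measured by \<open>C + 2 ^ N\<close> and stops at
    \<open>C + 2 ^ 0\<close>.\<close>
  define F where "F = {(x, i). (x, i) \<in> Lam A T \<and> norm x \<le> C + 1}"
  define V where "V = U \<union> (\<lambda>(a, b). y a - y b) ` (F \<times> F)"
  have "finite F" unfolding F_def by (rule tiling_points_finite[OF tiling_points_T])
  have "finite V" unfolding V_def U_def using \<open>finite Dg\<close> \<open>finite F\<close> by auto
  have FT: "a \<in> Lam A T" if "a \<in> F" for a using that by (auto simp: F_def)
  have V_ret: "V \<subseteq> return_vectors" unfolding V_def U_def using y_ret FT by auto
  define b where "b n = (\<Sum>u\<in>V. cmod (unit_char \<alpha> ((Q ^^ n) u) - 1))" for n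
  have b_ge: "cmod (unit_char \<alpha> ((Q ^^ n) u) - 1) \<le> b n" if "u \<in> V" for u n
    unfolding b_def using that \<open>finite V\<close> by (intro member_le_sum) auto
  have b0: "b n \<ge> 0" for n unfolding b_def by (intro sum_nonneg) auto
  have b_summable: "summable b" unfolding b_def[abs_def] using V_ret summ by (intro summable_sum) auto
  define Tail where "Tail n = (\<Sum>k. b (k + n))" for n
  have shift_summable: "summable (\<lambda>k. b (k + n))" for n
      using b_summable by (simp add: summable_iff_shift)
  have Tail0: "Tail n \<ge> 0" for n unfolding Tail_def by (intro suminf_nonneg shift_summable b0)
  have Tail_step: "b n + Tail (Suc n) = Tail n" for n
    using suminf_split_head[OF shift_summable[of n]] by (simp add: Tail_def)
  have Tail_dec: "Tail (n + k) \<le> Tail n" for n k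
  proof (induction k)
    case (Suc k)
    then show ?case using Tail_step[of "n + k"] b0[of "n + k"] by simp
  qed simp
  \<comment> \<open>One descent by \<open>m\<close> levels pays \<open>b n\<close> and leaves
    \<open>Tail (n + m)\<close>; the tail absorbs both, whatever the number of descents.\<close>
  have Tail_m: "b n + Tail (n + m) \<le> Tail n" for n
    using Tail_step[of n] Tail_dec[of "Suc n" "m - 1"] m(1) by simp
  have step: "\<exists>a1\<in>Lam A T. norm (fst a1) \<le> (norm (fst a) + C) / 2 \<and>
      y a - ((Q ^^ m) (y a1) + c i0) \<in> V" if a: "a \<in> Lam A T" for a
  proof -
    obtain x i where xi: "a = (x, i)" by (cases a)
    obtain x1 j where x1: "(x1, j) \<in> Lam A T" "(x - (Q ^^ m) x1, i) \<in> (subst_pts ^^ m) {(0, j)}"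
      using a LT[of x i] unfolding xi by blast
    define d where "d = x - (Q ^^ m) x1"
    have d: "(d, i) \<in> Dg" using x1(2) unfolding Dg_def d_def by blast
    have "x1 = (inv Q ^^ m) (x - d)" by (simp add: d_def)
    then have "norm x1 \<le> norm (x - d) / 2" using m(3) by metis
    also have "\<dots> \<le> (norm x + C) / 2"
      using norm_triangle_ineq4[of x d] C(2)[OF d] by simp
    finally have norm: "norm x1 \<le> (norm x + C) / 2" .
    define u where "u = y (x, i) - ((Q ^^ m) (y (x1, j)) + c i0)"
    have "((Q ^^ m) (y (x1, j)) + c i0, i0) \<in> Lam A T"
      unfolding LT[of "(Q ^^ m) (y (x1, j)) + c i0"] using yT[OF x1(1)] c[of i0]
      by (intro exI[of _ "y (x1, j)"] exI[of _ i0]) simp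
    moreover have "(y (x, i), i0) \<in> Lam A T" using yT a xi by simp
    moreover have "(Q ^^ m) (y (x1, j)) + c i0 + u = y (x, i)" by (simp add: u_def)
    ultimately have "u \<in> return_vectors" unfolding return_vectors_def
        by (metis (mono_tags, lifting) mem_Collect_eq)
    moreover have "u = (Q ^^ m) d + c i - (Q ^^ m) (c j) - c i0"
      by (simp add: u_def y_def d_def Qn_add Qn_diff algebra_simps)
    then have "u \<in> (\<lambda>(a, j). (Q ^^ m) (fst a) + c (snd a) - (Q ^^ m) (c j) - c i0) ` (Dg \<times> UNIV)"
      using d by (intro image_eqI[of _ _ "((d, i), j)"]) auto
    ultimately have "u \<in> V" unfolding V_def U_def by blast
    then show ?thesis using x1(1) norm unfolding u_def xi by (intro bexI[of _ "(x1, j)"]) auto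
  qed
  \<comment> \<open>The bound is free of \<open>N\<close>, which is the uniformity sought. The
    factor 2 stands for the two tiles, each of which contributes a correction at every
    level.\<close>
  have claim: "cmod (unit_char \<alpha> ((Q ^^ n) (y a - y a')) - 1) \<le> 2 * Tail n"
    if "a \<in> Lam A T" "a' \<in> Lam A T" "norm (fst a) \<le> C + 2 ^ N" "norm (fst a') \<le> C + 2 ^ N" for N n a a'
    using that
  proof (induction N arbitrary: n a a')
    case 0
    then have "a \<in> F" "a' \<in> F" by (auto simp: F_def split_def)
    then have "y a - y a' \<in> V"
      unfolding V_def by (intro UnI2 image_eqI[of _ _ "(a, a')"]) auto
    then have "cmod (unit_char \<alpha> ((Q ^^ n) (y a - y a')) - 1) \<le> b n" by (rule b_ge)
    then show ?case using Tail_step[of n] Tail0[of "Suc n"] Tail0[of n] by simp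
  next
    case (Suc N)
    obtain a1 where a1: "a1 \<in> Lam A T" "norm (fst a1) \<le>
        (norm (fst a) + C) / 2" "y a - ((Q ^^ m) (y a1) + c i0) \<in> V"
      using step[OF Suc.prems(1)] by blast
    obtain a1' where a1': "a1' \<in> Lam A T" "norm (fst a1') \<le>
        (norm (fst a') + C) / 2" "y a' - ((Q ^^ m) (y a1') + c i0) \<in> V"
      using step[OF Suc.prems(2)] by blast
    define u where "u = y a - ((Q ^^ m) (y a1) + c i0)"
    define u' where "u' = y a' - ((Q ^^ m) (y a1') + c i0)"
    have IH: "cmod (unit_char \<alpha> ((Q ^^ (n + m)) (y a1 - y a1')) - 1) \<le> 2 * Tail (n + m)"
      using a1(1,2) a1'(1,2) Suc.prems(3,4) by (intro Suc.IH) auto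
    have "y a - y a' = (Q ^^ m) (y a1 - y a1') + (u + - u')"
      by (simp add: u_def u'_def Qn_diff)
    then have "(Q ^^ n) (y a - y a') = (Q ^^ (n + m)) (y a1 - y a1') + ((Q ^^ n) u + - (Q ^^ n) u')"
      by (simp add: Qn_add Qn_diff funpow_add)
    then have "cmod (unit_char \<alpha> ((Q ^^ n) (y a - y a')) - 1) \<le>
        cmod (unit_char \<alpha> ((Q ^^ (n + m)) (y a1 - y a1')) - 1) + cmod (unit_char \<alpha> ((Q ^^ n) u + -
            (Q ^^ n) u') - 1)"
      by (simp only: unit_char_diff_bound)
    also have "cmod (unit_char \<alpha> ((Q ^^ n) u + - (Q ^^ n) u') - 1) \<le>
        cmod (unit_char \<alpha> ((Q ^^ n) u) - 1) + cmod (unit_char \<alpha> ((Q ^^ n) u') - 1)"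
      using unit_char_diff_bound[of \<alpha> "(Q ^^ n) u" "- (Q ^^ n) u'"] by (simp only: unit_char_minus_bound)
    also have "\<dots> \<le> b n + b n"
      using b_ge a1(3) a1'(3) unfolding u_def u'_def by (intro add_mono) auto
    finally show ?case using IH Tail_m[of n] by linarith
  qed
  have all: "cmod (unit_char \<alpha> ((Q ^^ (n + m)) w) - 1) \<le> 2 * Tail n" if w: "w \<in> return_vectors" for w n
  proof -
    obtain x i where x: "(x, i) \<in> Lam A T" "(x + w, i) \<in> Lam A T"
        using w unfolding return_vectors_def by blast
    obtain N where "max (norm x) (norm (x + w)) < 2 ^ N"
        using real_arch_pow[of 2 "max (norm x) (norm (x + w))"] by (auto simp del: max_less_iff_conj)
    then have "norm (fst (x, i)) \<le> C + 2 ^ N" "norm (fst (x + w, i)) \<le> C + 2 ^ N" using C(1) by simp_all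
    then have "cmod (unit_char \<alpha> ((Q ^^ n) (y (x + w, i) - y (x, i))) - 1) \<le> 2 * Tail n"
      by (intro claim x)
    \<comment> \<open>Equal types have equal offsets, so these cancel and the estimate for
      \<open>w\<close> is obtained \<open>m\<close> levels higher.\<close>
    moreover have "y (x + w, i) - y (x, i) = (Q ^^ m) w" by (simp add: y_def Qn_add)
    ultimately show ?thesis by (simp add: funpow_add)
  qed
  have "(\<lambda>n. 2 * Tail n) \<longlonglongrightarrow> 2 * 0"
    unfolding Tail_def by (intro tendsto_intros suminf_exist_split2 b_summable)
  then obtain n where n: "2 * Tail n < \<epsilon>"
    using order_tendstoD(2)[of "\<lambda>n. 2 * Tail n" 0 sequentially \<epsilon>] \<epsilon>
        by (auto simp: eventually_sequentially)
  show ?thesis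
  proof (intro exI[of _ "n + m"] ballI)
    fix w assume "w \<in> return_vectors"
    then show "cmod (unit_char \<alpha> ((Q ^^ (n + m)) w) - 1) < \<epsilon>" using all[of w n] n by simp
  qed
qed

section \<open>Periods and iterated recognizability\<close>

lemma periods_add: "k \<in> periods T \<Longrightarrow> l \<in> periods T \<Longrightarrow> k + l \<in> periods T"
proof -
  assume k: "k \<in> periods T" and l: "l \<in> periods T"
  have "shift_tiles (- (k + l)) T = shift_tiles (- k) (shift_tiles (- l) T)" by simp
  also have "\<dots> = T" using k l by (simp only: periods_def mem_Collect_eq)
  finally show ?thesis by (simp only: periods_def mem_Collect_eq)
qed

lemma periods_Q: "k \<in> periods T \<Longrightarrow> Q k \<in> periods T"
proof -
  assume k: "k \<in> periods T"
  have "shift_tiles (- Q k) T = tile_subst A Q D (shift_tiles (- k) T)"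
    using Qn_minus[of 1 k] by (simp add: tile_subst_shift T_fixed)
  also have "\<dots> = T" using k by (simp only: periods_def mem_Collect_eq T_fixed)
  finally show ?thesis by (simp only: periods_def mem_Collect_eq)
qed

text \<open>Undoing the outermost substitution gives a displacement \<open>inv Q k\<close>, which
  becomes \<open>(inv Q ^^ Suc n) k\<close> when pushed through the remaining \<open>n\<close>
  levels; the induction then supplies a second period \<open>l\<close>.\<close>

lemma recognizable_pow:
  assumes rec: "recognizable_mod_periods A Q D T"
    and "S \<in> XT" "S' \<in> XT" "(tile_subst A Q D ^^ n) S = (tile_subst A Q D ^^ n) S'"
  shows "\<exists>k\<in>periods T. S' = shift_tiles (- (inv Q ^^ n) k) S"
  using assms(2-)
proof (induction n arbitrary: S S')
  case 0
  have "0 \<in> periods T" by (simp add: periods_def)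
  then show ?case using 0 by (intro bexI[of _ 0]) auto
next
  case (Suc n)
  have "tile_subst A Q D ((tile_subst A Q D ^^ n) S) = tile_subst A Q D ((tile_subst A Q D ^^ n) S')"
    using Suc.prems(3) by simp
  then obtain k where k: "k \<in> periods T"
    "(tile_subst A Q D ^^ n) S' = shift_tiles (- (inv Q k)) ((tile_subst A Q D ^^ n) S)"
    using rec Suc.prems(1,2) tile_subst_pow_in_hull unfolding recognizable_mod_periods_def by meson
  define S1 where "S1 = shift_tiles (- (inv Q ^^ Suc n) k) S"
  have "(Q ^^ n) ((inv Q ^^ Suc n) k) = inv Q k" by (simp add: funpow_swap1)
  then have "(tile_subst A Q D ^^ n) S1 = (tile_subst A Q D ^^ n) S'"
    unfolding S1_def tile_subst_pow_shift k(2) Qn_minus by (simp only:)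
  moreover have "S1 \<in> XT" unfolding S1_def using Suc.prems(1) by (rule shift_in_hull)
  ultimately obtain l where l: "l \<in> periods T" "S' = shift_tiles (- (inv Q ^^ n) l) S1"
    using Suc.IH Suc.prems(2) by blast
  \<comment> \<open>Periods are mapped to periods by \<open>Q\<close>, so both displacements can be
    written at level \<open>n + 1\<close> and merged into that of \<open>Q l + k\<close>.\<close>
  have "(inv Q ^^ n) l = (inv Q ^^ Suc n) (Q l)" by (simp add: funpow_swap1)
  then have "S' = shift_tiles (- (inv Q ^^ Suc n) (Q l) + - (inv Q ^^ Suc n) k) S"
    unfolding l(2) S1_def shift_tiles_shift_tiles by (simp only:)
  also have "- (inv Q ^^ Suc n) (Q l) + - (inv Q ^^ Suc n) k = - (inv Q ^^ Suc n) (Q l + k)"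
    using linear_add[OF linQin[of "Suc n"], of "Q l" k] by (simp only: minus_add_distrib)
  finally show ?case using periods_add[OF periods_Q[OF l(1)] k(1)] by blast
qed

end

context primitive_subst_tiling
begin

lemma limit_in_hull:
  assumes "\<And>j. S j \<in> XT" "S' \<in> tilings A" "(\<lambda>j. tiling_dist A (S j) S') \<longlonglongrightarrow> 0"
  shows "S' \<in> XT"
proof -
  have closed: "closedin tilings.mtopology XT"
    unfolding hull_eq tilings_topology_eq by simp
  have "limitin tilings.mtopology S S' sequentially"
    unfolding tilings.limitin_metric_dist_null
    using assms hull_subset by (auto intro!: always_eventually)
  then show ?thesis
    by (rule limitin_closedin[OF _ closed]) (use assms(1) in \<open>auto intro!: always_eventually\<close>)
qed

lemma tiling_dist_limit_image:
  assumes f: "continuous_map (tilings_topology A) (tilings_topology A) f"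
    and S: "\<And>j. S j \<in> tilings A" "S' \<in> tilings A" "(\<lambda>j. tiling_dist A (S j) S') \<longlonglongrightarrow> 0"
  shows "(\<lambda>j. tiling_dist A (f (S j)) (f S')) \<longlonglongrightarrow> 0"
proof -
  have "limitin tilings.mtopology S S' sequentially"
    unfolding tilings.limitin_metric_dist_null using S by (auto intro!: always_eventually)
  then have "limitin tilings.mtopology (f \<circ> S) (f S') sequentially"
    using continuous_map_limit[OF f] by (simp add: tilings_topology_eq)
  then show ?thesis unfolding tilings.limitin_metric_dist_null by simp
qed

text \<open>Along a subsequence both families of desubstitutions converge, and by continuity their
  limits have the same \<open>n\<close>-fold substitution. Recognizability applied to the limits
  yields one period \<open>k\<close> for the whole subsequence.\<close>

lemma recognizable_limit:
  assumes rec: "recognizable_mod_periods A Q D T"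
    and dist: "(\<lambda>j. tiling_dist A (shift_tiles (x j) T) (shift_tiles (y j) T)) \<longlonglongrightarrow> 0"
  obtains \<phi> :: "nat \<Rightarrow> nat" and k where "strict_mono \<phi>" "k \<in> periods T"
    "(\<lambda>j. tiling_dist A (shift_tiles ((inv Q ^^ n) (x (\<phi> j) - k)) T) (shift_tiles ((inv Q ^^ n) (y
        (\<phi> j))) T)) \<longlonglongrightarrow> 0"
proof -
  define R where "R j = shift_tiles ((inv Q ^^ n) (x j)) T" for j
  define R' where "R' j = shift_tiles ((inv Q ^^ n) (y j)) T" for j
  have R: "R j \<in> XT" "R' j \<in> XT" "R j \<in> tilings A" "R' j \<in> tilings A" for j
    unfolding R_def R'_def by (simp_all add: shift_T_in_hull shift_T_tiling)
  obtain \<phi>1 :: "nat \<Rightarrow> nat" and S where S: "strict_mono \<phi>1" "S \<in> tilings A" "(\<lambda>j. tiling_dist A (R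
      (\<phi>1 j)) S) \<longlonglongrightarrow> 0"
    using tilings_sequentially_compact[of R] R(3) by blast
  obtain \<phi>2 :: "nat \<Rightarrow> nat" and S' where S': "strict_mono \<phi>2" "S' \<in> tilings A" "(\<lambda>j. tiling_dist A
      (R' (\<phi>1 (\<phi>2 j))) S') \<longlonglongrightarrow> 0"
    using tilings_sequentially_compact[of "\<lambda>j. R' (\<phi>1 j)"] R(4) by blast
  define \<phi> where "\<phi> = \<phi>1 \<circ> \<phi>2"
  have \<phi>: "strict_mono \<phi>" unfolding \<phi>_def using S(1) S'(1) by (rule strict_mono_o)
  have RS: "(\<lambda>j. tiling_dist A (R (\<phi> j)) S) \<longlonglongrightarrow> 0"
    using LIMSEQ_subseq_LIMSEQ[OF S(3) S'(1)] by (simp add: o_def \<phi>_def)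
  have RS': "(\<lambda>j. tiling_dist A (R' (\<phi> j)) S') \<longlonglongrightarrow> 0"
    using S'(3) by (simp add: \<phi>_def)
  have hulls: "S \<in> XT" "S' \<in> XT"
    using limit_in_hull[of "\<lambda>j. R (\<phi> j)", OF R(1) S(2) RS] limit_in_hull[of "\<lambda>j. R' (\<phi> j)", OF R(2)
        S'(2) RS'] by simp_all
  let ?w = "tile_subst A Q D ^^ n"
  have w: "?w (R j) = shift_tiles (x j) T" "?w (R' j) = shift_tiles (y j) T" for j
    unfolding R_def R'_def by (simp_all add: shift_T_desubst[symmetric])
  have 1: "(\<lambda>j. tiling_dist A (shift_tiles (x (\<phi> j)) T) (?w S)) \<longlonglongrightarrow> 0"
    using tiling_dist_limit_image[OF continuous_map_tile_subst_pow[of n] R(3) S(2) RS] by (simp only: w)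
  have 2: "(\<lambda>j. tiling_dist A (shift_tiles (y (\<phi> j)) T) (?w S')) \<longlonglongrightarrow> 0"
    using tiling_dist_limit_image[OF continuous_map_tile_subst_pow[of n] R(4) S'(2) RS']
        by (simp only: w)
  have 3: "(\<lambda>j. tiling_dist A (shift_tiles (x (\<phi> j)) T) (shift_tiles (y (\<phi> j)) T)) \<longlonglongrightarrow> 0"
    using LIMSEQ_subseq_LIMSEQ[OF dist \<phi>] by (simp add: o_def)
  have "tiling_dist A (?w S) (?w S') \<le> 0"
  proof (rule LIMSEQ_le_const)
    show "(\<lambda>j. tiling_dist A (shift_tiles (x (\<phi> j)) T) (?w S) + tiling_dist A (shift_tiles (x (\<phi> j))
        T) (shift_tiles (y (\<phi> j)) T)
        + tiling_dist A (shift_tiles (y (\<phi> j)) T) (?w S')) \<longlonglongrightarrow> 0"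
      using tendsto_add[OF tendsto_add[OF 1 3] 2] by simp
    have "tiling_dist A (?w S) (?w S') \<le> tiling_dist A (shift_tiles (x (\<phi> j)) T) (?w S) +
        tiling_dist A (shift_tiles (x (\<phi> j)) T) (shift_tiles (y (\<phi> j)) T) + tiling_dist A
            (shift_tiles (y (\<phi> j)) T) (?w S')" for j
      using tiling_dist_triangle[of A "?w S" "?w S'" "shift_tiles (x (\<phi> j)) T"]
        tiling_dist_triangle[of A "shift_tiles (x (\<phi> j)) T" "?w S'" "shift_tiles (y (\<phi> j)) T"]
        tiling_dist_commute[of A "?w S" "shift_tiles (x (\<phi> j)) T"] by linarith
    then show "\<exists>N. \<forall>j\<ge>N. tiling_dist A (?w S) (?w S') \<le> tiling_dist A (shift_tiles (x (\<phi> j)) T) (?w S) +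
        tiling_dist A (shift_tiles (x (\<phi> j)) T) (shift_tiles (y (\<phi> j)) T) + tiling_dist A
            (shift_tiles (y (\<phi> j)) T) (?w S')" by blast
  qed
  then have "tiling_dist A (?w S) (?w S') = 0" using tiling_dist_nonneg[of A "?w S" "?w S'"] by simp
  then have "?w S = ?w S'"
    using tiling_dist_0_iff[OF tile_subst_pow_in_tilings tile_subst_pow_in_tilings, OF S(2) S'(2)]
        by blast
  then obtain k where k: "k \<in> periods T" "S' = shift_tiles (- (inv Q ^^ n) k) S"
    using recognizable_pow[OF rec hulls] by blast
  have 4: "(\<lambda>j. tiling_dist A (shift_tiles (- (inv Q ^^ n) k) (R (\<phi> j))) S') \<longlonglongrightarrow> 0"
    unfolding k(2) by (rule tiling_dist_limit_image[OF continuous_map_shift R(3) S(2) RS])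
  have eq: "shift_tiles (- (inv Q ^^ n) k) (R j) = shift_tiles ((inv Q ^^ n) (x j - k)) T" for j
    using linear_diff[OF linQin[of n], of "x j" k] by (simp add: R_def)
  have 5: "(\<lambda>j. tiling_dist A (shift_tiles (- (inv Q ^^ n) k) (R (\<phi> j))) (R' (\<phi> j))) \<longlonglongrightarrow> 0"
  proof (rule tendsto_sandwich[OF _ _ tendsto_const])
    show "\<forall>\<^sub>F j in sequentially. tiling_dist A (shift_tiles (- (inv Q ^^ n) k) (R (\<phi> j))) (R' (\<phi> j))
      \<le> tiling_dist A (shift_tiles (- (inv Q ^^ n) k) (R (\<phi> j))) S' + tiling_dist A (R' (\<phi> j)) S'"
    proof (rule always_eventually, rule allI)
      fix j
      show "tiling_dist A (shift_tiles (- (inv Q ^^ n) k) (R (\<phi> j))) (R' (\<phi> j))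
      \<le> tiling_dist A (shift_tiles (- (inv Q ^^ n) k) (R (\<phi> j))) S' + tiling_dist A (R' (\<phi> j)) S'"
        using tiling_dist_triangle[of A "shift_tiles (- (inv Q ^^ n) k) (R (\<phi> j))" "R' (\<phi> j)" S']
          tiling_dist_commute[of A "R' (\<phi> j)" S'] by linarith
    qed
    show "(\<lambda>j. tiling_dist A (shift_tiles (- (inv Q ^^ n) k) (R (\<phi> j))) S' + tiling_dist A (R' (\<phi>
        j)) S') \<longlonglongrightarrow> 0"
      using tendsto_add[OF 4 RS'] by simp
  qed (simp add: tiling_dist_nonneg)
  show thesis
  proof (rule that[OF \<phi> k(1)])
    show "(\<lambda>j. tiling_dist A (shift_tiles ((inv Q ^^ n) (x (\<phi> j) - k)) T) (shift_tiles ((inv Q ^^ n)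
        (y (\<phi> j))) T)) \<longlonglongrightarrow> 0"
      using 5 unfolding eq R'_def .
  qed
qed

text \<open>A single good index is all that the sequential test for uniform continuity asks for, so
  passing to subsequences is harmless.\<close>

theorem orbit_character_uniformly_continuous:
  assumes rec: "recognizable_mod_periods A Q D T" and per: "period_condition T \<alpha>"
    and unif: "\<And>\<epsilon>. \<epsilon> > 0 \<Longrightarrow> \<exists>n. \<forall>w\<in>return_vectors. cmod (unit_char \<alpha> ((Q ^^ n) w) - 1) < \<epsilon>"
    and dist: "(\<lambda>j. tiling_dist A (shift_tiles (x j) T) (shift_tiles (y j) T)) \<longlonglongrightarrow> 0" and \<epsilon>: "\<epsilon> > 0"
  shows "\<exists>j. cmod (unit_char \<alpha> (x j - y j) - 1) < \<epsilon>"
proof -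
  obtain n where n: "\<And>w. w \<in> return_vectors \<Longrightarrow> cmod (unit_char \<alpha> ((Q ^^ n) w) - 1) < \<epsilon> / 2"
    using unif[of "\<epsilon> / 2"] \<epsilon> by auto
  obtain \<phi> :: "nat \<Rightarrow> nat" and k where k: "k \<in> periods T"
    and lim: "(\<lambda>j. tiling_dist A (shift_tiles ((inv Q ^^ n) (x (\<phi> j) - k)) T) (shift_tiles ((inv Q
        ^^ n) (y (\<phi> j))) T)) \<longlonglongrightarrow> 0"
    by (rule recognizable_limit[OF rec dist])
  obtain B where B: "B > 0" "\<And>x. norm ((Q ^^ n) x) \<le> B * norm x"
      using linear_bounded_pos[OF linQn] by blast
  obtain \<rho> where \<rho>: "\<rho> > 0" "\<And>i a. a \<in> A i \<Longrightarrow> norm a < \<rho>" using proto_bounded by blast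
  define c where "c = 2 * pi * norm \<alpha> * B + 1"
  have c: "c > 0" using B(1) by (simp add: c_def add_nonneg_pos)
  \<comment> \<open>The entry \<open>1 / \<rho>\<close> brings the tile over the origin into the
    compared region. The last entry keeps the displacement, after magnification by
    \<open>Q^n\<close>, from costing more than \<open>\<epsilon> / 2\<close>; the summand 1 in
    \<open>c\<close> makes it positive also for \<open>\<alpha> = 0\<close>.\<close>
  define \<eta> where "\<eta> = min (1 / sqrt 2) (min (1 / \<rho>) (\<epsilon> / (2 * c)))"
  have \<eta>: "\<eta> > 0" "\<eta> \<le> 1 / sqrt 2" "\<eta> \<le> 1 / \<rho>" "\<eta> \<le> \<epsilon> / (2 * c)"
    using \<rho>(1) \<epsilon> c by (auto simp: \<eta>_def)
  obtain j where j: "tiling_dist A (shift_tiles ((inv Q ^^ n) (x (\<phi> j) - k)) T) (shift_tiles ((inv Q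
      ^^ n) (y (\<phi> j))) T) < \<eta>"
    using order_tendstoD(2)[OF lim \<eta>(1)] by (auto simp: eventually_sequentially)
  define X where "X = (inv Q ^^ n) (x (\<phi> j) - k)"
  define Y where "Y = (inv Q ^^ n) (y (\<phi> j))"
  have near: "near_set \<eta> (Lam A (shift_tiles Y T)) (Lam A (shift_tiles X T))"
    using close_if_tiling_dist_less[OF j \<eta>(2)] unfolding close_tilings_iff X_def Y_def by blast
  have "0 \<in> supp (Lam A (shift_tiles X T))" using tiling_points_shift_T
      by (simp add: tiling_points_iff_supp)
  then obtain p i where p: "(p, i) \<in> Lam A (shift_tiles X T)" "- p \<in> A i" unfolding mem_supp by auto
  have "norm p < \<rho>" using \<rho>(2)[OF p(2)] by simp
  moreover have "\<rho> \<le> 1 / \<eta>" using \<eta>(1,3) \<rho>(1) by (simp add: field_simps)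
  ultimately have "norm p < 1 / \<eta>" by linarith
  then obtain q where q: "(q, i) \<in> Lam A (shift_tiles Y T)" "dist p q < \<eta>"
    using near p(1) unfolding near_set_def by blast
  \<comment> \<open>The matching tiles at \<open>p\<close> and \<open>q\<close> come from tiles of
    \<open>T\<close> at \<open>p - X\<close> and \<open>q - Y\<close> of the same type;
    \<open>p - q\<close> is the part of \<open>X - Y\<close> that is not a return vector.\<close>
  define w where "w = (q - Y) - (p - X)"
  have "(p - X, i) \<in> Lam A T" "(p - X + w, i) \<in> Lam A T"
    using p(1) q(1) by (simp_all add: Lam_shift w_def)
  then have w: "w \<in> return_vectors" unfolding return_vectors_def by blast
  have "x (\<phi> j) - y (\<phi> j) = (Q ^^ n) w + (k + (Q ^^ n) (p - q))"
    by (simp add: w_def X_def Y_def Qn_diff)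
  then have "cmod (unit_char \<alpha> (x (\<phi> j) - y (\<phi> j)) - 1) \<le>
      cmod (unit_char \<alpha> ((Q ^^ n) w) - 1) + cmod (unit_char \<alpha> (k + (Q ^^ n) (p - q)) - 1)"
    by (simp only: unit_char_diff_bound)
  also have "cmod (unit_char \<alpha> (k + (Q ^^ n) (p - q)) - 1) \<le>
      cmod (unit_char \<alpha> k - 1) + cmod (unit_char \<alpha> ((Q ^^ n) (p - q)) - 1)"
    by (rule unit_char_diff_bound)
  also have "unit_char \<alpha> k = 1" using per k unfolding period_condition_def by blast
  also have "cmod (unit_char \<alpha> ((Q ^^ n) (p - q)) - 1) \<le> \<epsilon> / 2"
  proof -
    have "cmod (unit_char \<alpha> ((Q ^^ n) (p - q)) - 1) \<le> 2 * pi * norm \<alpha> * norm ((Q ^^ n) (p - q))"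
      by (rule unit_char_small)
    also have "\<dots> \<le> 2 * pi * norm \<alpha> * (B * \<eta>)"
    proof (intro mult_left_mono)
      have "B * norm (p - q) \<le> B * \<eta>" using q(2) B(1) by (simp add: dist_norm)
      then show "norm ((Q ^^ n) (p - q)) \<le> B * \<eta>" using B(2)[of "p - q"] by linarith
    qed auto
    also have "\<dots> \<le> c * \<eta>" using \<eta>(1) by (simp add: c_def algebra_simps)
    also have "\<dots> \<le> \<epsilon> / 2" using \<eta>(4) c by (simp add: field_simps)
    finally show ?thesis .
  qed
  finally have "cmod (unit_char \<alpha> (x (\<phi> j) - y (\<phi> j)) - 1) < \<epsilon>" using n[OF w] by simp
  then show ?thesis by blast
qed

text \<open>The period condition makes the character well defined on the orbit, where a tiling fixes
  its translation vector only up to periods. The extension to the closure uses completeness of the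
  complex plane.\<close>

theorem continuous_eigenfunction_exists:
  assumes rec: "recognizable_mod_periods A Q D T" and per: "period_condition T \<alpha>"
    and unif: "\<And>\<epsilon>. \<epsilon> > 0 \<Longrightarrow> \<exists>n. \<forall>w\<in>return_vectors. cmod (unit_char \<alpha> ((Q ^^ n) w) - 1) < \<epsilon>"
  shows "\<exists>f. continuous_map (hull_topology A T) euclidean f \<and> (\<forall>S\<in>XT. cmod (f S) = 1) \<and>
    (\<forall>S\<in>XT. \<forall>x. f (shift_tiles (- x) S) = unit_char \<alpha> x * f S)"
proof -
  define Orb where "Orb = range (\<lambda>g. shift_tiles g T)"
  define g where "g S = (SOME x. S = shift_tiles x T)" for S
  have g: "S = shift_tiles (g S) T" if "S \<in> Orb" for S
    using that unfolding Orb_def g_def by (metis (mono_tags, lifting) image_iff someI_ex)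
  \<comment> \<open>The sign is due to parametrising the orbit by \<open>T + x\<close>, whereas the
    action is by \<open>-x\<close>.\<close>
  define f0 where "f0 S = unit_char \<alpha> (- g S)" for S
  have f0: "f0 (shift_tiles x T) = unit_char \<alpha> (- x)" for x
  proof -
    have "shift_tiles (g (shift_tiles x T)) T = shift_tiles x T"
      using g[of "shift_tiles x T"] unfolding Orb_def by simp
    then have "shift_tiles (- x) (shift_tiles (g (shift_tiles x T)) T) =
        shift_tiles (- x) (shift_tiles x T)" by simp
    then have "shift_tiles (- (x - g (shift_tiles x T))) T = T" by simp
    then have "x - g (shift_tiles x T) \<in> periods T" by (simp only: periods_def mem_Collect_eq)
    then have "unit_char \<alpha> (x - g (shift_tiles x T)) = 1"
        using per unfolding period_condition_def by blast
    moreover have "- g (shift_tiles x T) = (x - g (shift_tiles x T)) + - x" by simp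
    ultimately show ?thesis unfolding f0_def by (metis mult_1 unit_char_add)
  qed
  have f0_dist: "dist (f0 (shift_tiles x T)) (f0 (shift_tiles y T)) =
      cmod (unit_char \<alpha> (x - y) - 1)" for x y
  proof -
    have "unit_char \<alpha> (- y) = unit_char \<alpha> (- x) * unit_char \<alpha> (x - y)"
      by (simp flip: unit_char_add)
    then have "unit_char \<alpha> (- y) - unit_char \<alpha> (- x) = unit_char \<alpha> (- x) * (unit_char \<alpha> (x - y) - 1)"
      by (simp add: algebra_simps)
    then show ?thesis by (simp add: f0 dist_norm norm_minus_commute[of "unit_char \<alpha> (- x)"] norm_mult)
  qed
  have "uniformly_continuous_map (submetric tilings.Self Orb) euclidean_metric f0"
    unfolding uniformly_continuous_map_sequentially_alt
  proof (intro conjI allI impI)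
    fix \<epsilon> :: real and \<rho> \<sigma> :: "nat \<Rightarrow> ('n, 'k) tile set"
    assume \<epsilon>: "0 < \<epsilon>" and "range \<rho> \<subseteq> mspace (submetric tilings.Self Orb) \<and>
        range \<sigma> \<subseteq> mspace (submetric tilings.Self Orb) \<and>
      (\<lambda>n. mdist (submetric tilings.Self Orb) (\<rho> n) (\<sigma> n)) \<longlonglongrightarrow> 0"
    then have Orb: "\<And>n. \<rho> n \<in> Orb" "\<And>n. \<sigma> n \<in> Orb" and lim: "(\<lambda>n. tiling_dist A (\<rho> n) (\<sigma> n)) \<longlonglongrightarrow> 0" by auto
    have \<rho>: "\<rho> n = shift_tiles (g (\<rho> n)) T" and \<sigma>: "\<sigma> n = shift_tiles (g (\<sigma> n)) T" for n
      using g Orb by blast+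
    have "\<exists>n. cmod (unit_char \<alpha> (g (\<rho> n) - g (\<sigma> n)) - 1) < \<epsilon>"
    proof (rule orbit_character_uniformly_continuous[OF rec per])
      show "(\<lambda>n. tiling_dist A (shift_tiles (g (\<rho> n)) T) (shift_tiles (g (\<sigma> n)) T)) \<longlonglongrightarrow> 0"
        using lim by (simp only: \<rho>[symmetric] \<sigma>[symmetric])
      show "\<exists>n. \<forall>w\<in>return_vectors. cmod (unit_char \<alpha> ((Q ^^ n) w) - 1) < e" if "e > 0" for e
        using that by (rule unif)
    qed (rule \<epsilon>)
    then obtain n where "cmod (unit_char \<alpha> (g (\<rho> n) - g (\<sigma> n)) - 1) < \<epsilon>" ..
    then have "dist (f0 (shift_tiles (g (\<rho> n)) T)) (f0 (shift_tiles (g (\<sigma> n)) T)) < \<epsilon>"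
        by (simp only: f0_dist)
    then have "dist (f0 (\<rho> n)) (f0 (\<sigma> n)) < \<epsilon>" by (simp only: \<rho>[symmetric] \<sigma>[symmetric])
    then show "\<exists>n. mdist euclidean_metric (f0 (\<rho> n)) (f0 (\<sigma> n)) < \<epsilon>" by auto
  qed auto
  moreover have "mcomplete_of (euclidean_metric :: complex metric)"
    by (simp add: mcomplete_of_def complete_UNIV)
  ultimately obtain f where f: "uniformly_continuous_map (submetric tilings.Self (mtopology_of
      tilings.Self closure_of Orb)) euclidean_metric f"
    "\<And>S. S \<in> Orb \<Longrightarrow> f S = f0 S"
    using uniformly_continuous_map_extends_to_closure_of by blast
  have top: "mtopology_of tilings.Self = tilings_topology A"
    by (simp add: mtopology_of_def tilings_topology_eq)
  have cont: "continuous_map (hull_topology A T) euclidean f"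
    using uniformly_continuous_imp_continuous_map[OF f(1)]
    by (simp add: mtopology_of_submetric top hull_topology_def hull_eq Orb_def)
  \<comment> \<open>A continuous function that vanishes on the orbit vanishes on the hull. It is
    applied to the modulus and to the eigenfunction equation.\<close>
  have closed_eq: "S \<in> XT \<Longrightarrow> h S = (0 :: complex)"
    if h: "continuous_map (hull_topology A T) euclidean h" "\<And>g. h (shift_tiles g T) = 0" for h S
  proof -
    have XT: "closedin (tilings_topology A) XT" unfolding hull_eq by simp
    have ts: "topspace (hull_topology A T) = XT" using hull_subset by (auto simp: hull_topology_def)
    have "closedin (hull_topology A T) {S \<in> topspace (hull_topology A T). h S \<in> {0}}"
      by (rule closedin_continuous_map_preimage[OF h(1)]) simp
    then have "closedin (tilings_topology A) {S \<in> XT. h S \<in> {0}}"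
      unfolding ts using XT unfolding hull_topology_def by (rule closedin_trans_full)
    then have "XT \<subseteq> {S \<in> XT. h S \<in> {0}}"
      by (rule hull_minimal) (simp add: h(2) shift_T_in_hull)
    then show "S \<in> XT \<Longrightarrow> h S = 0" by blast
  qed
  have shift_cont: "continuous_map (hull_topology A T) (hull_topology A T) (shift_tiles x)" for x
    unfolding hull_topology_def
  proof (rule continuous_map_into_subtopology)
    show "continuous_map (subtopology (tilings_topology A) XT) (tilings_topology A) (shift_tiles x)"
      by (intro continuous_map_from_subtopology continuous_map_shift)
    show "shift_tiles x \<in> topspace (subtopology (tilings_topology A) XT) \<rightarrow> XT"
      using shift_in_hull by auto
  qed
  have forb: "f (shift_tiles x T) = unit_char \<alpha> (- x)" for x
    using f(2)[of "shift_tiles x T"] f0[of x] unfolding Orb_def by simp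
  show ?thesis
  proof (intro exI[of _ f] conjI ballI allI cont)
    fix S assume S: "S \<in> XT"
    have "continuous_map (hull_topology A T) euclidean (\<lambda>S. complex_of_real (cmod (f S)) - 1)"
    proof -
      have "continuous_map euclidean euclidean (\<lambda>z :: complex. complex_of_real (cmod z) - 1)"
        unfolding continuous_map_iff_continuous2 by (intro continuous_intros)
      then show ?thesis using continuous_map_compose[OF cont, of euclidean "\<lambda>z. complex_of_real
          (cmod z) - 1"] by (simp add: o_def)
    qed
    then have "complex_of_real (cmod (f S)) - 1 = 0"
      by (rule closed_eq) (simp_all add: forb S)
    then show "cmod (f S) = 1" by (metis eq_iff_diff_eq_0 of_real_eq_1_iff)
  next
    fix S x assume S: "S \<in> XT"
    have "continuous_map (hull_topology A T) euclidean (\<lambda>S. f (shift_tiles (- x) S) - unit_char \<alpha> x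
        * f S)"
    proof (intro continuous_map_diff)
      show "continuous_map (hull_topology A T) euclidean (\<lambda>S. f (shift_tiles (- x) S))"
        using continuous_map_compose[OF shift_cont cont] by (simp add: o_def)
      have "continuous_map euclidean euclidean (\<lambda>z. unit_char \<alpha> x * z)"
        unfolding continuous_map_iff_continuous2 by (intro continuous_intros)
      then show "continuous_map (hull_topology A T) euclidean (\<lambda>S. unit_char \<alpha> x * f S)"
        using continuous_map_compose[OF cont, of euclidean "\<lambda>z. unit_char \<alpha> x * z"] by (simp add: o_def)
    qed
    then have "f (shift_tiles (- x) S) - unit_char \<alpha> x * f S = 0"
    proof (rule closed_eq)
      show "S \<in> XT" by (rule S)
      show "f (shift_tiles (- x) (shift_tiles g T)) - unit_char \<alpha> x * f (shift_tiles g T) = 0" for g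
        by (simp add: forb flip: unit_char_add)
    qed
    then show "f (shift_tiles (- x) S) = unit_char \<alpha> x * f S" by simp
  qed
qed

end

context invariant_tiling_measure
begin

text \<open>Unimodularity gives both square integrability and non-vanishing, since the measure is a
  probability.\<close>

lemma eigenfunction_of_continuous:
  assumes cont: "continuous_map (hull_topology A T) euclidean f"
    and norm: "\<And>S. S \<in> XT \<Longrightarrow> cmod (f S) = 1"
    and eq: "\<And>S x. S \<in> XT \<Longrightarrow> f (shift_tiles (- x) S) = unit_char \<alpha> x * f S"
  shows "eigenfunction \<mu> \<alpha> f"
  unfolding eigenfunction_def
proof (intro conjI allI)
  show "f \<in> borel_measurable \<mu>"
  proof (rule borel_measurableI)
    fix V :: "complex set" assume "open V"
    then have "openin (hull_topology A T) {S \<in> topspace (hull_topology A T). f S \<in> V}"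
      by (intro openin_continuous_map_preimage[OF cont]) simp
    then have "{S \<in> XT. f S \<in> V} \<in> sets \<mu>"
      using open_in_sets by (simp add: topspace_hull_topology)
    then show "f -` V \<inter> space \<mu> \<in> sets \<mu>"
      by (simp add: space_\<mu> vimage_def Collect_conj_eq Int_commute)
  qed
  have "integrable \<mu> (\<lambda>S. 1 :: real)" by simp
  then show "integrable \<mu> (\<lambda>S. (cmod (f S))\<^sup>2)"
    by (rule Bochner_Integration.integrable_cong[THEN iffD1, rotated -1]) (simp_all add: norm space_\<mu>)
  show "\<not> (AE S in \<mu>. f S = 0)"
  proof
    assume "AE S in \<mu>. f S = 0"
    then have "AE S in \<mu>. False"
      by (rule AE_mp[OF _ AE_I2]) (use norm space_\<mu> in fastforce)
    then show False by simp
  qed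
  show "AE S in \<mu>. f (shift_tiles (- x) S) = unit_char \<alpha> x * f S" for x
    by (rule AE_I2) (simp add: eq space_\<mu>)
qed

end

theorem theorem5p3:
  fixes A :: "'k::finite \<Rightarrow> (real^'n) set"
    and Q :: "real^'n \<Rightarrow> real^'n"
    and D :: "'k \<Rightarrow> 'k \<Rightarrow> (real^'n) set"
    and T :: "('n, 'k) tile set"
    and \<mu> :: "('n, 'k) tile set measure"
    and \<alpha> :: "real^'n"
  assumes "substitution_tiling A Q D T"
    and "primitive D"
    and "invariant_prob A T \<mu>"
  shows "(dyn_eigenvalue \<mu> \<alpha> \<longrightarrow> legal_limit_condition A Q D T \<alpha> \<and> period_condition T \<alpha>) \<and>
    (repetitive A T \<and> recognizable_mod_periods A Q D T \<and>
       (\<forall>z. complex_eigenvalue Q z \<longrightarrow> algebraic_int z) \<and>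
       legal_limit_condition A Q D T \<alpha> \<and> period_condition T \<alpha> \<longrightarrow>
       dyn_eigenvalue \<mu> \<alpha> \<and>
       (\<exists>f. eigenfunction \<mu> \<alpha> f \<and> continuous_map (hull_topology A T) euclidean f))"
proof -
  have ts: "tile_substitution A Q D" "T \<in> tilings A" "tile_subst A Q D T = T"
    using assms(1) by (simp_all add: substitution_tiling_def)
  then have "prototiles A" by (simp add: tile_substitution_def)
  interpret invariant_tiling_measure A Q D T \<mu>
    by unfold_locales (fact \<open>prototiles A\<close> ts assms)+
  show ?thesis
  proof (intro conjI[where P = "dyn_eigenvalue \<mu> \<alpha> \<longrightarrow> _"] impI)
    assume "dyn_eigenvalue \<mu> \<alpha>"
    then show "legal_limit_condition A Q D T \<alpha> \<and> period_condition T \<alpha>"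
      using eigenvalue_imp_legal_limit eigenvalue_imp_periods by blast
  next
    assume H: "repetitive A T \<and> recognizable_mod_periods A Q D T \<and>
       (\<forall>z. complex_eigenvalue Q z \<longrightarrow> algebraic_int z) \<and>
       legal_limit_condition A Q D T \<alpha> \<and> period_condition T \<alpha>"
    have summ: "summable (\<lambda>n. cmod (unit_char \<alpha> ((Q ^^ n) u) - 1))" if "u \<in> return_vectors" for u
    proof (rule unit_char_orbit_summable[OF linQ])
      show "algebraic_int z" if "complex_eigenvalue Q z" for z using H that by blast
      show "(\<lambda>n. unit_char \<alpha> ((Q ^^ n) u)) \<longlonglongrightarrow> 1"
        using H that return_vectors_legal unfolding legal_limit_condition_def by blast
    qed
    have unif: "\<exists>n. \<forall>w\<in>return_vectors. cmod (unit_char \<alpha> ((Q ^^ n) w) - 1) < \<epsilon>" if "\<epsilon> > 0" for \<epsilon>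
      using summ that by (rule return_vectors_uniform)
    have "recognizable_mod_periods A Q D T" "period_condition T \<alpha>" using H by blast+
    from this unif have "\<exists>f. continuous_map (hull_topology A T) euclidean f \<and> (\<forall>S\<in>XT. cmod (f S) = 1) \<and>
        (\<forall>S\<in>XT. \<forall>x. f (shift_tiles (- x) S) = unit_char \<alpha> x * f S)"
      by (rule continuous_eigenfunction_exists)
    then obtain f where f: "continuous_map (hull_topology A T) euclidean f"
      "\<And>S. S \<in> XT \<Longrightarrow> cmod (f S) = 1"
      "\<And>S x. S \<in> XT \<Longrightarrow> f (shift_tiles (- x) S) = unit_char \<alpha> x * f S"
      by blast
    then have "eigenfunction \<mu> \<alpha> f" by (rule eigenfunction_of_continuous)
    then show "dyn_eigenvalue \<mu> \<alpha> \<and> (\<exists>f. eigenfunction \<mu> \<alpha> f \<and>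
        continuous_map (hull_topology A T) euclidean f)"
      using f(1) unfolding dyn_eigenvalue_def by blast
  qed
qed

end
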